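(* Let $(M,\phi,\xi_1^*,\dots,\xi_p^* )$ be an f.pk-$\mathfrak{g}$-structure on a smooth manifold $M$ of dimension $2n+p$, where $\mathfrak{g}$ is a $p$-dimensional real Lie algebra. Then $(M,\phi,\xi_i^* )$ is normal if and only if $$[\phi,\phi]+d\eta^*=0,$$ where $d\eta^*$ is the antisymmetric tensor of type $(1,2)$ on $M$ given by $$d\eta^*(Z,T)=\sum_{i=1}^p d\eta_i(Z,T)\,\xi_i^*=\sum_{i=1}^p\big(Z(\eta_i(T))-T(\eta_i(Z))-\eta_i([Z,T])\big)\,\xi_i^* .$$ Moreover, this condition implies that $\mathfrak{g}$ is abelian.
   Context: Let $M$ be a smooth manifold of dimension $2n+p$. An f-structure on $M$ is a tensor field $\phi$ of type $(1,1)$ with $\phi^3+\phi=0$. Write $D=\operatorname{im}\phi$. If $\ker\phi$ is a $p$-dimensional parallelisable distribution and a parallelism (global frame) $\xi_1^*,\dots,\xi_p^*$ of $\ker\phi$ is chosen, $(M,\phi,\xi_i^* )$ is called an f.pk-structure. It is an f.pk-$\mathfrak{g}$-structure if the parallelism spans a Lie algebra $\mathfrak{g}$: there is an injective Lie algebra homomorphism ${}^*:\mathfrak{g}\to\chi(M)$ from a $p$-dimensional real Lie algebra $\mathfrak{g}$ into the vector fields on $M$, whose image spans $\ker\phi$, and a basis $\xi_1,\dots,\xi_p$ of $\mathfrak{g}$ with ${}^*(\xi_i)=\xi_i^*$. Then $TM=\ker\phi\oplus D$, and one-forms $\eta_i$ are defined by $\eta_i(\xi_j^* )=\delta_{ij}$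 and $\eta_i|_D=0$. Put $\eta(X)=\sum_{i=1}^p\eta_i(X)\,\xi_i$ (a $\mathfrak{g}$-valued one-form on $M$) and $\eta^*(X)=\sum_i\eta_i(X)\,\xi_i^*$; thus $\phi^2=-I+\eta^*$. For a $(1,1)$-tensor $A$, the Nijenhuis tensor is $[A,A](X,Y)=A^2[X,Y]+[AX,AY]-A[AX,Y]-A[X,AY]$. Let $G$ be the simply connected Lie group with Lie algebra $\mathfrak{g}$, with elements of $\mathfrak{g}$ regarded as left-invariant vector fields on $G$, so that $T(M\times G)=D\oplus\operatorname{span}\{\xi_i^*\}\oplus\operatorname{span}\{\xi_i\}$. Define an almost complex structure on $M\times G$ by $J(X,\xi)=(\phi X-\xi^*,\eta(X))$, where $(X,\xi)$ denotes the $TM$- and $TG$-parts and, pointwise, $\xi=\sum_i a_i\xi_i$ gives $\xi^*=\sum_i a_i\xi_i^*$; that is, $J=\phi$ on $D$, $J\xi_i^*=\xi_i$, $J\xi_i=-\xi_i^*$. The f.pk-$\mathfrak{g}$-structure $(M,\phi,\xi_i^* )$ is called normal if $J$ is integrable (equivalently, $[J,J]=0$). *)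

theory Defs
  imports "HOL-Analysis.Analysis" "HOL-Library.Function_Algebras"
begin

(* Real functions, and hence tangent vectors and vector fields below, form a
   real vector space under the pointwise operations. *)
instantiation "fun" :: (type, real_vector) real_vector
begin

definition scaleR_fun :: "real \<Rightarrow> ('a \<Rightarrow> 'b) \<Rightarrow> 'a \<Rightarrow> 'b"
  where "scaleR_fun c f = (\<lambda>x. c *\<^sub>R f x)"

instance
  by standard (simp_all add: scaleR_fun_def fun_eq_iff scaleR_add_right scaleR_add_left)

end

definition is_basis :: "nat \<Rightarrow> 'v::real_vector set \<Rightarrow> (nat \<Rightarrow> 'v) \<Rightarrow> bool"
  where "is_basis k V b \<longleftrightarrow>
    inj_on b {..<k} \<and> independent (b ` {..<k}) \<and> span (b ` {..<k}) = V"


subsection \<open>Smooth manifolds\<close>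

(* All derivatives in constant directions; on an open subset of a
   finite-dimensional space this is the usual class C^k. *)
primrec Ck_on :: "nat \<Rightarrow> 'a::real_normed_vector set \<Rightarrow> ('a \<Rightarrow> 'b::real_normed_vector) \<Rightarrow> bool"
  where
    "Ck_on 0 S f \<longleftrightarrow> continuous_on S f"
  | "Ck_on (Suc k) S f \<longleftrightarrow>
       (\<forall>x\<in>S. f differentiable (at x)) \<and>
       (\<forall>v. Ck_on k S (\<lambda>x. frechet_derivative f (at x) v))"

definition smooth_on :: "'a::real_normed_vector set \<Rightarrow> ('a \<Rightarrow> 'b::real_normed_vector) \<Rightarrow> bool"
  where "smooth_on S f \<longleftrightarrow> (\<forall>k. Ck_on k S f)"

(* A chart is a domain together with a coordinate map; the inverse on the image
   is inv_into U psi. *)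
type_synonym ('m, 'e) atlas = "('m set \<times> ('m \<Rightarrow> 'e)) set"

(* The manifold is the whole type 'm.  The model space is any finite-dimensional
   inner product space; the class euclidean_space is not used because it
   excludes dimension 0. *)
definition smooth_manifold ::
  "nat \<Rightarrow> ('m::{t2_space,second_countable_topology}, 'e::{real_inner,heine_borel}) atlas \<Rightarrow> bool"
  where "smooth_manifold d A \<longleftrightarrow>
    (\<exists>b. is_basis d (UNIV :: 'e set) b) \<and>
    (\<Union>(U, \<psi>)\<in>A. U) = UNIV \<and>
    (\<forall>(U, \<psi>)\<in>A. open U \<and> open (\<psi> ` U) \<and> homeomorphism U (\<psi> ` U) \<psi> (inv_into U \<psi>)) \<and>
    (\<forall>(U, \<psi>)\<in>A. \<forall>(V, \<theta>)\<in>A. smooth_on (\<psi> ` (U \<inter> V)) (\<theta> \<circ> inv_into U \<psi>))"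

definition smooth_map_at ::
  "('m::topological_space, 'e::real_normed_vector) atlas \<Rightarrow>
   ('n::topological_space, 'f::real_normed_vector) atlas \<Rightarrow> ('m \<Rightarrow> 'n) \<Rightarrow> 'm \<Rightarrow> bool"
  where "smooth_map_at A B F x \<longleftrightarrow>
    (\<exists>(U, \<psi>)\<in>A. \<exists>(V, \<theta>)\<in>B. \<exists>W. open W \<and> x \<in> W \<and> W \<subseteq> U \<and> F ` W \<subseteq> V \<and>
       smooth_on (\<psi> ` W) (\<theta> \<circ> F \<circ> inv_into U \<psi>))"

definition smooth_map ::
  "('m::topological_space, 'e::real_normed_vector) atlas \<Rightarrow>
   ('n::topological_space, 'f::real_normed_vector) atlas \<Rightarrow> ('m \<Rightarrow> 'n) \<Rightarrow> bool"
  where "smooth_map A B F \<longleftrightarrow> (\<forall>x. smooth_map_at A B F x)"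

definition real_atlas :: "(real, real) atlas"
  where "real_atlas = {(UNIV, id)}"

(* f is smooth on some neighbourhood of x *)
abbreviation smooth_fun_at ::
  "('m::topological_space, 'e::real_normed_vector) atlas \<Rightarrow> ('m \<Rightarrow> real) \<Rightarrow> 'm \<Rightarrow> bool"
  where "smooth_fun_at A f x \<equiv> smooth_map_at A real_atlas f x"

definition prod_atlas :: "('m, 'e) atlas \<Rightarrow> ('n, 'f) atlas \<Rightarrow> ('m \<times> 'n, 'e \<times> 'f) atlas"
  where "prod_atlas A B = {(U \<times> V, map_prod \<psi> \<theta>) | U \<psi> V \<theta>. (U, \<psi>) \<in> A \<and> (V, \<theta>) \<in> B}"


subsection \<open>Tangent vectors and vector fields\<close>

(* Tangent vectors at x act on the functions smooth near x; their value on any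
   other function is fixed to be 0, so that equal tangent vectors are equal
   functionals. *)
type_synonym 'm tvec = "('m \<Rightarrow> real) \<Rightarrow> real"
type_synonym 'm vfield = "'m \<Rightarrow> 'm tvec"

(* The directional derivatives at x, read in charts. *)
definition tangent_space ::
  "('m::topological_space, 'e::real_normed_vector) atlas \<Rightarrow> 'm \<Rightarrow> 'm tvec set"
  where "tangent_space A x =
    {v. \<exists>(U, \<psi>)\<in>A. \<exists>w. x \<in> U \<and>
       v = (\<lambda>f. if smooth_fun_at A f x
                then frechet_derivative (f \<circ> inv_into U \<psi>) (at (\<psi> x)) w else 0)}"

definition vector_fields ::
  "('m::topological_space, 'e::real_normed_vector) atlas \<Rightarrow> 'm vfield set"
  where "vector_fields A =
    {X. (\<forall>x. X x \<in> tangent_space A x) \<and>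
        (\<forall>f x. smooth_fun_at A f x \<longrightarrow> smooth_fun_at A (\<lambda>y. X y f) x)}"

definition lie_bracket ::
  "('m::topological_space, 'e::real_normed_vector) atlas \<Rightarrow> 'm vfield \<Rightarrow> 'm vfield \<Rightarrow> 'm vfield"
  where "lie_bracket A X Y = (\<lambda>x f.
    if smooth_fun_at A f x then X x (\<lambda>y. Y y f) - Y x (\<lambda>y. X y f) else 0)"

(* The differential of F at x; A and B are atlases of its domain and codomain,
   of which only B enters. *)
definition differential ::
  "('n::topological_space, 'f::real_normed_vector) atlas \<Rightarrow> ('m \<Rightarrow> 'n) \<Rightarrow> 'm \<Rightarrow> 'm tvec \<Rightarrow> 'n tvec"
  where "differential B F x v = (\<lambda>f. if smooth_fun_at B f (F x) then v (f \<circ> F) else 0)"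

definition app_field :: "('m \<Rightarrow> 'm tvec \<Rightarrow> 'm tvec) \<Rightarrow> 'm vfield \<Rightarrow> 'm vfield"
  where "app_field \<phi> X = (\<lambda>x. \<phi> x (X x))"

definition tensor11 ::
  "('m::topological_space, 'e::real_normed_vector) atlas \<Rightarrow> ('m \<Rightarrow> 'm tvec \<Rightarrow> 'm tvec) \<Rightarrow> bool"
  where "tensor11 A \<phi> \<longleftrightarrow>
    (\<forall>x. \<forall>v\<in>tangent_space A x. \<phi> x v \<in> tangent_space A x) \<and>
    (\<forall>x. \<forall>v\<in>tangent_space A x. \<forall>w\<in>tangent_space A x. \<phi> x (v + w) = \<phi> x v + \<phi> x w) \<and>
    (\<forall>x c. \<forall>v\<in>tangent_space A x. \<phi> x (c *\<^sub>R v) = c *\<^sub>R \<phi> x v) \<and>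
    (\<forall>X\<in>vector_fields A. app_field \<phi> X \<in> vector_fields A)"

definition nijenhuis ::
  "('m::topological_space, 'e::real_normed_vector) atlas \<Rightarrow> ('m \<Rightarrow> 'm tvec \<Rightarrow> 'm tvec) \<Rightarrow>
   'm vfield \<Rightarrow> 'm vfield \<Rightarrow> 'm vfield"
  where "nijenhuis A \<phi> X Y =
    app_field \<phi> (app_field \<phi> (lie_bracket A X Y)) + lie_bracket A (app_field \<phi> X) (app_field \<phi> Y)
    - app_field \<phi> (lie_bracket A (app_field \<phi> X) Y) - app_field \<phi> (lie_bracket A X (app_field \<phi> Y))"


subsection \<open>Lie algebras and Lie groups\<close>

definition lie_algebra :: "('l::real_vector \<Rightarrow> 'l \<Rightarrow> 'l) \<Rightarrow> bool"
  where "lie_algebra br \<longleftrightarrow>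
    (\<forall>a. linear (br a)) \<and> (\<forall>b. linear (\<lambda>a. br a b)) \<and>
    (\<forall>a. br a a = 0) \<and>
    (\<forall>a b c. br a (br b c) + br b (br c a) + br c (br a b) = 0)"

definition abelian_lie_algebra :: "('l::real_vector \<Rightarrow> 'l \<Rightarrow> 'l) \<Rightarrow> bool"
  where "abelian_lie_algebra br \<longleftrightarrow> (\<forall>a b. br a b = 0)"

definition lie_group ::
  "nat \<Rightarrow> ('g::{t2_space,second_countable_topology}, 'h::{real_inner,heine_borel}) atlas \<Rightarrow>
   ('g \<Rightarrow> 'g \<Rightarrow> 'g) \<Rightarrow> bool"
  where "lie_group d B mul \<longleftrightarrow>
    smooth_manifold d B \<and>
    smooth_map (prod_atlas B B) B (\<lambda>(a, b). mul a b) \<and>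
    (\<exists>e i. Groups.group mul e i \<and> smooth_map B B i)"

definition left_invariant_fields ::
  "('g::topological_space, 'h::real_normed_vector) atlas \<Rightarrow> ('g \<Rightarrow> 'g \<Rightarrow> 'g) \<Rightarrow> 'g vfield set"
  where "left_invariant_fields B mul =
    {X \<in> vector_fields B. \<forall>a b. differential B (mul a) b (X b) = X (mul a b)}"

(* L identifies the Lie algebra with that of left-invariant vector fields. *)
definition lie_algebra_of_group ::
  "('g::topological_space, 'h::real_normed_vector) atlas \<Rightarrow> ('g \<Rightarrow> 'g \<Rightarrow> 'g) \<Rightarrow>
   ('l::real_vector \<Rightarrow> 'l \<Rightarrow> 'l) \<Rightarrow> ('l \<Rightarrow> 'g vfield) \<Rightarrow> bool"
  where "lie_algebra_of_group B mul br L \<longleftrightarrow>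
    linear L \<and> bij_betw L UNIV (left_invariant_fields B mul) \<and>
    (\<forall>a b. L (br a b) = lie_bracket B (L a) (L b))"


subsection \<open>f.pk-structures with a Lie algebra of characteristic fields\<close>

definition f_structure ::
  "('m::topological_space, 'e::real_normed_vector) atlas \<Rightarrow> ('m \<Rightarrow> 'm tvec \<Rightarrow> 'm tvec) \<Rightarrow> bool"
  where "f_structure A \<phi> \<longleftrightarrow>
    tensor11 A \<phi> \<and> (\<forall>x. \<forall>v\<in>tangent_space A x. \<phi> x (\<phi> x (\<phi> x v)) + \<phi> x v = 0)"

(* xs i, for i < p, is a global frame of ker phi. *)
definition fpk_structure ::
  "('m::topological_space, 'e::real_normed_vector) atlas \<Rightarrow> nat \<Rightarrow> ('m \<Rightarrow> 'm tvec \<Rightarrow> 'm tvec) \<Rightarrow>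
   (nat \<Rightarrow> 'm vfield) \<Rightarrow> bool"
  where "fpk_structure A p \<phi> xs \<longleftrightarrow>
    f_structure A \<phi> \<and> (\<forall>i<p. xs i \<in> vector_fields A) \<and>
    (\<forall>x. is_basis p {v \<in> tangent_space A x. \<phi> x v = 0} (\<lambda>i. xs i x))"

(* star is the homomorphism from the Lie algebra to the vector fields on M;
   xi is the chosen basis, so that star (xi i) is the chosen parallelism. *)
definition fpkg_structure ::
  "('m::topological_space, 'e::real_normed_vector) atlas \<Rightarrow> nat \<Rightarrow> ('m \<Rightarrow> 'm tvec \<Rightarrow> 'm tvec) \<Rightarrow>
   ('l::real_vector \<Rightarrow> 'l \<Rightarrow> 'l) \<Rightarrow> (nat \<Rightarrow> 'l) \<Rightarrow> ('l \<Rightarrow> 'm vfield) \<Rightarrow> bool"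
  where "fpkg_structure A p \<phi> br \<xi> star \<longleftrightarrow>
    lie_algebra br \<and> is_basis p UNIV \<xi> \<and>
    linear star \<and> inj star \<and> range star \<subseteq> vector_fields A \<and>
    (\<forall>a b. star (br a b) = lie_bracket A (star a) (star b)) \<and>
    fpk_structure A p \<phi> (\<lambda>i. star (\<xi> i))"

(* The one-forms dual to the frame and vanishing on im phi. *)
definition eta ::
  "('m::topological_space, 'e::real_normed_vector) atlas \<Rightarrow> nat \<Rightarrow> ('m \<Rightarrow> 'm tvec \<Rightarrow> 'm tvec) \<Rightarrow>
   (nat \<Rightarrow> 'm vfield) \<Rightarrow> nat \<Rightarrow> 'm \<Rightarrow> 'm tvec \<Rightarrow> real"
  where "eta A p \<phi> xs i x = (THE h.
    (\<forall>v\<in>tangent_space A x. \<forall>w\<in>tangent_space A x. h (v + w) = h v + h w) \<and>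
    (\<forall>c. \<forall>v\<in>tangent_space A x. h (c *\<^sub>R v) = c * h v) \<and>
    (\<forall>v. v \<notin> tangent_space A x \<longrightarrow> h v = 0) \<and>
    (\<forall>j<p. h (xs j x) = (if i = j then 1 else 0)) \<and>
    (\<forall>v\<in>tangent_space A x. h (\<phi> x v) = 0))"

definition d_form ::
  "('m::topological_space, 'e::real_normed_vector) atlas \<Rightarrow> ('m \<Rightarrow> 'm tvec \<Rightarrow> real) \<Rightarrow>
   'm vfield \<Rightarrow> 'm vfield \<Rightarrow> 'm \<Rightarrow> real"
  where "d_form A \<omega> Z T x =
    Z x (\<lambda>y. \<omega> y (T y)) - T x (\<lambda>y. \<omega> y (Z y)) - \<omega> x (lie_bracket A Z T x)"

definition d_eta_star ::
  "('m::topological_space, 'e::real_normed_vector) atlas \<Rightarrow> nat \<Rightarrow> ('m \<Rightarrow> 'm tvec \<Rightarrow> 'm tvec) \<Rightarrow>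
   (nat \<Rightarrow> 'm vfield) \<Rightarrow> 'm vfield \<Rightarrow> 'm vfield \<Rightarrow> 'm vfield"
  where "d_eta_star A p \<phi> xs Z T = (\<lambda>x. \<Sum>i<p. d_form A (eta A p \<phi> xs i) Z T x *\<^sub>R xs i x)"


subsection \<open>The almost complex structure on the product with the Lie group\<close>

(* The vector of T_g G with coefficients a_i in the frame ls is sent to the
   vector of T_x M with the same coefficients in the frame xs. *)
definition star_at ::
  "nat \<Rightarrow> (nat \<Rightarrow> 'm vfield) \<Rightarrow> (nat \<Rightarrow> 'g vfield) \<Rightarrow> 'm \<Rightarrow> 'g \<Rightarrow> 'g tvec \<Rightarrow> 'm tvec"
  where "star_at p xs ls x g v =
    (THE u. \<exists>a :: nat \<Rightarrow> real. v = (\<Sum>i<p. a i *\<^sub>R ls i g) \<and> u = (\<Sum>i<p. a i *\<^sub>R xs i x))"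

(* The splitting of T_(x,g) (M x G) is given by the differentials of the two
   projections and of the two inclusions y |-> (y, g) and h |-> (x, h). *)
definition product_J ::
  "('m::topological_space, 'e::real_normed_vector) atlas \<Rightarrow>
   ('g::topological_space, 'h::real_normed_vector) atlas \<Rightarrow>
   nat \<Rightarrow> ('m \<Rightarrow> 'm tvec \<Rightarrow> 'm tvec) \<Rightarrow> (nat \<Rightarrow> 'm vfield) \<Rightarrow> (nat \<Rightarrow> 'g vfield) \<Rightarrow>
   'm \<times> 'g \<Rightarrow> ('m \<times> 'g) tvec \<Rightarrow> ('m \<times> 'g) tvec"
  where "product_J A B p \<phi> xs ls = (\<lambda>(x, g) w.
    let X = differential A fst (x, g) w;
        v = differential B snd (x, g) w
    in differential (prod_atlas A B) (\<lambda>y. (y, g)) x (\<phi> x X - star_at p xs ls x g v)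
     + differential (prod_atlas A B) (\<lambda>h. (x, h)) g (\<Sum>i<p. eta A p \<phi> xs i x X *\<^sub>R ls i g))"

(* L realises the Lie algebra as left-invariant vector fields on G.
   Integrability of J means that its Nijenhuis tensor vanishes. *)
definition normal_fpkg ::
  "('m::topological_space, 'e::real_normed_vector) atlas \<Rightarrow>
   ('g::topological_space, 'h::real_normed_vector) atlas \<Rightarrow>
   nat \<Rightarrow> ('m \<Rightarrow> 'm tvec \<Rightarrow> 'm tvec) \<Rightarrow> (nat \<Rightarrow> 'l::real_vector) \<Rightarrow>
   ('l \<Rightarrow> 'm vfield) \<Rightarrow> ('l \<Rightarrow> 'g vfield) \<Rightarrow> bool"
  where "normal_fpkg A B p \<phi> \<xi> star L \<longleftrightarrow>
    (let P = prod_atlas A B;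
         J = product_J A B p \<phi> (\<lambda>i. star (\<xi> i)) (\<lambda>i. L (\<xi> i))
     in \<forall>X\<in>vector_fields P. \<forall>Y\<in>vector_fields P. nijenhuis P J X Y = 0)"

end

theory Submission
  imports Defs
begin

text \<open>
  Write C for the tensor [\<phi>, \<phi>] + d\<eta>*, and lift fields X, Y from M to M x G. The M-part of
  [J, J](X, Y) is C(X, Y), and its G-part has the components
  d\<eta>_j(\<phi> X, Y) + d\<eta>_j(X, \<phi> Y) + (\<Sum>\<eta>_i(X) \<eta>_k(Y) [\<xi>_i, \<xi>_k])_j in the frame of left-invariant fields; so
  normality gives C = 0. Conversely let C = 0. Applying \<eta>_j to C(X, Y) yields
  d\<eta>_j(X, Y) = d\<eta>_j(\<phi> X, \<phi> Y). For X = \<xi>_i* the right-hand side vanishes, so the Lie algebra is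
  abelian; for \<phi> X in place of X, together with \<phi>^2 = -I + \<eta>*, it follows that the remaining
  terms of the G-part cancel. Hence [J, J] vanishes on lifts from M. Since
  [J, J](JX, Y) = -J [J, J](X, Y) and J \<xi>_i* = \<xi>_i, it also vanishes on the left-invariant fields, and
  therefore everywhere, because it is a tensor and all these fields span the tangent spaces.
\<close>

subsection \<open>Calculus of smooth functions\<close>

text \<open>Under \<eta>_j all terms of [\<phi>, \<phi>](X, Y) with an outer \<phi> vanish and
  \<eta>_j([\<phi> X, \<phi> Y]) is left; since \<eta>_j \<circ> \<phi> = 0, this is
  -d\<eta>_j(\<phi> X, \<phi> Y), which explains the identity drawn from C = 0.

  The obstacle is the passage from lifts to all fields. A tensor of type (1,1) must carry smooth
  global fields to smooth global fields, and for J this has to be proved before J can be treated as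
  a tensor. Smooth coefficients are needed for the forms \<eta>_i, which are defined point by point,
  for the frame of left-invariant fields, and for the coordinate fields of M, which exist only
  locally. Gaussian elimination settles the forms and the frame, bump functions the coordinate
  fields. Tangent vectors are functionals, so they are compared on coordinate functions, and on M x
  G on functions pulled back from one factor.\<close>

lemma Ck_on_cong:
  assumes "open S" "\<And>x. x \<in> S \<Longrightarrow> f x = g x" "Ck_on k S f"
  shows "Ck_on k S g"
  using assms(2,3)
proof (induction k arbitrary: f g)
  case 0
  then show ?case using continuous_on_cong[of S S f g] by simp
next
  case (Suc k)
  have der: "(g has_derivative frechet_derivative f (at x)) (at x)" if "x \<in> S" for x
  proof -
    have "(f has_derivative frechet_derivative f (at x)) (at x)"
      using Suc.prems(2) that frechet_derivative_works by auto
    then show ?thesis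
      using has_derivative_transform_within_open[OF _ assms(1) that] Suc.prems(1) by blast
  qed
  have "frechet_derivative f (at x) = frechet_derivative g (at x)" if "x \<in> S" for x
    using frechet_derivative_at[OF der[OF that]] by simp
  then have "Ck_on k S (\<lambda>x. frechet_derivative g (at x) v)" for v
    using Suc.IH[of "\<lambda>x. frechet_derivative f (at x) v"] Suc.prems(2) by simp
  with der show ?case by (auto simp: differentiable_def)
qed

text \<open>Uniqueness of the derivative lets any family \<open>f'\<close> stand in for the choice
  made by \<open>frechet_derivative\<close>, so that the closure properties below can name their
  derivatives explicitly.\<close>

lemma Ck_on_SucI:
  assumes "open S" "\<And>x. x \<in> S \<Longrightarrow> (f has_derivative f' x) (at x)"
    and "\<And>v. Ck_on k S (\<lambda>x. f' x v)"
  shows "Ck_on (Suc k) S f"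
proof -
  have "Ck_on k S (\<lambda>x. frechet_derivative f (at x) v)" for v
    by (rule Ck_on_cong[OF assms(1) _ assms(3)[of v]])
       (use frechet_derivative_at[OF assms(2)] in simp)
  then show ?thesis using assms(2) by (auto simp: differentiable_def)
qed

lemma Ck_on_SucD:
  assumes "Ck_on (Suc k) S f" "x \<in> S"
  shows "(f has_derivative frechet_derivative f (at x)) (at x)"
  using assms frechet_derivative_works by auto

lemma Ck_on_Suc_imp: "Ck_on (Suc k) S f \<Longrightarrow> Ck_on k S f"
proof (induction k arbitrary: f)
  case 0
  then show ?case
    by (auto intro!: continuous_at_imp_continuous_on differentiable_imp_continuous_within)
next
  case (Suc k)
  have "Ck_on k S (\<lambda>x. frechet_derivative f (at x) v)" for v
    using Suc.IH[of "\<lambda>x. frechet_derivative f (at x) v"] Suc.prems by simp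
  then show ?case using Suc.prems by simp
qed

lemma Ck_on_subset: "Ck_on k S f \<Longrightarrow> T \<subseteq> S \<Longrightarrow> Ck_on k T f"
  by (induction k arbitrary: f) (auto intro: continuous_on_subset)

lemma Ck_on_const: "open S \<Longrightarrow> Ck_on k S (\<lambda>x. c)"
proof (induction k arbitrary: c)
  case (Suc k)
  show ?case
    by (rule Ck_on_SucI[of _ _ "\<lambda>x v. 0"]) (use Suc in \<open>auto\<close>)
qed auto

lemma Ck_on_add:
  assumes "open S" "Ck_on k S f" "Ck_on k S g"
  shows "Ck_on k S (\<lambda>x. f x + g x)"
  using assms(2,3)
proof (induction k arbitrary: f g)
  case (Suc k)
  have d: "Ck_on k S (\<lambda>x. frechet_derivative f (at x) v)"
    "Ck_on k S (\<lambda>x. frechet_derivative g (at x) v)" for v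
    using Suc.prems by auto
  show ?case
    by (rule Ck_on_SucI[OF assms(1) has_derivative_add])
       (rule Ck_on_SucD Suc.prems Suc.IH d | assumption)+
qed (auto intro: continuous_intros)

lemma Ck_on_bounded_linear:
  assumes "open S" "Ck_on k S f" "bounded_linear h"
  shows "Ck_on k S (\<lambda>x. h (f x))"
  using assms(2)
proof (induction k arbitrary: f)
  case 0
  then show ?case using bounded_linear.continuous_on[OF assms(3)] by auto
next
  case (Suc k)
  have d: "Ck_on k S (\<lambda>x. frechet_derivative f (at x) v)" for v
    using Suc.prems by auto
  show ?case
    by (rule Ck_on_SucI[OF assms(1) bounded_linear.has_derivative[OF assms(3)]])
       (rule Ck_on_SucD Suc.prems Suc.IH d | assumption)+
qed

text \<open>By the product rule the derivative is a sum of two expressions of the same bilinear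
  form. Each has one undifferentiated factor, whose order is lowered by
  \<open>Ck_on_Suc_imp\<close>, so the induction runs over all pairs f, g at once.\<close>

lemma Ck_on_bounded_bilinear:
  assumes "open S" "Ck_on k S f" "Ck_on k S g" "bounded_bilinear h"
  shows "Ck_on k S (\<lambda>x. h (f x) (g x))"
  using assms(2,3)
proof (induction k arbitrary: f g)
  case 0
  then show ?case using bounded_bilinear.continuous_on[OF assms(4)] by auto
next
  case (Suc k)
  have d: "Ck_on k S (\<lambda>x. frechet_derivative f (at x) v)"
    "Ck_on k S (\<lambda>x. frechet_derivative g (at x) v)" for v
    using Suc.prems by auto
  show ?case
    by (rule Ck_on_SucI[OF assms(1) bounded_bilinear.FDERIV[OF assms(4)]])
       (rule Ck_on_SucD Suc.prems Ck_on_add Suc.IH d Ck_on_Suc_imp assms | assumption)+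
qed

lemma Ck_on_sum:
  assumes "open S" "\<And>i. i \<in> I \<Longrightarrow> Ck_on k S (f i)"
  shows "Ck_on k S (\<lambda>x. \<Sum>i\<in>I. f i x)"
  using assms(2)
proof (induction I rule: infinite_finite_induct)
  case (insert i I)
  then show ?case using Ck_on_add[OF assms(1), of k "f i" "\<lambda>x. \<Sum>i\<in>I. f i x"] by simp
qed (simp_all add: Ck_on_const[OF assms(1)])

text \<open>A finite generating set with dual vectors, as a substitute for the orthonormal basis of
  the class euclidean_space, which excludes dimension 0.\<close>
definition coframe :: "'a::real_inner set \<Rightarrow> ('a \<Rightarrow> 'a) \<Rightarrow> bool"
  where "coframe C d \<longleftrightarrow> finite C \<and> (\<forall>v. (\<Sum>c\<in>C. (v \<bullet> d c) *\<^sub>R c) = v)"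

lemma coframe_exists:
  assumes "finite D" "span D = (UNIV :: 'a::real_inner set)"
  obtains C d where "coframe C (d :: 'a \<Rightarrow> 'a)"
proof -
  from basis_orthogonal[OF assms(1)] obtain C :: "'a set" where C: "finite C" "span C = UNIV"
    "pairwise orthogonal C" using assms(2) by metis
  \<comment> \<open>The orthogonal set C may contain 0; the summand of that element vanishes
    whatever its coefficient, here 1 / 0 = 0.\<close>
  have "(\<Sum>c\<in>C. (v \<bullet> ((1 / (c \<bullet> c)) *\<^sub>R c)) *\<^sub>R c) = v" for v
  proof -
    obtain a where a: "v = (\<Sum>c\<in>C. a c *\<^sub>R c)"
      using span_finite[OF C(1)] C(2) by (auto simp: set_eq_iff image_iff)
    have "v \<bullet> c = a c * (c \<bullet> c)" if "c \<in> C" for c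
    proof -
      have "v \<bullet> c = (\<Sum>b\<in>C. a b * (b \<bullet> c))" by (simp add: a inner_sum_left)
      also have "\<dots> = (\<Sum>b\<in>C. if b = c then a c * (c \<bullet> c) else 0)"
        using C(3) that by (intro sum.cong) (auto simp: pairwise_def orthogonal_def)
      finally show ?thesis using C(1) that by simp
    qed
    then have "(\<Sum>c\<in>C. (v \<bullet> ((1 / (c \<bullet> c)) *\<^sub>R c)) *\<^sub>R c) = (\<Sum>c\<in>C. a c *\<^sub>R c)"
      by (intro sum.cong) auto
    then show ?thesis using a by simp
  qed
  then show ?thesis using that[of C "\<lambda>c. (1 / (c \<bullet> c)) *\<^sub>R c"] C(1) by (simp add: coframe_def)
qed

lemma coframe_linear:
  assumes "coframe C d" "linear h"
  shows "h v = (\<Sum>c\<in>C. (v \<bullet> d c) *\<^sub>R h c)"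
proof -
  have "h v = h (\<Sum>c\<in>C. (v \<bullet> d c) *\<^sub>R c)" using assms(1) by (simp add: coframe_def)
  also have "\<dots> = (\<Sum>c\<in>C. (v \<bullet> d c) *\<^sub>R h c)"
    using assms(2) by (simp add: linear_sum linear_scale)
  finally show ?thesis .
qed

text \<open>The chain rule gives g'(f x) in the direction f'(x) v, which varies with x, whereas
  \<open>Ck_on\<close> controls constant directions only. The coframe expands it into finitely many
  constant directions c with coefficients of class C^k; this is where the finite dimension of the
  middle space enters.\<close>

lemma Ck_on_compose:
  fixes f :: "'a::real_normed_vector \<Rightarrow> 'b::real_inner" and g :: "'b \<Rightarrow> 'c::real_normed_vector"
  assumes "coframe C (d :: 'b \<Rightarrow> 'b)" "open S" "open T" "Ck_on k S f" "Ck_on k T g" "f ` S \<subseteq> T"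
  shows "Ck_on k S (\<lambda>x. g (f x))"
  using assms(4-5)
proof (induction k arbitrary: g)
  case 0
  then show ?case using assms(6) continuous_on_compose2[of T g S f] by simp
next
  case (Suc k)
  let ?Df = "\<lambda>x. frechet_derivative f (at x)" and ?Dg = "\<lambda>y. frechet_derivative g (at y)"
  have der: "((\<lambda>x. g (f x)) has_derivative (\<lambda>v. \<Sum>c\<in>C. (?Df x v \<bullet> d c) *\<^sub>R ?Dg (f x) c)) (at x)"
    if "x \<in> S" for x
  proof -
    have f: "(f has_derivative ?Df x) (at x)" using Suc.prems(1) that Ck_on_SucD by blast
    have g: "(g has_derivative ?Dg (f x)) (at (f x))"
      using Suc.prems(2) that Ck_on_SucD assms(6) by blast
    have "((\<lambda>x. g (f x)) has_derivative (\<lambda>v. ?Dg (f x) (?Df x v))) (at x)"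
      using diff_chain_at[OF f g] by (simp add: o_def)
    moreover have "?Dg (f x) (?Df x v) = (\<Sum>c\<in>C. (?Df x v \<bullet> d c) *\<^sub>R ?Dg (f x) c)" for v
      by (rule coframe_linear[OF assms(1) has_derivative_linear[OF g]])
    ultimately show ?thesis by simp
  qed
  show ?case
  proof (rule Ck_on_SucI[OF assms(2) der])
    fix v
    have "Ck_on k S (\<lambda>x. ?Dg (f x) c)" for c
      using Suc.IH[of "\<lambda>y. ?Dg y c"] Suc.prems Ck_on_Suc_imp by auto
    moreover have "Ck_on k S (\<lambda>x. ?Df x v \<bullet> d c)" for c
      using Ck_on_bounded_linear[OF assms(2), of k "\<lambda>x. ?Df x v" "\<lambda>u. u \<bullet> d c"]
        Suc.prems(1) by (simp add: bounded_linear_inner_left)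
    ultimately show "Ck_on k S (\<lambda>x. \<Sum>c\<in>C. (?Df x v \<bullet> d c) *\<^sub>R ?Dg (f x) c)"
      by (intro Ck_on_sum[OF assms(2)] Ck_on_bounded_bilinear[OF assms(2) _ _ bounded_bilinear_scaleR])
  qed
qed

text \<open>The inverse reappears in its own derivative, but there only order k is required, which
  the induction hypothesis supplies.\<close>

lemma Ck_on_inverse:
  fixes f :: "'a::real_normed_vector \<Rightarrow> real"
  assumes "open S" "Ck_on k S f" "\<And>x. x \<in> S \<Longrightarrow> f x \<noteq> 0"
  shows "Ck_on k S (\<lambda>x. inverse (f x))"
  using assms(2)
proof (induction k)
  case 0
  then show ?case using assms(3) by (auto intro!: continuous_intros)
next
  case (Suc k)
  have i: "Ck_on k S (\<lambda>x. inverse (f x))" using Suc Ck_on_Suc_imp by blast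
  have "((\<lambda>x. inverse (f x)) has_derivative
      (\<lambda>v. - 1 * (inverse (f x) * frechet_derivative f (at x) v * inverse (f x)))) (at x)"
    if "x \<in> S" for x
    using Deriv.has_derivative_inverse[OF assms(3)[OF that] Ck_on_SucD[OF Suc.prems that]] by simp
  moreover have "Ck_on k S (\<lambda>x. - 1 * (inverse (f x) * frechet_derivative f (at x) v * inverse (f x)))" for v
    using i Suc.prems
    by (intro Ck_on_bounded_bilinear[OF assms(1) _ _ bounded_bilinear_mult] Ck_on_const[OF assms(1)]) auto
  ultimately show ?case by (rule Ck_on_SucI[OF assms(1)])
qed

section \<open>Closure properties of smooth functions on open sets\<close>

lemma smooth_on_cong:
  "open S \<Longrightarrow> (\<And>x. x \<in> S \<Longrightarrow> f x = g x) \<Longrightarrow> smooth_on S f \<Longrightarrow> smooth_on S g"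
  unfolding smooth_on_def using Ck_on_cong by metis

lemma smooth_on_subset: "smooth_on S f \<Longrightarrow> T \<subseteq> S \<Longrightarrow> smooth_on T f"
  unfolding smooth_on_def using Ck_on_subset by metis

lemma smooth_on_const: "open S \<Longrightarrow> smooth_on S (\<lambda>x. c)"
  unfolding smooth_on_def using Ck_on_const by metis

lemma smooth_on_add:
  "open S \<Longrightarrow> smooth_on S f \<Longrightarrow> smooth_on S g \<Longrightarrow> smooth_on S (\<lambda>x. f x + g x)"
  unfolding smooth_on_def using Ck_on_add by metis

lemma smooth_on_mult:
  fixes f g :: "_ \<Rightarrow> real"
  shows "open S \<Longrightarrow> smooth_on S f \<Longrightarrow> smooth_on S g \<Longrightarrow> smooth_on S (\<lambda>x. f x * g x)"
  unfolding smooth_on_def using Ck_on_bounded_bilinear bounded_bilinear_mult by metis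

lemma smooth_on_inner:
  "open S \<Longrightarrow> smooth_on S f \<Longrightarrow> smooth_on S g \<Longrightarrow> smooth_on S (\<lambda>x. f x \<bullet> g x)"
  unfolding smooth_on_def using Ck_on_bounded_bilinear bounded_bilinear_inner by metis

lemma smooth_on_inverse:
  fixes f :: "_ \<Rightarrow> real"
  shows "open S \<Longrightarrow> smooth_on S f \<Longrightarrow> (\<And>x. x \<in> S \<Longrightarrow> f x \<noteq> 0) \<Longrightarrow> smooth_on S (\<lambda>x. inverse (f x))"
  unfolding smooth_on_def using Ck_on_inverse by metis

lemma smooth_on_bounded_linear:
  "open S \<Longrightarrow> smooth_on S f \<Longrightarrow> bounded_linear h \<Longrightarrow> smooth_on S (\<lambda>x. h (f x))"
  unfolding smooth_on_def using Ck_on_bounded_linear by metis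

lemma smooth_on_compose:
  fixes f :: "'a::real_normed_vector \<Rightarrow> 'b::real_inner" and g :: "'b \<Rightarrow> 'c::real_normed_vector"
  shows "coframe (C :: 'b set) d \<Longrightarrow> open S \<Longrightarrow> open T \<Longrightarrow> smooth_on S f \<Longrightarrow> smooth_on T g \<Longrightarrow> f ` S \<subseteq> T
    \<Longrightarrow> smooth_on S (\<lambda>x. g (f x))"
  unfolding smooth_on_def using Ck_on_compose[of C d S T _ f g] by blast

lemma smooth_on_ident: "open S \<Longrightarrow> smooth_on S (\<lambda>x. x)"
  unfolding smooth_on_def
proof
  fix k assume S: "open S"
  show "Ck_on k S (\<lambda>x. x)"
  proof (cases k)
    case (Suc j)
    show ?thesis unfolding Suc
      by (rule Ck_on_SucI[OF S has_derivative_ident Ck_on_const[OF S]])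
  qed auto
qed

lemma smooth_on_differentiable: "smooth_on S f \<Longrightarrow> x \<in> S \<Longrightarrow> f differentiable (at x)"
  unfolding smooth_on_def using Ck_on.simps(2) by blast

lemma smooth_on_has_derivative:
  "smooth_on S f \<Longrightarrow> x \<in> S \<Longrightarrow> (f has_derivative frechet_derivative f (at x)) (at x)"
  using smooth_on_differentiable frechet_derivative_works by blast

lemma smooth_on_frechet_derivative:
  "smooth_on S f \<Longrightarrow> smooth_on S (\<lambda>x. frechet_derivative f (at x) v)"
  unfolding smooth_on_def using Ck_on.simps(2) by blast

lemma smooth_on_continuous_on: "smooth_on S f \<Longrightarrow> continuous_on S f"
  unfolding smooth_on_def using Ck_on.simps(1) by blast

text \<open>The functions t^(-j) e^(-1/t), extended by 0, are closed under differentiation up to linear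
  combinations.\<close>
lemma smooth_on_flat:
  "smooth_on UNIV (\<lambda>t::real. if t \<le> 0 then 0 else exp (- inverse t))"
proof -
  define g where "g = (\<lambda>j (t::real). if t \<le> 0 then 0 else inverse t ^ j * exp (- inverse t))"
  \<comment> \<open>With u = 1/t one has u' = -u^2, so u^j e^(-u) has the derivative u^(j+2) e^(-u)
    - j u^(j+1) e^(-u).\<close>
  have der: "(g j has_real_derivative (g (j + 2) t - real j * g (j + 1) t)) (at t)" for j t
  proof -
    consider "t < 0" | "t > 0" | "t = 0" by linarith
    then show ?thesis
    proof cases
      case 1
      have "((\<lambda>t. 0) has_real_derivative 0) (at t)" by simp
      then have "(g j has_real_derivative 0) (at t)"
        by (rule has_field_derivative_transform_within_open[of _ _ _ "{..<0}"]) (use 1 in \<open>auto simp: g_def\<close>)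
      then show ?thesis using 1 by (simp add: g_def)
    next
      case 2
      have "((\<lambda>t. inverse t ^ j * exp (- inverse t)) has_real_derivative
          (inverse t ^ (j + 2) * exp (- inverse t) - real j * (inverse t ^ (j + 1) * exp (- inverse t)))) (at t)"
        using 2 by (cases "j = 0")
          (auto intro!: derivative_eq_intros simp: field_simps power2_eq_square power_eq_if[of t j])
      then have "(g j has_real_derivative
          (inverse t ^ (j + 2) * exp (- inverse t) - real j * (inverse t ^ (j + 1) * exp (- inverse t)))) (at t)"
        by (rule has_field_derivative_transform_within_open[of _ _ _ "{0<..}"]) (use 2 in \<open>auto simp: g_def\<close>)
      then show ?thesis using 2 by (simp add: g_def)
    next
      case 3
      \<comment> \<open>At 0 the difference quotient from the right is u^(j+1) e^(-u) with u = 1/t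
        tending to infinity; from the left it is 0.\<close>
      have "((\<lambda>u. u ^ Suc j * exp (- u)) \<longlongrightarrow> 0) (at_top :: real filter)"
        using tendsto_power_div_exp_0[of "Suc j"] by (simp add: exp_minus field_simps)
      then have "((\<lambda>t. inverse t ^ Suc j * exp (- inverse t)) \<longlongrightarrow> 0) (at_right (0::real))"
        using filterlim_compose filterlim_inverse_at_top_right by blast
      then have "((\<lambda>t. g j t / t) \<longlongrightarrow> 0) (at_right 0)"
        by (rule Lim_transform_eventually)
           (auto simp: g_def eventually_at_filter field_simps intro!: always_eventually)
      moreover have "((\<lambda>t. g j t / t) \<longlongrightarrow> 0) (at_left 0)"
        by (rule Lim_transform_eventually[OF tendsto_const])
           (auto simp: g_def eventually_at_filter intro!: always_eventually)
      ultimately have "((\<lambda>t. g j t / t) \<longlongrightarrow> 0) (at 0)" by (simp add: filterlim_split_at_real)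
      then show ?thesis using 3 by (simp add: has_field_derivative_iff g_def)
    qed
  qed
  have "Ck_on k UNIV (g j)" for k j
  proof (induction k arbitrary: j)
    case 0
    have "isCont (g j) t" for t using der DERIV_isCont by blast
    then show ?case by (simp add: continuous_at_imp_continuous_on)
  next
    case (Suc k)
    have "Ck_on k UNIV (\<lambda>t. g (j + 2) t + (- real j) * g (j + 1) t)"
      by (intro Ck_on_add[OF open_UNIV] Ck_on_const[OF open_UNIV]
          Ck_on_bounded_bilinear[OF open_UNIV _ _ bounded_bilinear_mult] Suc)
    then have c: "Ck_on k UNIV (\<lambda>t. (g (j + 2) t + (- real j) * g (j + 1) t) * v)" for v
      by (intro Ck_on_bounded_bilinear[OF open_UNIV _ _ bounded_bilinear_mult] Ck_on_const[OF open_UNIV])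
    have "(g j has_derivative (\<lambda>v. (g (j + 2) t + (- real j) * g (j + 1) t) * v)) (at t)" for t
      using der[of j t] by (simp add: has_field_derivative_def)
    then show ?case by (rule Ck_on_SucI[OF open_UNIV _ c])
  qed
  moreover have "g 0 = (\<lambda>t. if t \<le> 0 then 0 else exp (- inverse t))"
    unfolding g_def by (rule ext) simp
  ultimately show ?thesis unfolding smooth_on_def by metis
qed

section \<open>Symmetry of second derivatives\<close>

lemma smooth_on_line_derivative:
  fixes f :: "'a::real_normed_vector \<Rightarrow> real"
  assumes "smooth_on S f" "y + s *\<^sub>R a \<in> S"
  shows "((\<lambda>s. f (y + s *\<^sub>R a)) has_real_derivative frechet_derivative f (at (y + s *\<^sub>R a)) a) (at s)"
proof -
  let ?D = "frechet_derivative f (at (y + s *\<^sub>R a))"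
  have f: "(f has_derivative ?D) (at (y + s *\<^sub>R a))"
    by (rule smooth_on_has_derivative[OF assms])
  have l: "((\<lambda>s. y + s *\<^sub>R a) has_derivative (\<lambda>h. h *\<^sub>R a)) (at s)"
    by (auto intro!: derivative_eq_intros)
  have "((\<lambda>s. f (y + s *\<^sub>R a)) has_derivative (\<lambda>h. ?D (h *\<^sub>R a))) (at s)"
    using diff_chain_at[OF l f] by (simp add: o_def)
  moreover have "?D (h *\<^sub>R a) = ?D a * h" for h
    using linear_scale[OF has_derivative_linear[OF f]] by simp
  ultimately show ?thesis by (simp add: has_field_derivative_def)
qed

text \<open>The second difference is symmetric in a and b, which gives the symmetry of second
  derivatives.\<close>
lemma smooth_on_second_difference:
  fixes f :: "'a::real_normed_vector \<Rightarrow> real"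
  assumes "smooth_on S f" "0 < h"
    and "\<And>s t. 0 \<le> s \<Longrightarrow> s \<le> h \<Longrightarrow> 0 \<le> t \<Longrightarrow> t \<le> h \<Longrightarrow> x + s *\<^sub>R a + t *\<^sub>R b \<in> S"
  shows "\<exists>s t. 0 < s \<and> s < h \<and> 0 < t \<and> t < h \<and>
    f (x + h *\<^sub>R a + h *\<^sub>R b) - f (x + h *\<^sub>R a) - f (x + h *\<^sub>R b) + f x =
    h * h * frechet_derivative (\<lambda>y. frechet_derivative f (at y) a) (at (x + s *\<^sub>R a + t *\<^sub>R b)) b"
proof -
  let ?G = "\<lambda>y. frechet_derivative f (at y) a"
  have swap: "(x + t *\<^sub>R b) + s *\<^sub>R a = x + s *\<^sub>R a + t *\<^sub>R b" for s t by (simp add: algebra_simps)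
  \<comment> \<open>The mean value theorem is used twice: in direction a for the increment of f
    along b, then in direction b for the derivative of f along a. Writing
    \<open>0 *\<^sub>R b\<close> gives both ends of the increment the same shape.\<close>
  have "((\<lambda>s. f ((x + h *\<^sub>R b) + s *\<^sub>R a) - f ((x + 0 *\<^sub>R b) + s *\<^sub>R a)) has_real_derivative
      ?G ((x + h *\<^sub>R b) + s *\<^sub>R a) - ?G ((x + 0 *\<^sub>R b) + s *\<^sub>R a)) (at s)"
    if "0 \<le> s" "s \<le> h" for s
    by (intro DERIV_diff smooth_on_line_derivative[OF assms(1)])
       (use assms(2) assms(3)[OF that, of h] assms(3)[OF that, of 0] in \<open>simp_all add: swap\<close>)
  from MVT2[OF assms(2) this] obtain s where s: "0 < s" "s < h"
    "(f ((x + h *\<^sub>R b) + h *\<^sub>R a) - f ((x + 0 *\<^sub>R b) + h *\<^sub>R a)) - (f ((x + h *\<^sub>R b) + 0 *\<^sub>R a) - f ((x + 0 *\<^sub>R b) + 0 *\<^sub>R a))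
      = (h - 0) * (?G ((x + h *\<^sub>R b) + s *\<^sub>R a) - ?G ((x + 0 *\<^sub>R b) + s *\<^sub>R a))"
    by blast
  have "((\<lambda>t. ?G (x + s *\<^sub>R a + t *\<^sub>R b)) has_real_derivative
      frechet_derivative ?G (at (x + s *\<^sub>R a + t *\<^sub>R b)) b) (at t)"
    if "0 \<le> t" "t \<le> h" for t
    using smooth_on_line_derivative[OF smooth_on_frechet_derivative[OF assms(1)]]
      assms(3)[OF _ _ that] s by simp
  from MVT2[OF assms(2) this] obtain t where t: "0 < t" "t < h"
    "?G (x + s *\<^sub>R a + h *\<^sub>R b) - ?G (x + s *\<^sub>R a + 0 *\<^sub>R b)
      = (h - 0) * frechet_derivative ?G (at (x + s *\<^sub>R a + t *\<^sub>R b)) b"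
    by blast
  show ?thesis
    by (intro exI[of _ s] exI[of _ t]) (use s t in \<open>simp add: algebra_simps\<close>)
qed

text \<open>Read in either order, one second difference equals h * h times a mixed derivative at
  some point of the small parallelogram. Continuity at x moves both values to x up to any
  \<epsilon>.\<close>

lemma smooth_on_symmetric_derivative:
  fixes f :: "'a::real_normed_vector \<Rightarrow> real"
  assumes "smooth_on S f" "open S" "x \<in> S"
  shows "frechet_derivative (\<lambda>y. frechet_derivative f (at y) a) (at x) b
       = frechet_derivative (\<lambda>y. frechet_derivative f (at y) b) (at x) a"
proof -
  define G where "G = (\<lambda>a b y. frechet_derivative (\<lambda>y. frechet_derivative f (at y) a) (at y) b)"
  have cont: "isCont (G a b) x" for a b
    using smooth_on_continuous_on[OF smooth_on_frechet_derivative[OF smooth_on_frechet_derivative[OF assms(1)]]]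
      assms(2,3) by (simp add: G_def continuous_on_eq_continuous_at)
  have "\<bar>G a b x - G b a x\<bar> \<le> \<epsilon>" if "\<epsilon> > 0" for \<epsilon>
  proof -
    have near: "\<forall>\<^sub>F y in nhds x. dist (G a b y) (G a b x) < \<epsilon>/2" for a b
      using tendstoD[OF cont[of a b, unfolded isCont_def tendsto_at_iff_tendsto_nhds], of "\<epsilon>/2"] that by simp
    have "\<forall>\<^sub>F y in nhds x. y \<in> S \<and> dist (G a b y) (G a b x) < \<epsilon>/2 \<and> dist (G b a y) (G b a x) < \<epsilon>/2"
      by (intro eventually_conj near eventually_nhds_in_open assms(2,3))
    then obtain e where e: "e > 0" and
      ball: "\<And>y. dist y x < e \<Longrightarrow> y \<in> S \<and> dist (G a b y) (G a b x) < \<epsilon>/2 \<and> dist (G b a y) (G b a x) < \<epsilon>/2"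
      by (auto simp: eventually_nhds_metric)
    \<comment> \<open>The summand 1 keeps N positive when a = b = 0; the factor 2 in h makes the
      parallelogram stay strictly inside the ball of radius e.\<close>
    define N where "N = norm a + norm b + 1"
    define h where "h = e / (2 * N)"
    have n: "N > 0" by (simp add: N_def add_nonneg_pos)
    have h: "h > 0" "h * (norm a + norm b) < e"
    proof -
      show "h > 0" using e n by (simp add: h_def)
      have "h * (norm a + norm b) \<le> h * N" using \<open>h > 0\<close> by (simp add: N_def)
      also have "\<dots> = e / 2" using n by (simp add: h_def)
      finally show "h * (norm a + norm b) < e" using e by simp
    qed
    have near: "dist (x + s *\<^sub>R u + t *\<^sub>R v) x < e"
      if "0 \<le> s" "s \<le> h" "0 \<le> t" "t \<le> h" "norm u + norm v = norm a + norm b" for s t u v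
    proof -
      have "dist (x + s *\<^sub>R u + t *\<^sub>R v) x = norm (s *\<^sub>R u + t *\<^sub>R v)" by (simp add: dist_norm algebra_simps)
      also have "\<dots> \<le> s * norm u + t * norm v"
        using norm_triangle_ineq[of "s *\<^sub>R u" "t *\<^sub>R v"] that(1,3) by simp
      also have "\<dots> \<le> h * norm u + h * norm v"
        using that(2,4) by (intro add_mono mult_right_mono) auto
      also have "\<dots> = h * (norm a + norm b)" unfolding that(5)[symmetric] by (simp only: distrib_left)
      also note h(2)
      finally show ?thesis .
    qed
    obtain s t where 1: "0 < s" "s < h" "0 < t" "t < h"
      "f (x + h *\<^sub>R a + h *\<^sub>R b) - f (x + h *\<^sub>R a) - f (x + h *\<^sub>R b) + f x = h * h * G a b (x + s *\<^sub>R a + t *\<^sub>R b)"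
      using smooth_on_second_difference[OF assms(1) h(1), of x a b] ball[OF near[of _ _ a b]] unfolding G_def by blast
    obtain s' t' where 2: "0 < s'" "s' < h" "0 < t'" "t' < h"
      "f (x + h *\<^sub>R b + h *\<^sub>R a) - f (x + h *\<^sub>R b) - f (x + h *\<^sub>R a) + f x = h * h * G b a (x + s' *\<^sub>R b + t' *\<^sub>R a)"
      using smooth_on_second_difference[OF assms(1) h(1), of x b a] ball[OF near[of _ _ b a]] add.commute[of "norm b" "norm a"]
      unfolding G_def by blast
    have "h * h * G a b (x + s *\<^sub>R a + t *\<^sub>R b) = h * h * G b a (x + s' *\<^sub>R b + t' *\<^sub>R a)"
      using 1(5) 2(5) by (simp add: algebra_simps)
    then have "G a b (x + s *\<^sub>R a + t *\<^sub>R b) = G b a (x + s' *\<^sub>R b + t' *\<^sub>R a)" using h by simp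
    moreover have "dist (G a b (x + s *\<^sub>R a + t *\<^sub>R b)) (G a b x) < \<epsilon>/2" using ball[OF near[of s t a b]] 1(1-4) by simp
    moreover have "dist (G b a (x + s' *\<^sub>R b + t' *\<^sub>R a)) (G b a x) < \<epsilon>/2" using ball[OF near[of s' t' b a]] 2(1-4) by simp
    ultimately show ?thesis unfolding dist_real_def by linarith
  qed
  then have "\<bar>G a b x - G b a x\<bar> \<le> 0" using field_le_epsilon[of "\<bar>G a b x - G b a x\<bar>" 0] by simp
  then show ?thesis by (simp add: G_def)
qed

subsection \<open>Smooth functions on a manifold\<close>

text \<open>What local calculus uses of a smooth manifold, with a coframe of the model space in
  place of its dimension. Hausdorff separation and the Heine-Borel property come in with the bump
  functions.\<close>

locale mfd =
  fixes A :: "('m::topological_space, 'e::real_inner) atlas" and C :: "'e set" and d :: "'e \<Rightarrow> 'e"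
  assumes cover: "(\<Union>(U, \<psi>)\<in>A. U) = UNIV"
    and chart: "(U, \<psi>) \<in> A \<Longrightarrow> open U \<and> open (\<psi> ` U) \<and> homeomorphism U (\<psi> ` U) \<psi> (inv_into U \<psi>)"
    and transition: "(U, \<psi>) \<in> A \<Longrightarrow> (V, \<theta>) \<in> A \<Longrightarrow> smooth_on (\<psi> ` (U \<inter> V)) (\<theta> \<circ> inv_into U \<psi>)"
    and coframe: "coframe C d"

lemma smooth_manifold_mfd:
  assumes "smooth_manifold k A"
  obtains C d where "mfd A C d"
proof -
  obtain b where "is_basis k (UNIV :: 'b set) b" using assms by (auto simp: smooth_manifold_def)
  then obtain C d where "coframe C (d :: 'b \<Rightarrow> 'b)"
    using coframe_exists[of "b ` {..<k}"] by (auto simp: is_basis_def)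
  then have "mfd A C d" using assms unfolding smooth_manifold_def by unfold_locales fast+
  then show ?thesis by (rule that)
qed

context mfd
begin

abbreviation sm :: "('m \<Rightarrow> real) \<Rightarrow> 'm \<Rightarrow> bool" where "sm \<equiv> smooth_fun_at A"

lemma chart_at: obtains U \<psi> where "(U, \<psi>) \<in> A" "x \<in> U"
  using cover by fast

lemma chart_inv: "(U, \<psi>) \<in> A \<Longrightarrow> y \<in> U \<Longrightarrow> inv_into U \<psi> (\<psi> y) = y"
  using chart homeomorphism_apply1 by metis

lemma open_chart_image:
  assumes "(U, \<psi>) \<in> A" "open W" "W \<subseteq> U"
  shows "open (\<psi> ` W)"
proof -
  have "openin (top_of_set (\<psi> ` U)) (\<psi> ` W)"
    using homeomorphism_imp_open_map[of U "\<psi> ` U" \<psi> "inv_into U \<psi>" W] chart[OF assms(1)] assms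
    by (simp add: openin_open_eq)
  then show ?thesis using chart[OF assms(1)] by (simp add: openin_open_eq)
qed

lemma open_chart_preimage:
  assumes "(U, \<psi>) \<in> A" "open T"
  shows "open {y\<in>U. \<psi> y \<in> T}"
proof -
  have "open (U \<inter> \<psi> -` T)"
    using continuous_open_preimage[of U \<psi> T] chart[OF assms(1)] assms(2) homeomorphism_def by metis
  then show ?thesis by (simp add: Int_def vimage_def)
qed

text \<open>In the new chart f is its expression in the old one, composed with the transition map.
  Hence smoothness does not depend on the chart.\<close>

lemma transition_compose:
  assumes "(U, \<psi>) \<in> A" "(V, \<theta>) \<in> A" "open W" "W \<subseteq> U" "W \<subseteq> V" "smooth_on (\<psi> ` W) (f \<circ> inv_into U \<psi>)"
  shows "smooth_on (\<theta> ` W) (f \<circ> inv_into V \<theta>)"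
proof -
  have o: "open (\<theta> ` W)" "open (\<psi> ` W)" using open_chart_image assms by auto
  have "smooth_on (\<theta> ` W) (\<psi> \<circ> inv_into V \<theta>)"
    by (rule smooth_on_subset[OF transition[OF assms(2,1)]]) (use assms in auto)
  moreover have "(\<psi> \<circ> inv_into V \<theta>) ` (\<theta> ` W) \<subseteq> \<psi> ` W"
    using chart_inv[OF assms(2)] assms(5) by (auto simp: subset_iff)
  ultimately have "smooth_on (\<theta> ` W) (\<lambda>z. (f \<circ> inv_into U \<psi>) ((\<psi> \<circ> inv_into V \<theta>) z))"
    by (rule smooth_on_compose[OF coframe o _ assms(6)])
  then show ?thesis
  proof (rule smooth_on_cong[OF o(1), rotated])
    fix z assume "z \<in> \<theta> ` W"
    then obtain y where y: "y \<in> W" "z = \<theta> y" by auto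
    then show "(f \<circ> inv_into U \<psi>) ((\<psi> \<circ> inv_into V \<theta>) z) = (f \<circ> inv_into V \<theta>) z"
      using chart_inv[OF assms(1), of y] chart_inv[OF assms(2), of y] assms(4,5) by (auto simp: subset_iff)
  qed
qed

lemma smI:
  assumes "(U, \<psi>) \<in> A" "x \<in> U" "open T" "\<psi> x \<in> T" "smooth_on T (f \<circ> inv_into U \<psi>)"
  shows "sm f x"
proof -
  let ?W = "{y\<in>U. \<psi> y \<in> T}"
  have "open ?W" "x \<in> ?W" "?W \<subseteq> U" "f ` ?W \<subseteq> UNIV" using open_chart_preimage assms by auto
  moreover have "smooth_on (\<psi> ` ?W) (id \<circ> f \<circ> inv_into U \<psi>)"
    by (simp, rule smooth_on_subset[OF assms(5)]) auto
  ultimately have "\<exists>W. open W \<and> x \<in> W \<and> W \<subseteq> U \<and> f ` W \<subseteq> UNIV \<and> smooth_on (\<psi> ` W) (id \<circ> f \<circ> inv_into U \<psi>)"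
    by blast
  then show ?thesis using assms(1) by (auto simp: smooth_map_at_def real_atlas_def)
qed

text \<open>The definition of smoothness only provides some chart around x; by chart independence
  the expression in any prescribed chart is smooth near the image of x.\<close>

lemma smE:
  assumes "sm f x" "(U, \<psi>) \<in> A" "x \<in> U"
  obtains T where "open T" "\<psi> x \<in> T" "T \<subseteq> \<psi> ` U" "smooth_on T (f \<circ> inv_into U \<psi>)"
proof -
  from assms(1) obtain V \<theta> W where 1: "(V, \<theta>) \<in> A" "open W" "x \<in> W" "W \<subseteq> V"
    "smooth_on (\<theta> ` W) (f \<circ> inv_into V \<theta>)"
    by (auto simp: smooth_map_at_def real_atlas_def)
  have o: "open (W \<inter> U)" using 1 chart[OF assms(2)] by auto
  have "smooth_on (\<psi> ` (W \<inter> U)) (f \<circ> inv_into U \<psi>)"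
    by (rule transition_compose[OF 1(1) assms(2) o])
       (use 1 assms smooth_on_subset[OF 1(5), of "\<theta> ` (W \<inter> U)"] in auto)
  then show ?thesis using that[of "\<psi> ` (W \<inter> U)"] open_chart_image[OF assms(2) o] 1 assms by auto
qed

lemma eventually_chart:
  assumes "(U, \<psi>) \<in> A" "x \<in> U" "open T" "\<psi> x \<in> T"
  shows "\<forall>\<^sub>F y in nhds x. y \<in> U \<and> \<psi> y \<in> T"
  using eventually_nhds_in_open[OF open_chart_preimage[OF assms(1,3)], of x] assms by simp

lemma eventually_chart_image:
  assumes "(U, \<psi>) \<in> A" "x \<in> U" "\<forall>\<^sub>F y in nhds x. P y"
  shows "\<exists>T. open T \<and> \<psi> x \<in> T \<and> T \<subseteq> \<psi> ` U \<and> (\<forall>z\<in>T. P (inv_into U \<psi> z))"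
proof -
  obtain W where W: "open W" "x \<in> W" "\<And>y. y \<in> W \<Longrightarrow> P y" using assms(3) by (auto simp: eventually_nhds)
  have "open (\<psi> ` (W \<inter> U))" using open_chart_image[OF assms(1)] W chart[OF assms(1)] by auto
  moreover have "P (inv_into U \<psi> z)" if "z \<in> \<psi> ` (W \<inter> U)" for z
    using that W chart_inv[OF assms(1)] by auto
  ultimately show ?thesis using W assms by (intro exI[of _ "\<psi> ` (W \<inter> U)"]) auto
qed

lemma sm_cong:
  assumes "sm f x" "\<forall>\<^sub>F y in nhds x. f y = g y"
  shows "sm g x"
proof -
  obtain U \<psi> where c: "(U, \<psi>) \<in> A" "x \<in> U" using chart_at .
  obtain T where T: "open T" "\<psi> x \<in> T" "T \<subseteq> \<psi> ` U" "smooth_on T (f \<circ> inv_into U \<psi>)"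
    using smE[OF assms(1) c] .
  obtain T' where T': "open T'" "\<psi> x \<in> T'" "\<forall>z\<in>T'. f (inv_into U \<psi> z) = g (inv_into U \<psi> z)"
    using eventually_chart_image[OF c assms(2)] by auto
  have "smooth_on (T \<inter> T') (g \<circ> inv_into U \<psi>)"
    by (rule smooth_on_cong[OF _ _ smooth_on_subset[OF T(4)]]) (use T T' in auto)
  then show ?thesis by (rule smI[OF c, of "T \<inter> T'", rotated 2]) (use T T' in auto)
qed

lemma sm_eventually:
  assumes "sm f x" shows "\<forall>\<^sub>F y in nhds x. sm f y"
proof -
  obtain U \<psi> where c: "(U, \<psi>) \<in> A" "x \<in> U" using chart_at .
  obtain T where T: "open T" "\<psi> x \<in> T" "T \<subseteq> \<psi> ` U" "smooth_on T (f \<circ> inv_into U \<psi>)"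
    using smE[OF assms(1) c] .
  show ?thesis using eventually_chart[OF c T(1,2)]
    by (rule eventually_mono) (use smI[OF c(1) _ T(1) _ T(4)] in auto)
qed

lemma sm_const: "sm (\<lambda>y. a) x"
proof -
  obtain U \<psi> where c: "(U, \<psi>) \<in> A" "x \<in> U" using chart_at .
  show ?thesis by (rule smI[OF c, of UNIV]) (auto simp: o_def smooth_on_const)
qed

lemma sm_binop:
  assumes "sm f x" "sm g x"
    and "\<And>(T::'e set) F G. open T \<Longrightarrow> smooth_on T F \<Longrightarrow> smooth_on T G \<Longrightarrow> smooth_on T (\<lambda>z. h (F z) (G z))"
  shows "sm (\<lambda>y. h (f y) (g y)) x"
proof -
  obtain U \<psi> where c: "(U, \<psi>) \<in> A" "x \<in> U" using chart_at .
  obtain T where T: "open T" "\<psi> x \<in> T" "T \<subseteq> \<psi> ` U" "smooth_on T (f \<circ> inv_into U \<psi>)"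
    using smE[OF assms(1) c] .
  obtain T' where T': "open T'" "\<psi> x \<in> T'" "T' \<subseteq> \<psi> ` U" "smooth_on T' (g \<circ> inv_into U \<psi>)"
    using smE[OF assms(2) c] .
  have "smooth_on (T \<inter> T') (\<lambda>z. h ((f \<circ> inv_into U \<psi>) z) ((g \<circ> inv_into U \<psi>) z))"
    by (rule assms(3)[OF _ smooth_on_subset[OF T(4)] smooth_on_subset[OF T'(4)]]) (use T T' in auto)
  then show ?thesis by (intro smI[OF c, of "T \<inter> T'"]) (use T T' in \<open>auto simp: o_def\<close>)
qed

lemma sm_add: "sm f x \<Longrightarrow> sm g x \<Longrightarrow> sm (\<lambda>y. f y + g y) x"
  by (rule sm_binop) (auto intro: smooth_on_add)

lemma sm_mult: "sm f x \<Longrightarrow> sm g x \<Longrightarrow> sm (\<lambda>y. f y * g y) x"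
  by (rule sm_binop) (auto intro: smooth_on_mult)

lemma sm_minus: "sm f x \<Longrightarrow> sm (\<lambda>y. - f y) x"
  using sm_mult[OF sm_const[of "-1"], of f x] by simp

lemma sm_diff: "sm f x \<Longrightarrow> sm g x \<Longrightarrow> sm (\<lambda>y. f y - g y) x"
  using sm_add[OF _ sm_minus, of f x g] by simp

lemma sm_sum: "(\<And>i. i \<in> I \<Longrightarrow> sm (f i) x) \<Longrightarrow> sm (\<lambda>y. \<Sum>i\<in>I. f i y) x"
proof (induction I rule: infinite_finite_induct)
  case (insert i I)
  then show ?case using sm_add[of "f i" x "\<lambda>y. \<Sum>i\<in>I. f i y"] by simp
qed (simp_all add: sm_const)

lemma sm_nonzero:
  assumes "sm f x" "f x \<noteq> 0"
  shows "sm (\<lambda>y. inverse (f y)) x" and "\<forall>\<^sub>F y in nhds x. f y \<noteq> 0"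
proof -
  obtain U \<psi> where c: "(U, \<psi>) \<in> A" "x \<in> U" using chart_at .
  obtain T where T: "open T" "\<psi> x \<in> T" "T \<subseteq> \<psi> ` U" "smooth_on T (f \<circ> inv_into U \<psi>)"
    using smE[OF assms(1) c] .
  let ?T = "T \<inter> (f \<circ> inv_into U \<psi>) -` (- {0})"
  have o: "open ?T"
    using continuous_open_preimage[OF smooth_on_continuous_on[OF T(4)] T(1)] by blast
  have m: "\<psi> x \<in> ?T" using T assms(2) chart_inv[OF c] by auto
  have "smooth_on ?T (\<lambda>z. inverse ((f \<circ> inv_into U \<psi>) z))"
    by (rule smooth_on_inverse[OF o smooth_on_subset[OF T(4)]]) auto
  then show "sm (\<lambda>y. inverse (f y)) x"
    by (intro smI[OF c o m]) (simp add: o_def)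
  show "\<forall>\<^sub>F y in nhds x. f y \<noteq> 0"
    using eventually_chart[OF c o m] by (rule eventually_mono) (auto simp: chart_inv[OF c(1)])
qed

lemma sm_divide: "sm f x \<Longrightarrow> sm g x \<Longrightarrow> g x \<noteq> 0 \<Longrightarrow> sm (\<lambda>y. f y / g y) x"
  using sm_mult[OF _ sm_nonzero(1), of f x g] by (simp add: divide_inverse)

subsection \<open>Tangent vectors\<close>

text \<open>The derivative along the coordinate vector w. The point comes last, so that
  \<open>pd\<close> applied to f is again a function on the manifold and can be differentiated once
  more.\<close>

definition pd :: "'m set \<Rightarrow> ('m \<Rightarrow> 'e) \<Rightarrow> 'e \<Rightarrow> ('m \<Rightarrow> real) \<Rightarrow> 'm \<Rightarrow> real"
  where "pd U \<psi> w f y = frechet_derivative (f \<circ> inv_into U \<psi>) (at (\<psi> y)) w"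

definition rep :: "'m set \<Rightarrow> ('m \<Rightarrow> 'e) \<Rightarrow> 'm \<Rightarrow> 'e \<Rightarrow> 'm tvec"
  where "rep U \<psi> x w = (\<lambda>f. if sm f x then pd U \<psi> w f x else 0)"

definition coord :: "('m \<Rightarrow> 'e) \<Rightarrow> 'e \<Rightarrow> 'm \<Rightarrow> real"
  where "coord \<psi> w y = \<psi> y \<bullet> w"

lemma pd_has_derivative:
  assumes "(U, \<psi>) \<in> A" "x \<in> U" "sm f x"
  shows "((f \<circ> inv_into U \<psi>) has_derivative (\<lambda>w. pd U \<psi> w f x)) (at (\<psi> x))"
  using smE[OF assms(3,1,2)] smooth_on_has_derivative unfolding pd_def by metis

lemma pdI:
  "((f \<circ> inv_into U \<psi>) has_derivative D) (at (\<psi> x)) \<Longrightarrow> pd U \<psi> w f x = D w"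
  unfolding pd_def using frechet_derivative_at by metis

lemma pd_cong:
  assumes "(U, \<psi>) \<in> A" "x \<in> U" "sm f x" "\<forall>\<^sub>F y in nhds x. f y = g y"
  shows "pd U \<psi> w f x = pd U \<psi> w g x"
proof -
  obtain T where T: "open T" "\<psi> x \<in> T" "\<forall>z\<in>T. f (inv_into U \<psi> z) = g (inv_into U \<psi> z)"
    using eventually_chart_image[OF assms(1,2,4)] by auto
  have "((g \<circ> inv_into U \<psi>) has_derivative (\<lambda>w. pd U \<psi> w f x)) (at (\<psi> x))"
    by (rule has_derivative_transform_within_open[OF pd_has_derivative[OF assms(1-3)] T(1,2)])
       (use T(3) in auto)
  then show ?thesis using pdI by metis
qed

lemma pd_sm:
  assumes "(U, \<psi>) \<in> A" "x \<in> U" "sm f x"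
  shows "sm (pd U \<psi> w f) x"
proof -
  obtain T where T: "open T" "\<psi> x \<in> T" "T \<subseteq> \<psi> ` U" "smooth_on T (f \<circ> inv_into U \<psi>)"
    using smE[OF assms(3,1,2)] .
  have "smooth_on T (pd U \<psi> w f \<circ> inv_into U \<psi>)"
    by (rule smooth_on_cong[OF T(1) _ smooth_on_frechet_derivative[OF T(4), of w]])
       (use T(3) chart_inv[OF assms(1)] in \<open>auto simp: pd_def subset_iff\<close>)
  then show ?thesis by (rule smI[OF assms(1,2) T(1,2)])
qed

lemma pd_commute:
  assumes "(U, \<psi>) \<in> A" "x \<in> U" "sm f x"
  shows "pd U \<psi> v (pd U \<psi> w f) x = pd U \<psi> w (pd U \<psi> v f) x"
proof -
  obtain T where T: "open T" "\<psi> x \<in> T" "T \<subseteq> \<psi> ` U" "smooth_on T (f \<circ> inv_into U \<psi>)"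
    using smE[OF assms(3,1,2)] .
  have "pd U \<psi> v (pd U \<psi> w f) x
      = frechet_derivative (\<lambda>z. frechet_derivative (f \<circ> inv_into U \<psi>) (at z) w) (at (\<psi> x)) v" for v w
  proof (rule pdI)
    show "((pd U \<psi> w f \<circ> inv_into U \<psi>) has_derivative
      frechet_derivative (\<lambda>z. frechet_derivative (f \<circ> inv_into U \<psi>) (at z) w) (at (\<psi> x))) (at (\<psi> x))"
      by (rule has_derivative_transform_within_open[OF
          smooth_on_has_derivative[OF smooth_on_frechet_derivative[OF T(4)] T(2)] T(1,2)])
         (use T(3) chart_inv[OF assms(1)] in \<open>auto simp: pd_def subset_iff\<close>)
  qed
  then show ?thesis using smooth_on_symmetric_derivative[OF T(4,1,2)] by simp
qed

lemma rep_in_tangent_space: "(U, \<psi>) \<in> A \<Longrightarrow> x \<in> U \<Longrightarrow> rep U \<psi> x w \<in> tangent_space A x"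
  unfolding tangent_space_def rep_def pd_def by blast

text \<open>The derivative of the transition map carries the coordinate vector from one chart to the
  other. All tangent vectors at x can therefore be written in one chart, which makes the tangent
  space a vector space.\<close>

lemma tangent_space_rep:
  assumes "v \<in> tangent_space A x" "(U, \<psi>) \<in> A" "x \<in> U"
  obtains w where "v = rep U \<psi> x w"
proof -
  obtain V \<theta> w where V: "(V, \<theta>) \<in> A" "x \<in> V" "v = rep V \<theta> x w"
    using assms(1) unfolding tangent_space_def rep_def pd_def by blast
  let ?\<tau> = "\<psi> \<circ> inv_into V \<theta>"
  let ?W = "U \<inter> V"
  have W: "open (\<theta> ` ?W)"
    using open_chart_image[OF V(1)] chart[OF V(1)] chart[OF assms(2)] by auto
  have \<tau>: "(?\<tau> has_derivative frechet_derivative ?\<tau> (at (\<theta> x))) (at (\<theta> x))"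
    by (rule smooth_on_has_derivative[OF transition[OF V(1) assms(2)]]) (use V assms in auto)
  have \<tau>x: "?\<tau> (\<theta> x) = \<psi> x" using chart_inv[OF V(1,2)] by simp
  have "pd V \<theta> w f x = pd U \<psi> (frechet_derivative ?\<tau> (at (\<theta> x)) w) f x" if "sm f x" for f
  proof (rule pdI)
    have "((f \<circ> inv_into U \<psi>) \<circ> ?\<tau> has_derivative
        (\<lambda>w. pd U \<psi> w f x) \<circ> frechet_derivative ?\<tau> (at (\<theta> x))) (at (\<theta> x))"
      using diff_chain_at[OF \<tau>] pd_has_derivative[OF assms(2,3) that] \<tau>x by metis
    then have "((f \<circ> inv_into V \<theta>) has_derivative
        (\<lambda>w. pd U \<psi> w f x) \<circ> frechet_derivative ?\<tau> (at (\<theta> x))) (at (\<theta> x))"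
    proof (rule has_derivative_transform_within_open[OF _ W])
      fix z assume "z \<in> \<theta> ` ?W"
      then obtain y where y: "y \<in> U" "y \<in> V" "z = \<theta> y" by auto
      then show "(f \<circ> inv_into U \<psi> \<circ> ?\<tau>) z = (f \<circ> inv_into V \<theta>) z"
        using chart_inv[OF V(1), of y] chart_inv[OF assms(2), of y] by simp
    qed (use V assms in auto)
    then show "((f \<circ> inv_into V \<theta>) has_derivative
        (\<lambda>w. pd U \<psi> (frechet_derivative ?\<tau> (at (\<theta> x)) w) f x)) (at (\<theta> x))"
      by (simp add: o_def)
  qed
  then have "v = rep U \<psi> x (frechet_derivative ?\<tau> (at (\<theta> x)) w)"
    unfolding V(3) rep_def by (auto simp: fun_eq_iff)
  then show ?thesis by (rule that)
qed

lemma tangent_space_pd: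
  assumes "v \<in> tangent_space A x"
  obtains U \<psi> w where "(U, \<psi>) \<in> A" "x \<in> U" "v = (\<lambda>f. if sm f x then pd U \<psi> w f x else 0)"
proof -
  obtain U \<psi> where c: "(U, \<psi>) \<in> A" "x \<in> U" using chart_at .
  obtain w where "v = rep U \<psi> x w" using tangent_space_rep[OF assms c] .
  then show ?thesis using that c by (simp add: rep_def)
qed

lemma tv_nonsmooth: "v \<in> tangent_space A x \<Longrightarrow> \<not> sm f x \<Longrightarrow> v f = 0"
  by (erule tangent_space_pd) simp

text \<open>Locality of tangent vectors. When neither function is smooth at x, both values are the
  default 0.\<close>

lemma tv_cong:
  assumes "v \<in> tangent_space A x" "\<forall>\<^sub>F y in nhds x. f y = g y"
  shows "v f = v g"
proof -
  obtain U \<psi> w where v: "(U, \<psi>) \<in> A" "x \<in> U" "v = (\<lambda>f. if sm f x then pd U \<psi> w f x else 0)"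
    using tangent_space_pd[OF assms(1)] .
  have "\<forall>\<^sub>F y in nhds x. g y = f y" using assms(2) by (simp add: eq_commute)
  then have "sm f x \<longleftrightarrow> sm g x" using sm_cong assms(2) by blast
  then show ?thesis using v(3) pd_cong[OF v(1,2) _ assms(2)] by simp
qed

lemma tv_const: "v \<in> tangent_space A x \<Longrightarrow> v (\<lambda>y. a) = 0"
proof (erule tangent_space_pd)
  fix U \<psi> w
  have "pd U \<psi> w (\<lambda>y. a) x = (\<lambda>w. 0) w" by (rule pdI) (simp add: o_def)
  then show "v = (\<lambda>f. if sm f x then pd U \<psi> w f x else 0) \<Longrightarrow> v (\<lambda>y. a) = 0" by simp
qed

lemma tv_add:
  assumes "v \<in> tangent_space A x" "sm f x" "sm g x"
  shows "v (\<lambda>y. f y + g y) = v f + v g"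
proof -
  obtain U \<psi> w where v: "(U, \<psi>) \<in> A" "x \<in> U" "v = (\<lambda>f. if sm f x then pd U \<psi> w f x else 0)"
    using tangent_space_pd[OF assms(1)] .
  have "pd U \<psi> w (\<lambda>y. f y + g y) x = pd U \<psi> w f x + pd U \<psi> w g x"
    by (rule pdI) (use has_derivative_add[OF pd_has_derivative[OF v(1,2) assms(2)] pd_has_derivative[OF v(1,2) assms(3)]]
        in \<open>simp add: o_def\<close>)
  then show ?thesis using v(3) assms sm_add by simp
qed

lemma tv_mult:
  assumes "v \<in> tangent_space A x" "sm f x" "sm g x"
  shows "v (\<lambda>y. f y * g y) = f x * v g + v f * g x"
proof -
  obtain U \<psi> w where v: "(U, \<psi>) \<in> A" "x \<in> U" "v = (\<lambda>f. if sm f x then pd U \<psi> w f x else 0)"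
    using tangent_space_pd[OF assms(1)] .
  have "pd U \<psi> w (\<lambda>y. f y * g y) x = f x * pd U \<psi> w g x + pd U \<psi> w f x * g x"
    by (rule pdI) (use has_derivative_mult[OF pd_has_derivative[OF v(1,2) assms(2)] pd_has_derivative[OF v(1,2) assms(3)]]
        chart_inv[OF v(1,2)] in \<open>simp add: o_def\<close>)
  then show ?thesis using v(3) assms sm_mult by simp
qed

lemma tv_sum:
  "v \<in> tangent_space A x \<Longrightarrow> (\<And>i. i \<in> I \<Longrightarrow> sm (f i) x) \<Longrightarrow> v (\<lambda>y. \<Sum>i\<in>I. f i y) = (\<Sum>i\<in>I. v (f i))"
proof (induction I rule: infinite_finite_induct)
  case (insert i I)
  then show ?case using tv_add[of v x "f i" "\<lambda>y. \<Sum>i\<in>I. f i y"] sm_sum[of I f x] by simp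
qed (simp_all add: tv_const)

lemma linear_pd:
  assumes "(U, \<psi>) \<in> A" "x \<in> U" "sm f x"
  shows "linear (\<lambda>w. pd U \<psi> w f x)"
  using pd_has_derivative[OF assms] has_derivative_linear by blast

lemma tangent_space_add:
  assumes "v \<in> tangent_space A x" "v' \<in> tangent_space A x"
  shows "v + v' \<in> tangent_space A x"
proof -
  obtain U \<psi> where c: "(U, \<psi>) \<in> A" "x \<in> U" using chart_at .
  obtain w w' where "v = rep U \<psi> x w" "v' = rep U \<psi> x w'"
    using tangent_space_rep[OF _ c] assms by metis
  then have "v + v' = rep U \<psi> x (w + w')"
    using linear_add[OF linear_pd[OF c]] by (auto simp: rep_def fun_eq_iff)
  then show ?thesis using rep_in_tangent_space[OF c] by simp
qed

lemma tangent_space_scale: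
  assumes "v \<in> tangent_space A x"
  shows "a *\<^sub>R v \<in> tangent_space A x"
proof -
  obtain U \<psi> where c: "(U, \<psi>) \<in> A" "x \<in> U" using chart_at .
  obtain w where "v = rep U \<psi> x w" using tangent_space_rep[OF assms c] .
  then have "a *\<^sub>R v = rep U \<psi> x (a *\<^sub>R w)"
    using linear_scale[OF linear_pd[OF c]] by (auto simp: rep_def fun_eq_iff scaleR_fun_def)
  then show ?thesis using rep_in_tangent_space[OF c] by simp
qed

lemma tangent_space_0: "0 \<in> tangent_space A x"
proof -
  obtain U \<psi> where c: "(U, \<psi>) \<in> A" "x \<in> U" using chart_at .
  show ?thesis using tangent_space_scale[OF rep_in_tangent_space[OF c], of 0] by simp
qed

lemma subspace_tangent_space: "subspace (tangent_space A x)"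
  unfolding subspace_def using tangent_space_0 tangent_space_add tangent_space_scale by blast

lemmas tangent_space_diff = subspace_diff[OF subspace_tangent_space]
  and tangent_space_neg = subspace_neg[OF subspace_tangent_space]
  and tangent_space_sum = subspace_sum[OF subspace_tangent_space]

section \<open>Coordinates of tangent vectors\<close>

lemma sm_coord:
  assumes "(U, \<psi>) \<in> A" "x \<in> U"
  shows "sm (coord \<psi> w) x"
proof -
  have U: "open (\<psi> ` U)" using chart[OF assms(1)] by auto
  have "smooth_on (\<psi> ` U) (\<lambda>z. z \<bullet> w)"
    by (rule smooth_on_inner[OF U smooth_on_ident[OF U] smooth_on_const[OF U]])
  then have "smooth_on (\<psi> ` U) (coord \<psi> w \<circ> inv_into U \<psi>)"
    by (rule smooth_on_cong[OF U, rotated]) (auto simp: coord_def chart_inv[OF assms(1)])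
  then show ?thesis by (rule smI[OF assms U, rotated]) (use assms in auto)
qed

lemma pd_coord:
  assumes "(U, \<psi>) \<in> A" "x \<in> U"
  shows "pd U \<psi> u (coord \<psi> w) x = u \<bullet> w"
proof (rule pdI)
  have U: "open (\<psi> ` U)" using chart[OF assms(1)] by auto
  have "((\<lambda>z. z \<bullet> w) has_derivative (\<lambda>u. u \<bullet> w)) (at (\<psi> x))"
    by (auto intro!: derivative_eq_intros)
  then show "((coord \<psi> w \<circ> inv_into U \<psi>) has_derivative (\<lambda>u. u \<bullet> w)) (at (\<psi> x))"
    by (rule has_derivative_transform_within_open[OF _ U])
       (use assms in \<open>auto simp: coord_def chart_inv[OF assms(1)]\<close>)
qed

text \<open>The coordinate vector of v is recovered from the values of v on the linear coordinates
  dual to the coframe. So finitely many values determine a tangent vector, and equalities can be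
  tested on them (\<open>tv_ext\<close>).\<close>

lemma tv_expand:
  assumes "v \<in> tangent_space A x" "(U, \<psi>) \<in> A" "x \<in> U"
  shows "v = (\<Sum>c\<in>C. v (coord \<psi> (d c)) *\<^sub>R rep U \<psi> x c)"
proof -
  obtain w where w: "v = rep U \<psi> x w" using tangent_space_rep[OF assms] .
  have "v (coord \<psi> u) = w \<bullet> u" for u
    using w sm_coord[OF assms(2,3)] pd_coord[OF assms(2,3)] by (simp add: rep_def)
  moreover have "v f = (\<Sum>c\<in>C. (w \<bullet> d c) *\<^sub>R rep U \<psi> x c f)" for f
    using coframe_linear[OF coframe linear_pd[OF assms(2,3), of f], of w] by (simp add: w rep_def)
  moreover have "(\<Sum>c\<in>C. g c) f = (\<Sum>c\<in>C. g c f)" for g :: "'e \<Rightarrow> 'm tvec" and f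
    by (induction C rule: infinite_finite_induct) auto
  ultimately show ?thesis by (simp add: fun_eq_iff scaleR_fun_def)
qed

lemma tv_ext:
  assumes "v \<in> tangent_space A x" "v' \<in> tangent_space A x" "(U, \<psi>) \<in> A" "x \<in> U"
    and "\<And>c. c \<in> C \<Longrightarrow> v (coord \<psi> (d c)) = v' (coord \<psi> (d c))"
  shows "v = v'"
  using tv_expand[OF assms(1,3,4)] tv_expand[OF assms(2,3,4)] assms(5) by simp

end

subsection \<open>Vector fields and the Nijenhuis tensor\<close>

lemma sum_fun_apply: "(\<Sum>i\<in>I. g i) x = (\<Sum>i\<in>I. g i x)"
  for g :: "'i \<Rightarrow> 'a \<Rightarrow> 'b::comm_monoid_add"
  by (induction I rule: infinite_finite_induct) auto

lemma scaleR_fun_apply [simp]: "(c *\<^sub>R f) x = c *\<^sub>R f x"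
  by (simp add: scaleR_fun_def)

definition fmul :: "('m \<Rightarrow> real) \<Rightarrow> 'm vfield \<Rightarrow> 'm vfield"
  where "fmul h X = (\<lambda>x. h x *\<^sub>R X x)"

lemma fmul_apply [simp]: "fmul h X x = h x *\<^sub>R X x"
  by (simp add: fmul_def)

context mfd
begin

lemma vf_tangent: "X \<in> vector_fields A \<Longrightarrow> X x \<in> tangent_space A x"
  by (simp add: vector_fields_def)

lemma vf_sm: "X \<in> vector_fields A \<Longrightarrow> sm f x \<Longrightarrow> sm (\<lambda>y. X y f) x"
  by (simp add: vector_fields_def)

lemma tv_expand_apply:
  assumes "v \<in> tangent_space A x" "(U, \<psi>) \<in> A" "x \<in> U" "sm f x"
  shows "v f = (\<Sum>c\<in>C. v (coord \<psi> (d c)) * pd U \<psi> c f x)"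
  using arg_cong[OF tv_expand[OF assms(1-3)], of "\<lambda>v. v f"] assms(4)
  by (simp add: sum_fun_apply rep_def)

lemma eventually_sm_chart:
  assumes "(U, \<psi>) \<in> A" "x \<in> U" "sm f x"
  shows "\<forall>\<^sub>F y in nhds x. y \<in> U \<and> sm f y"
  using eventually_nhds_in_open[of U x] chart[OF assms(1)] sm_eventually[OF assms(3)] assms(2)
  by (auto intro: eventually_conj)

lemma vf_expand:
  assumes "\<And>y. X y \<in> tangent_space A y" "(U, \<psi>) \<in> A" "x \<in> U" "sm f x"
  shows "\<forall>\<^sub>F y in nhds x. X y f = (\<Sum>c\<in>C. X y (coord \<psi> (d c)) * pd U \<psi> c f y)"
  using eventually_sm_chart[OF assms(2-4)]
  by (rule eventually_mono) (use tv_expand_apply[OF assms(1,2)] in blast)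

text \<open>Near x the function X f is the sum of the X(coordinate) times the partial derivatives of
  f, so smoothness needs to be tested on coordinate functions only.\<close>

lemma vector_fieldsI:
  assumes "\<And>x. X x \<in> tangent_space A x"
    and "\<And>x. \<exists>U \<psi>. (U, \<psi>) \<in> A \<and> x \<in> U \<and> (\<forall>c\<in>C. sm (\<lambda>y. X y (coord \<psi> (d c))) x)"
  shows "X \<in> vector_fields A"
proof -
  have "sm (\<lambda>y. X y f) x" if f: "sm f x" for f x
  proof -
    obtain U \<psi> where c: "(U, \<psi>) \<in> A" "x \<in> U" "\<And>c. c \<in> C \<Longrightarrow> sm (\<lambda>y. X y (coord \<psi> (d c))) x"
      using assms(2)[of x] by blast
    have "sm (\<lambda>y. \<Sum>c\<in>C. X y (coord \<psi> (d c)) * pd U \<psi> c f y) x"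
      by (intro sm_sum sm_mult c(3) pd_sm[OF c(1,2) f])
    moreover have "\<forall>\<^sub>F y in nhds x. (\<Sum>c\<in>C. X y (coord \<psi> (d c)) * pd U \<psi> c f y) = X y f"
      using vf_expand[OF assms(1) c(1,2) f] by (rule eventually_mono) (rule sym)
    ultimately show ?thesis by (rule sm_cong)
  qed
  then show ?thesis using assms(1) by (simp add: vector_fields_def)
qed

lemma vf_add:
  assumes "X \<in> vector_fields A" "Y \<in> vector_fields A"
  shows "X + Y \<in> vector_fields A"
  using assms sm_add tangent_space_add by (simp add: vector_fields_def)

lemma vf_fmul:
  assumes "X \<in> vector_fields A" "\<And>x. sm h x"
  shows "fmul h X \<in> vector_fields A"
  using assms sm_mult tangent_space_scale by (simp add: vector_fields_def)

lemma vf_0: "0 \<in> vector_fields A"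
  using sm_const tangent_space_0 by (simp add: vector_fields_def)

lemma vf_sum: "(\<And>i. i \<in> I \<Longrightarrow> X i \<in> vector_fields A) \<Longrightarrow> (\<Sum>i\<in>I. X i) \<in> vector_fields A"
  by (induction I rule: infinite_finite_induct) (simp_all add: vf_0 vf_add)

text \<open>The second-order terms of XY and YX agree by the symmetry of second derivatives.\<close>
lemma lie_bracket_tangent:
  assumes "X \<in> vector_fields A" "Y \<in> vector_fields A"
  shows "lie_bracket A X Y x \<in> tangent_space A x"
proof -
  obtain U \<psi> where c: "(U, \<psi>) \<in> A" "x \<in> U" using chart_at .
  define a where "a = (\<lambda>(X :: 'm vfield) c y. X y (coord \<psi> (d c)))"
  have a: "sm (a X c) x" if "X \<in> vector_fields A" for X c
    unfolding a_def by (rule vf_sm[OF that sm_coord[OF c]])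
  have second: "X x (\<lambda>y. Y y f) = (\<Sum>c\<in>C. X x (a Y c) * pd U \<psi> c f x)
      + (\<Sum>c\<in>C. \<Sum>e\<in>C. a Y c x * a X e x * pd U \<psi> e (pd U \<psi> c f) x)"
    if X: "X \<in> vector_fields A" and Y: "Y \<in> vector_fields A" and f: "sm f x" for X Y f
  proof -
    have "X x (\<lambda>y. Y y f) = X x (\<lambda>y. \<Sum>c\<in>C. a Y c y * pd U \<psi> c f y)"
      unfolding a_def by (rule tv_cong[OF vf_tangent[OF X] vf_expand[OF vf_tangent[OF Y] c f]])
    also have "\<dots> = (\<Sum>c\<in>C. X x (\<lambda>y. a Y c y * pd U \<psi> c f y))"
      by (rule tv_sum[OF vf_tangent[OF X] sm_mult[OF a[OF Y] pd_sm[OF c f]]])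
    also have "\<dots> = (\<Sum>c\<in>C. a Y c x * X x (pd U \<psi> c f) + X x (a Y c) * pd U \<psi> c f x)"
      by (intro sum.cong refl tv_mult[OF vf_tangent[OF X] a[OF Y] pd_sm[OF c f]])
    also have "\<dots> = (\<Sum>c\<in>C. a Y c x * (\<Sum>e\<in>C. a X e x * pd U \<psi> e (pd U \<psi> c f) x) + X x (a Y c) * pd U \<psi> c f x)"
      using tv_expand_apply[OF vf_tangent[OF X] c pd_sm[OF c f]] by (simp add: a_def)
    finally show ?thesis by (simp add: sum.distrib sum_distrib_left mult.assoc add.commute)
  qed
  have "lie_bracket A X Y x f = (\<Sum>c\<in>C. (X x (a Y c) - Y x (a X c)) *\<^sub>R rep U \<psi> x c f)" for f
  proof (cases "sm f x")
    case True
    have "(\<Sum>c\<in>C. \<Sum>e\<in>C. a Y c x * a X e x * pd U \<psi> e (pd U \<psi> c f) x)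
        = (\<Sum>c\<in>C. \<Sum>e\<in>C. a X c x * a Y e x * pd U \<psi> e (pd U \<psi> c f) x)"
      by (subst sum.swap) (simp add: pd_commute[OF c True] mult.commute mult.left_commute)
    then show ?thesis
      using True second[OF assms True] second[OF assms(2,1) True]
      by (simp add: lie_bracket_def rep_def left_diff_distrib sum_subtractf)
  qed (simp add: lie_bracket_def rep_def)
  then have "lie_bracket A X Y x = (\<Sum>c\<in>C. (X x (a Y c) - Y x (a X c)) *\<^sub>R rep U \<psi> x c)"
    by (simp add: fun_eq_iff sum_fun_apply)
  then show ?thesis
    by (simp add: tangent_space_sum tangent_space_scale rep_in_tangent_space[OF c])
qed

lemma lie_bracket_skew: "lie_bracket A X Y = - lie_bracket A Y X"
  by (auto simp: lie_bracket_def fun_eq_iff)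

lemma lie_bracket_add_left:
  assumes "X \<in> vector_fields A" "X' \<in> vector_fields A" "Y \<in> vector_fields A"
  shows "lie_bracket A (X + X') Y = lie_bracket A X Y + lie_bracket A X' Y"
  using assms tv_add[OF vf_tangent[OF assms(3)] vf_sm[OF assms(1)] vf_sm[OF assms(2)]]
  by (auto simp: lie_bracket_def fun_eq_iff)

lemma lie_bracket_fmul_left:
  assumes "X \<in> vector_fields A" "Y \<in> vector_fields A" "\<And>x. sm h x"
  shows "lie_bracket A (fmul h X) Y x = h x *\<^sub>R lie_bracket A X Y x - Y x h *\<^sub>R X x"
proof
  fix f
  show "lie_bracket A (fmul h X) Y x f = (h x *\<^sub>R lie_bracket A X Y x - Y x h *\<^sub>R X x) f"
    using tv_mult[OF vf_tangent[OF assms(2)] assms(3) vf_sm[OF assms(1)], of f x]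
      tv_nonsmooth[OF vf_tangent[OF assms(1)], of f x]
    by (auto simp: lie_bracket_def algebra_simps)
qed

section \<open>Tensors of type (1,1) and the Nijenhuis tensor\<close>

lemma tensor11_tangent: "tensor11 A J \<Longrightarrow> v \<in> tangent_space A x \<Longrightarrow> J x v \<in> tangent_space A x"
  by (simp add: tensor11_def)

lemma tensor11_add: "tensor11 A J \<Longrightarrow> v \<in> tangent_space A x \<Longrightarrow> w \<in> tangent_space A x \<Longrightarrow>
    J x (v + w) = J x v + J x w"
  by (simp add: tensor11_def)

lemma tensor11_scale: "tensor11 A J \<Longrightarrow> v \<in> tangent_space A x \<Longrightarrow> J x (a *\<^sub>R v) = a *\<^sub>R J x v"
  by (simp add: tensor11_def)

lemma tensor11_minus: "tensor11 A J \<Longrightarrow> v \<in> tangent_space A x \<Longrightarrow> J x (- v) = - J x v"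
  using tensor11_scale[of J v x "-1"] by simp

lemma tensor11_diff: "tensor11 A J \<Longrightarrow> v \<in> tangent_space A x \<Longrightarrow> w \<in> tangent_space A x \<Longrightarrow>
    J x (v - w) = J x v - J x w"
  using tensor11_add[of J v x "- w"] tensor11_minus[of J w x] tangent_space_neg by simp

lemma tensor11_0: "tensor11 A J \<Longrightarrow> J x 0 = 0"
  using tensor11_scale[of J 0 x 0] tangent_space_0 by simp

lemma tensor11_sum: "tensor11 A J \<Longrightarrow> (\<And>i. i \<in> I \<Longrightarrow> v i \<in> tangent_space A x) \<Longrightarrow>
    J x (\<Sum>i\<in>I. v i) = (\<Sum>i\<in>I. J x (v i))"
proof (induction I rule: infinite_finite_induct)
  case (insert i I)
  have IH: "J x (\<Sum>i\<in>I. v i) = (\<Sum>i\<in>I. J x (v i))"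
    by (rule insert.IH) (simp_all add: insert.prems)
  have "J x (v i + (\<Sum>i\<in>I. v i)) = J x (v i) + J x (\<Sum>i\<in>I. v i)"
    by (rule tensor11_add[OF insert.prems(1)]) (simp_all add: insert.prems tangent_space_sum)
  then show ?case by (simp only: sum.insert[OF insert.hyps] IH)
qed (use tensor11_0[of J x] in simp_all)

lemma tensor11_vf: "tensor11 A J \<Longrightarrow> X \<in> vector_fields A \<Longrightarrow> app_field J X \<in> vector_fields A"
  by (simp add: tensor11_def)

lemma app_field_apply: "app_field J X x = J x (X x)"
  by (simp add: app_field_def)

lemma nijenhuis_apply: "nijenhuis A J X Y x = J x (J x (lie_bracket A X Y x))
    + lie_bracket A (app_field J X) (app_field J Y) x
    - J x (lie_bracket A (app_field J X) Y x) - J x (lie_bracket A X (app_field J Y) x)"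
  by (simp add: nijenhuis_def app_field_apply)

lemma nijenhuis_skew:
  assumes "tensor11 A J" "X \<in> vector_fields A" "Y \<in> vector_fields A"
  shows "nijenhuis A J X Y = - nijenhuis A J Y X"
proof
  fix x
  have s: "lie_bracket A X Y x = - lie_bracket A Y X x" for X Y
    by (subst lie_bracket_skew) simp
  have J: "J x (lie_bracket A X Y x) = - J x (lie_bracket A Y X x)"
    if "X \<in> vector_fields A" "Y \<in> vector_fields A" for X Y
    unfolding s[of X Y] by (rule tensor11_minus[OF assms(1) lie_bracket_tangent[OF that(2,1)]])
  note JX = tensor11_vf[OF assms(1,2)] and JY = tensor11_vf[OF assms(1,3)]
  note m = tensor11_minus[OF assms(1) tensor11_tangent[OF assms(1) lie_bracket_tangent[OF assms(3,2)]]]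
  have "nijenhuis A J X Y x = - nijenhuis A J Y X x"
    unfolding nijenhuis_apply J[OF assms(2,3)] J[OF JX assms(3)] J[OF assms(2) JY]
      m s[of "app_field J X" "app_field J Y"] by (simp add: algebra_simps)
  then show "nijenhuis A J X Y x = (- nijenhuis A J Y X) x" by simp
qed

lemma nijenhuis_tangent:
  assumes "tensor11 A J" "X \<in> vector_fields A" "Y \<in> vector_fields A"
  shows "nijenhuis A J X Y x \<in> tangent_space A x"
proof -
  note JX = tensor11_vf[OF assms(1,2)] and JY = tensor11_vf[OF assms(1,3)] and J = tensor11_tangent[OF assms(1)]
  show ?thesis unfolding nijenhuis_apply
    by (intro tangent_space_add tangent_space_diff J lie_bracket_tangent[OF assms(2,3)]
        lie_bracket_tangent[OF JX JY] lie_bracket_tangent[OF JX assms(3)] lie_bracket_tangent[OF assms(2) JY])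
qed

lemma nijenhuis_add_left:
  assumes J: "tensor11 A J" and X: "X \<in> vector_fields A" and X': "X' \<in> vector_fields A"
    and Y: "Y \<in> vector_fields A"
  shows "nijenhuis A J (X + X') Y = nijenhuis A J X Y + nijenhuis A J X' Y"
proof
  fix x
  have s: "app_field J (X + X') = app_field J X + app_field J X'"
    using tensor11_add[OF J vf_tangent[OF X] vf_tangent[OF X']]
    by (intro ext) (simp add: app_field_apply)
  note JX = tensor11_vf[OF J X] and JX' = tensor11_vf[OF J X'] and JY = tensor11_vf[OF J Y]
  have a: "J x (lie_bracket A (X + X') Y x) = J x (lie_bracket A X Y x) + J x (lie_bracket A X' Y x)"
    if "X \<in> vector_fields A" "X' \<in> vector_fields A" "Y \<in> vector_fields A" for X X' Y
    unfolding lie_bracket_add_left[OF that]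
    by (subst plus_fun_apply) (rule tensor11_add[OF J lie_bracket_tangent[OF that(1,3)] lie_bracket_tangent[OF that(2,3)]])
  note b = tensor11_add[OF J tensor11_tangent[OF J lie_bracket_tangent[OF X Y]]
      tensor11_tangent[OF J lie_bracket_tangent[OF X' Y]]]
  have c: "lie_bracket A (app_field J X + app_field J X') (app_field J Y) x
      = lie_bracket A (app_field J X) (app_field J Y) x + lie_bracket A (app_field J X') (app_field J Y) x"
    unfolding lie_bracket_add_left[OF JX JX' JY] by (rule plus_fun_apply)
  have "nijenhuis A J (X + X') Y x = nijenhuis A J X Y x + nijenhuis A J X' Y x"
    unfolding nijenhuis_apply s a[OF X X' Y] b a[OF JX JX' Y] a[OF X X' JY] c
    by (simp only: algebra_simps)
  then show "nijenhuis A J (X + X') Y x = (nijenhuis A J X Y + nijenhuis A J X' Y) x" by simp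
qed

text \<open>The derivatives of h contribute -Y(h) J^2 X - (JY)(h) JX + J(Y(h) JX) + J((JY)(h) X),
  which cancels in pairs.\<close>

lemma nijenhuis_fmul_left:
  assumes J: "tensor11 A J" and X: "X \<in> vector_fields A" and Y: "Y \<in> vector_fields A"
    and h: "\<And>x. sm h x"
  shows "nijenhuis A J (fmul h X) Y = fmul h (nijenhuis A J X Y)"
proof
  fix x
  have s: "app_field J (fmul h X) = fmul h (app_field J X)"
    using tensor11_scale[OF J vf_tangent[OF X]] by (intro ext) (simp add: app_field_apply)
  note JX = tensor11_vf[OF J X] and JY = tensor11_vf[OF J Y]
  have lin: "J x (a *\<^sub>R v - b *\<^sub>R w) = a *\<^sub>R J x v - b *\<^sub>R J x w"
    if "v \<in> tangent_space A x" "w \<in> tangent_space A x" for a b v w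
    using tensor11_diff[OF J tangent_space_scale[OF that(1), of a] tangent_space_scale[OF that(2), of b]]
      tensor11_scale[OF J that(1), of a] tensor11_scale[OF J that(2), of b] by metis
  note t = lie_bracket_tangent[OF X Y] lie_bracket_tangent[OF JX Y] lie_bracket_tangent[OF X JY]
    vf_tangent[OF X]
  note l = lin[OF t(1,4)] lin[OF t(2) tensor11_tangent[OF J t(4)]] lin[OF t(3,4)]
    lin[OF tensor11_tangent[OF J t(1)] tensor11_tangent[OF J t(4)]]
  have "nijenhuis A J (fmul h X) Y x = h x *\<^sub>R nijenhuis A J X Y x"
    unfolding nijenhuis_apply s lie_bracket_fmul_left[OF X Y h] lie_bracket_fmul_left[OF JX Y h]
        lie_bracket_fmul_left[OF JX JY h] lie_bracket_fmul_left[OF X JY h] app_field_apply[of J X x] l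
    by (simp add: algebra_simps)
  then show "nijenhuis A J (fmul h X) Y x = fmul h (nijenhuis A J X Y) x" by simp
qed

lemma nijenhuis_0_left:
  assumes J: "tensor11 A J" and Y: "Y \<in> vector_fields A"
  shows "nijenhuis A J 0 Y = 0"
  using nijenhuis_add_left[OF J vf_0 vf_0 Y] by simp

lemma nijenhuis_sum_left:
  assumes J: "tensor11 A J" and Y: "Y \<in> vector_fields A"
  shows "(\<And>i. i \<in> I \<Longrightarrow> X i \<in> vector_fields A) \<Longrightarrow>
    nijenhuis A J (\<Sum>i\<in>I. X i) Y = (\<Sum>i\<in>I. nijenhuis A J (X i) Y)"
proof (induction I rule: infinite_finite_induct)
  case (insert i I)
  have IH: "nijenhuis A J (\<Sum>i\<in>I. X i) Y = (\<Sum>i\<in>I. nijenhuis A J (X i) Y)"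
    by (rule insert.IH) (simp add: insert.prems)
  have "nijenhuis A J (X i + (\<Sum>i\<in>I. X i)) Y = nijenhuis A J (X i) Y + nijenhuis A J (\<Sum>i\<in>I. X i) Y"
    by (rule nijenhuis_add_left[OF J _ _ Y]) (simp_all add: insert.prems vf_sum)
  then show ?case by (simp only: sum.insert[OF insert.hyps] IH)
qed (simp_all add: nijenhuis_0_left[OF J Y])

text \<open>After J^2 = -I is inserted, the four terms of the left-hand side are those of -J
  [J, J](X, Y) in another order. This spares all brackets with the frame of the Lie group.\<close>

lemma nijenhuis_J_left:
  assumes J: "tensor11 A J" and J2: "\<And>x v. v \<in> tangent_space A x \<Longrightarrow> J x (J x v) = - v"
    and X: "X \<in> vector_fields A" and Y: "Y \<in> vector_fields A"
  shows "nijenhuis A J (app_field J X) Y x = - J x (nijenhuis A J X Y x)"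
proof -
  note JX = tensor11_vf[OF J X] and JY = tensor11_vf[OF J Y]
  note t = lie_bracket_tangent[OF X Y, of x] lie_bracket_tangent[OF JX Y, of x]
    lie_bracket_tangent[OF X JY, of x] lie_bracket_tangent[OF JX JY, of x]
  \<comment> \<open>Writing -X as a multiple by the constant function -1 makes the Leibniz rule for
    brackets applicable; the derivative of the constant vanishes.\<close>
  have m: "app_field J (app_field J X) = fmul (\<lambda>y. - 1) X"
    using J2[OF vf_tangent[OF X]] by (intro ext) (simp add: app_field_apply)
  have h: "sm (\<lambda>y. - 1) x" for x by (rule sm_const)
  have b: "lie_bracket A (app_field J (app_field J X)) Z x = - lie_bracket A X Z x"
    if "Z \<in> vector_fields A" for Z
    unfolding m lie_bracket_fmul_left[OF X that h] using tv_const[OF vf_tangent[OF that]] by simp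
  note T = tensor11_tangent[OF J t(1)] tensor11_tangent[OF J t(2)] tensor11_tangent[OF J t(3)]
  have "J x (nijenhuis A J X Y x) = - J x (lie_bracket A X Y x)
      + J x (lie_bracket A (app_field J X) (app_field J Y) x)
      + lie_bracket A (app_field J X) Y x + lie_bracket A X (app_field J Y) x"
    unfolding nijenhuis_apply J2[OF t(1)]
      tensor11_diff[OF J tangent_space_diff[OF tangent_space_add[OF tangent_space_neg[OF t(1)] t(4)] T(2)] T(3)]
      tensor11_diff[OF J tangent_space_add[OF tangent_space_neg[OF t(1)] t(4)] T(2)]
      tensor11_add[OF J tangent_space_neg[OF t(1)] t(4)] tensor11_minus[OF J t(1)] J2[OF t(2)] J2[OF t(3)]
    by simp
  then show ?thesis
    unfolding nijenhuis_apply[of J "app_field J X"] b[OF Y] b[OF JY] J2[OF t(2)] tensor11_minus[OF J t(1)]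
    by (simp add: algebra_simps)
qed

text \<open>Local frames extend to global fields only after multiplication by a bump function; so a field
  is a combination of global fields with global smooth coefficients only up to a factor h that does
  not vanish at the given point. This suffices for tensors.\<close>
definition frames :: "'m vfield set \<Rightarrow> bool"
  where "frames E \<longleftrightarrow> E \<subseteq> vector_fields A \<and>
    (\<forall>X\<in>vector_fields A. \<forall>x. \<exists>h (I :: nat set) a e. (\<forall>y. sm h y) \<and> h x \<noteq> 0 \<and>
      (\<forall>i\<in>I. e i \<in> E \<and> (\<forall>y. sm (a i) y)) \<and> fmul h X = (\<Sum>i\<in>I. fmul (a i) (e i)))"

lemma framesE:
  assumes "frames E" "X \<in> vector_fields A"
  obtains h and I :: "nat set" and a e where "\<forall>y. sm h y" "h x \<noteq> 0" "\<forall>i\<in>I. e i \<in> E"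
    "\<forall>i\<in>I. e i \<in> vector_fields A" "\<forall>i\<in>I. \<forall>y. sm (a i) y" "fmul h X = (\<Sum>i\<in>I. fmul (a i) (e i))"
proof -
  obtain h and I :: "nat set" and a e where *: "\<forall>y. sm h y" "h x \<noteq> 0"
    "\<forall>i\<in>I. e i \<in> E \<and> (\<forall>y. sm (a i) y)" "fmul h X = (\<Sum>i\<in>I. fmul (a i) (e i))"
    using assms unfolding frames_def by blast
  show ?thesis by (rule that[of h I e a]) (use * assms(1) in \<open>auto simp: frames_def\<close>)
qed

text \<open>Preservation of smooth fields is itself a clause of \<open>tensor11\<close>, so J is
  given here by pointwise linearity and its behaviour on E alone. From h X = \<Sum> a_i e_i follows
  h JX = \<Sum> a_i J e_i, and near x one may divide by h.\<close>

lemma vf_app_field_frames: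
  assumes "frames E"
    and "\<And>x v. v \<in> tangent_space A x \<Longrightarrow> J x v \<in> tangent_space A x"
    and "\<And>x v w. v \<in> tangent_space A x \<Longrightarrow> w \<in> tangent_space A x \<Longrightarrow> J x (v + w) = J x v + J x w"
    and "\<And>x a v. v \<in> tangent_space A x \<Longrightarrow> J x (a *\<^sub>R v) = a *\<^sub>R J x v"
    and "\<And>e. e \<in> E \<Longrightarrow> app_field J e \<in> vector_fields A"
    and X: "X \<in> vector_fields A"
  shows "app_field J X \<in> vector_fields A"
proof -
  \<comment> \<open>This covers empty and infinite index sets alike, since \<open>frames\<close>
    leaves the index set arbitrary and a sum over an infinite set is 0.\<close>
  have J0: "J x 0 = 0" for x using assms(4)[of 0 x 0] tangent_space_0 by simp
  have Jsum: "J x (\<Sum>i\<in>I. v i) = (\<Sum>i\<in>I. J x (v i))"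
    if "\<And>i. i \<in> I \<Longrightarrow> v i \<in> tangent_space A x" for I :: "nat set" and x v
    using that
  proof (induction I rule: infinite_finite_induct)
    case (insert i I)
    have IH: "J x (\<Sum>i\<in>I. v i) = (\<Sum>i\<in>I. J x (v i))"
      by (rule insert.IH) (simp add: insert.prems)
    have "J x (v i + (\<Sum>i\<in>I. v i)) = J x (v i) + J x (\<Sum>i\<in>I. v i)"
      by (rule assms(3)) (simp_all add: insert.prems tangent_space_sum)
    then show ?case by (simp only: sum.insert[OF insert.hyps] IH)
  qed (simp_all add: J0)
  have "sm (\<lambda>y. J y (X y) f) x" if f: "sm f x" for f x
  proof -
    obtain h and I :: "nat set" and a e where *: "\<forall>y. sm h y" "h x \<noteq> 0" "\<forall>i\<in>I. e i \<in> E"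
      "\<forall>i\<in>I. e i \<in> vector_fields A" "\<forall>i\<in>I. \<forall>y. sm (a i) y" and eq: "fmul h X = (\<Sum>i\<in>I. fmul (a i) (e i))"
      by (rule framesE[OF assms(1) X, of x])
    note h = *(1)[rule_format] *(2) and e = *(3,4)[rule_format] and a = *(5)[rule_format]
    have hJ: "h y * J y (X y) f = (\<Sum>i\<in>I. a i y * J y (e i y) f)" for y
    proof -
      have "h y *\<^sub>R J y (X y) = J y (fmul h X y)" using assms(4)[OF vf_tangent[OF X]] by simp
      also have "\<dots> = J y (\<Sum>i\<in>I. a i y *\<^sub>R e i y)" by (simp add: eq sum_fun_apply)
      also have "\<dots> = (\<Sum>i\<in>I. J y (a i y *\<^sub>R e i y))"
        by (rule Jsum) (rule tangent_space_scale[OF vf_tangent[OF e(2)]])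
      also have "\<dots> = (\<Sum>i\<in>I. a i y *\<^sub>R J y (e i y))"
        by (rule sum.cong[OF refl]) (rule assms(4)[OF vf_tangent[OF e(2)]])
      finally show ?thesis by (simp add: fun_eq_iff sum_fun_apply)
    qed
    have Je: "sm (\<lambda>y. J y (e i y) f) x" if "i \<in> I" for i
      using vf_sm[OF assms(5)[OF e(1)[OF that]] f] by (simp add: app_field_apply)
    have "sm (\<lambda>y. (\<Sum>i\<in>I. a i y * J y (e i y) f) / h y) x"
      by (intro sm_divide sm_sum sm_mult Je a h)
    moreover have "\<forall>\<^sub>F y in nhds x. (\<Sum>i\<in>I. a i y * J y (e i y) f) / h y = J y (X y) f"
      using sm_nonzero(2)[OF h] by (rule eventually_mono) (simp flip: hJ)
    ultimately show ?thesis by (rule sm_cong)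
  qed
  then show ?thesis using assms(2)[OF vf_tangent[OF X]] by (simp add: vector_fields_def app_field_apply)
qed

text \<open>Linearity over functions is available in the first argument only; skew symmetry
  transfers the reduction to the second.\<close>

lemma nijenhuis_0_frames:
  assumes "frames E" and J: "tensor11 A J"
    and "\<And>e e'. e \<in> E \<Longrightarrow> e' \<in> E \<Longrightarrow> nijenhuis A J e e' = 0"
    and X: "X \<in> vector_fields A" and Y: "Y \<in> vector_fields A"
  shows "nijenhuis A J X Y = 0"
proof -
  have *: "nijenhuis A J X Y = 0" if X: "X \<in> vector_fields A" and Y: "Y \<in> vector_fields A"
    and 0: "\<And>e. e \<in> E \<Longrightarrow> nijenhuis A J e Y = 0" for X Y
  proof
    fix x
    obtain h and I :: "nat set" and a e where *: "\<forall>y. sm h y" "h x \<noteq> 0" "\<forall>i\<in>I. e i \<in> E"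
      "\<forall>i\<in>I. e i \<in> vector_fields A" "\<forall>i\<in>I. \<forall>y. sm (a i) y" and eq: "fmul h X = (\<Sum>i\<in>I. fmul (a i) (e i))"
      by (rule framesE[OF assms(1) X, of x])
    note h = *(1)[rule_format] *(2) and e = *(3,4)[rule_format] and a = *(5)[rule_format]
    have "fmul h (nijenhuis A J X Y) = nijenhuis A J (fmul h X) Y"
      by (rule nijenhuis_fmul_left[OF J X Y h(1), symmetric])
    also have "\<dots> = (\<Sum>i\<in>I. nijenhuis A J (fmul (a i) (e i)) Y)"
      unfolding eq by (rule nijenhuis_sum_left[OF J Y vf_fmul[OF e(2) a]])
    also have "\<dots> = (\<Sum>i\<in>I. fmul (a i) (nijenhuis A J (e i) Y))"
      by (intro sum.cong refl nijenhuis_fmul_left[OF J e(2) Y a])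
    also have "\<dots> = 0" by (rule sum.neutral) (use 0 e in \<open>auto simp: fun_eq_iff\<close>)
    finally have "h x *\<^sub>R nijenhuis A J X Y x = 0" by (metis fmul_apply zero_fun_apply)
    then show "nijenhuis A J X Y x = 0 x" using h by simp
  qed
  have E: "e \<in> vector_fields A" if "e \<in> E" for e using assms(1) that by (auto simp: frames_def)
  have "nijenhuis A J e Y = 0" if "e \<in> E" for e
    using *[OF Y E[OF that]] assms(3)[OF _ that] nijenhuis_skew[OF J E[OF that] Y] by simp
  then show ?thesis using * X Y by blast
qed

text \<open>Gaussian elimination, with a pivot that stays nonzero near the point.\<close>
lemma sm_coefficients:
  fixes v :: "nat \<Rightarrow> 'i \<Rightarrow> 'm \<Rightarrow> real"
  assumes "\<And>j c. j < p \<Longrightarrow> c \<in> I \<Longrightarrow> sm (v j c) q" "\<And>c. c \<in> I \<Longrightarrow> sm (Z c) q"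
    and "\<And>a. (\<And>c. c \<in> I \<Longrightarrow> (\<Sum>j<p. a j * v j c q) = 0) \<Longrightarrow> \<forall>j<p. a j = 0"
    and "\<And>c. c \<in> I \<Longrightarrow> \<forall>\<^sub>F y in nhds q. Z c y = (\<Sum>j<p. k j y * v j c y)"
  shows "j < p \<Longrightarrow> sm (k j) q"
  using assms
proof (induction p arbitrary: v Z j)
  case (Suc p)
  have "\<exists>c0\<in>I. v p c0 q \<noteq> 0"
  proof (rule ccontr)
    assume "\<not> ?thesis"
    \<comment> \<open>If the last vector vanished at q in every component c, its unit coefficient
      would be a nontrivial relation.\<close>
    then have "\<forall>j<Suc p. (if j = p then 1 else 0 :: real) = 0"
      by (intro Suc.prems(4)) (auto simp: if_distrib[of "\<lambda>a. a * _"] cong: if_cong)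
    then show False by (auto dest: spec[of _ p])
  qed
  then obtain c0 where c0: "c0 \<in> I" "v p c0 q \<noteq> 0" by blast
  have p0: "sm (v p c0) q" using Suc.prems(2) c0 by simp
  \<comment> \<open>The pivot equation c0 removes the last unknown from every other equation; W is
    the reduced left-hand side.\<close>
  define w where "w = (\<lambda>j c y. v j c y - v j c0 y / v p c0 y * v p c y)"
  define W where "W = (\<lambda>c y. Z c y - Z c0 y / v p c0 y * v p c y)"
  note ev = eventually_conj[OF sm_nonzero(2)[OF p0 c0(2)] Suc.prems(5)[OF c0(1)]]
  have k: "sm (k j) q" if "j < p" for j
  proof (rule Suc.IH[OF that])
    show "sm (w j c) q" if "j < p" "c \<in> I" for j c
      unfolding w_def using Suc.prems(2)[of _ c] Suc.prems(2)[of _ c0] c0 that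
      by (intro sm_diff sm_mult sm_divide p0) auto
    show "sm (W c) q" if "c \<in> I" for c
      unfolding W_def using Suc.prems(2)[of _ c] Suc.prems(3) c0 that
      by (intro sm_diff sm_mult sm_divide p0) auto
    show "\<forall>j<p. a j = 0" if a: "\<And>c. c \<in> I \<Longrightarrow> (\<Sum>j<p. a j * w j c q) = 0" for a
    proof -
      \<comment> \<open>The coefficient at p solves equation c0, so that a relation among the
        reduced vectors w extends to one among the vectors v.\<close>
      define b where "b = a(p := - (\<Sum>j<p. a j * v j c0 q) / v p c0 q)"
      have "(\<Sum>j<Suc p. b j * v j c q) = (\<Sum>j<p. a j * w j c q)" for c
      proof -
        have "(\<Sum>j<Suc p. b j * v j c q)
            = (\<Sum>j<p. a j * v j c q) - (\<Sum>j<p. a j * v j c0 q) / v p c0 q * v p c q"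
          by (simp add: b_def)
        also have "\<dots> = (\<Sum>j<p. a j * w j c q)"
          by (simp add: w_def right_diff_distrib sum_subtractf sum_divide_distrib sum_distrib_right mult.assoc)
        finally show ?thesis .
      qed
      then have "\<forall>j<Suc p. b j = 0" using a by (intro Suc.prems(4)) simp
      then show ?thesis by (auto simp: b_def dest: less_SucI)
    qed
    show "\<forall>\<^sub>F y in nhds q. W c y = (\<Sum>j<p. k j y * w j c y)" if "c \<in> I" for c
      using eventually_conj[OF ev Suc.prems(5)[OF that]]
    proof (rule eventually_mono)
      fix y
      let ?S = "\<lambda>c. \<Sum>j<p. k j y * v j c y"
      assume *: "(v p c0 y \<noteq> 0 \<and> Z c0 y = (\<Sum>j<Suc p. k j y * v j c0 y)) \<and> Z c y = (\<Sum>j<Suc p. k j y * v j c y)"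
      then have r: "Z c0 y / v p c0 y = ?S c0 / v p c0 y + k p y" by (simp add: field_simps)
      have "W c y = ?S c + k p y * v p c y - (?S c0 / v p c0 y + k p y) * v p c y"
        unfolding W_def r using * by simp
      also have "\<dots> = ?S c - ?S c0 / v p c0 y * v p c y" by (simp add: distrib_right)
      also have "\<dots> = (\<Sum>j<p. k j y * w j c y)"
        by (simp add: w_def right_diff_distrib sum_subtractf sum_divide_distrib sum_distrib_right mult.assoc)
      finally show "W c y = (\<Sum>j<p. k j y * w j c y)" .
    qed
  qed
  show ?case
  proof (cases "j < p")
    case False
    then have j: "j = p" using Suc.prems(1) by simp
    have "sm (\<lambda>y. (Z c0 y - (\<Sum>j<p. k j y * v j c0 y)) / v p c0 y) q"
      using Suc.prems(2,3) c0 k by (intro sm_divide sm_diff sm_sum sm_mult) auto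
    moreover have "\<forall>\<^sub>F y in nhds q. (Z c0 y - (\<Sum>j<p. k j y * v j c0 y)) / v p c0 y = k p y"
      using ev by (rule eventually_mono) auto
    ultimately show ?thesis unfolding j by (rule sm_cong)
  qed (rule k)
qed simp

text \<open>Off the closed set K the product is 0 on a whole neighbourhood, whatever f does there.
  This turns coefficients that are smooth only over a chart into global ones.\<close>

lemma sm_cutoff:
  assumes "closed K" "\<And>y. sm \<beta> y" "\<And>y. y \<notin> K \<Longrightarrow> \<beta> y = 0" "\<And>y. y \<in> K \<Longrightarrow> sm f y"
  shows "sm (\<lambda>y. \<beta> y * f y) x"
proof (cases "x \<in> K")
  case True
  then show ?thesis using assms sm_mult by blast
next
  case False
  have "\<forall>\<^sub>F y in nhds x. 0 = \<beta> y * f y"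
    using eventually_nhds_in_open[of "- K" x] assms(1) False
    by (auto elim!: eventually_mono simp: assms(3) open_Compl)
  then show ?thesis by (rule sm_cong[OF sm_const])
qed

end

subsection \<open>Bump functions\<close>

text \<open>The function is the flat function of r^2 - |\<psi> y - \<psi> x|^2, extended by 0
  outside the chart. The extension is smooth at points off U because K is closed in the whole
  manifold, not merely in U.\<close>

lemma (in mfd) bump:
  fixes K :: "'m set"
  assumes "(U, \<psi>) \<in> A" "x \<in> U" "0 < r" "closed K" "K = {y\<in>U. dist (\<psi> y) (\<psi> x) \<le> r}"
  obtains \<beta> where "\<And>y. sm \<beta> y" "\<beta> x \<noteq> 0" "\<And>y. y \<notin> K \<Longrightarrow> \<beta> y = 0"
proof -
  define flat where "flat = (\<lambda>t::real. if t \<le> 0 then 0 else exp (- inverse t))"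
  define q where "q = (\<lambda>z. r * r - (z - \<psi> x) \<bullet> (z - \<psi> x))"
  define \<beta> where "\<beta> = (\<lambda>y. if y \<in> U then flat (q (\<psi> y)) else 0)"
  have 0: "\<beta> y = 0" if "y \<notin> K" for y
  proof (cases "y \<in> U")
    case True
    then have "r < norm (\<psi> y - \<psi> x)" using that assms(5) by (simp add: dist_norm)
    then have "r * r < norm (\<psi> y - \<psi> x) * norm (\<psi> y - \<psi> x)" using assms(3) by (intro mult_strict_mono') auto
    then show ?thesis by (simp add: \<beta>_def q_def flat_def dot_square_norm power2_eq_square)
  qed (simp add: \<beta>_def)
  have "smooth_on UNIV (\<lambda>z. z - \<psi> x)"
    using smooth_on_add[OF open_UNIV smooth_on_ident[OF open_UNIV] smooth_on_const[OF open_UNIV], of "- \<psi> x"] by simp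
  then have "smooth_on UNIV (\<lambda>z. r * r + (- 1) * ((z - \<psi> x) \<bullet> (z - \<psi> x)))"
    by (intro smooth_on_add smooth_on_mult smooth_on_inner smooth_on_const open_UNIV)
  then have q: "smooth_on UNIV q" by (simp add: q_def)
  \<comment> \<open>The intermediate space of the composition is the real line.\<close>
  have "coframe {1::real} (\<lambda>_. 1)" by (simp add: coframe_def)
  from smooth_on_compose[OF this open_UNIV open_UNIV q smooth_on_flat]
  have "smooth_on UNIV (\<lambda>z. flat (q z))" by (simp add: flat_def)
  then have fq: "smooth_on (\<psi> ` U) (\<beta> \<circ> inv_into U \<psi>)"
  proof (rule smooth_on_cong[rotated 2, OF smooth_on_subset[OF _ subset_UNIV]])
    show "open (\<psi> ` U)" using chart[OF assms(1)] by blast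
    show "flat (q z) = (\<beta> \<circ> inv_into U \<psi>) z" if "z \<in> \<psi> ` U" for z
      using that by (auto simp: \<beta>_def chart_inv[OF assms(1)])
  qed
  have "sm \<beta> y" for y
  proof (cases "y \<in> U")
    case True
    show ?thesis by (rule smI[OF assms(1) True _ _ fq]) (use chart[OF assms(1)] True in auto)
  next
    case False
    then have "y \<in> - K" using assms(5) by simp
    then have "\<forall>\<^sub>F y in nhds y. 0 = \<beta> y"
      using eventually_nhds_in_open[of "- K" y] assms(4) 0
      by (auto elim!: eventually_mono simp: open_Compl)
    then show ?thesis by (rule sm_cong[OF sm_const])
  qed
  moreover have "\<beta> x \<noteq> 0" using assms(2) mult_pos_pos[OF assms(3,3)] by (simp add: \<beta>_def q_def flat_def)
  ultimately show ?thesis using that 0 by blast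
qed

text \<open>A closed coordinate ball is compact by the Heine-Borel property of the model space; its
  preimage is compact, hence closed in a Hausdorff manifold.\<close>

lemma bump_exists:
  fixes A :: "('m::t2_space, 'e::{real_inner,heine_borel}) atlas"
  assumes "mfd A C d" "(U, \<psi>) \<in> A" "x \<in> U"
  obtains K \<beta> where "closed K" "K \<subseteq> U" "\<And>y. smooth_fun_at A \<beta> y" "\<beta> x \<noteq> 0" "\<And>y. y \<notin> K \<Longrightarrow> \<beta> y = 0"
proof -
  interpret mfd A C d by fact
  have "open (\<psi> ` U)" "\<psi> x \<in> \<psi> ` U" using chart[OF assms(2)] assms(3) by auto
  then obtain r where r: "r > 0" "cball (\<psi> x) r \<subseteq> \<psi> ` U" using open_contains_cball by metis
  let ?K = "{y\<in>U. dist (\<psi> y) (\<psi> x) \<le> r}"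
  have "?K = inv_into U \<psi> ` cball (\<psi> x) r"
  proof (intro set_eqI iffI)
    fix y assume "y \<in> ?K"
    then show "y \<in> inv_into U \<psi> ` cball (\<psi> x) r"
      using chart_inv[OF assms(2), of y] by (intro image_eqI[of _ _ "\<psi> y"]) (auto simp: dist_commute)
  next
    fix y assume "y \<in> inv_into U \<psi> ` cball (\<psi> x) r"
    then obtain z where "y = inv_into U \<psi> z" "z \<in> cball (\<psi> x) r" by blast
    moreover then obtain u where "u \<in> U" "z = \<psi> u" using r(2) by blast
    ultimately show "y \<in> ?K" using chart_inv[OF assms(2)] by (simp add: dist_commute)
  qed
  moreover have "compact (cball (\<psi> x) r)"
    by (simp add: compact_eq_bounded_closed)
  moreover have "continuous_on (cball (\<psi> x) r) (inv_into U \<psi>)"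
    using chart[OF assms(2)] continuous_on_subset[OF _ r(2)] homeomorphism_cont2 by metis
  ultimately have "closed ?K" using compact_continuous_image compact_imp_closed by metis
  then obtain \<beta> where "\<forall>y. sm \<beta> y" "\<beta> x \<noteq> 0" "\<forall>y. y \<notin> ?K \<longrightarrow> \<beta> y = 0"
    using bump[OF assms(2,3) r(1) _ refl] by blast
  then show ?thesis using \<open>closed ?K\<close> by (intro that[of ?K \<beta>]) auto
qed

context mfd
begin

text \<open>Off U the value of \<open>rep\<close> need not be a tangent vector, but \<beta> is 0
  there, so the coordinate field is extended by zero.\<close>

lemma vf_cutoff:
  assumes "(U, \<psi>) \<in> A" "closed K" "K \<subseteq> U" "\<And>y. sm \<beta> y" "\<And>y. y \<notin> K \<Longrightarrow> \<beta> y = 0"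
  shows "fmul \<beta> (\<lambda>y. rep U \<psi> y w) \<in> vector_fields A"
proof -
  have "fmul \<beta> (\<lambda>y. rep U \<psi> y w) y \<in> tangent_space A y" for y
    using rep_in_tangent_space[OF assms(1)] tangent_space_scale tangent_space_0 assms(3,5)
    by (cases "y \<in> K") auto
  moreover have "sm (\<lambda>y. fmul \<beta> (\<lambda>y. rep U \<psi> y w) y f) x" if f: "sm f x" for f x
  proof (cases "x \<in> U")
    case True
    have "\<forall>\<^sub>F y in nhds x. \<beta> y * pd U \<psi> w f y = fmul \<beta> (\<lambda>y. rep U \<psi> y w) y f"
      using sm_eventually[OF f] by (rule eventually_mono) (simp add: rep_def)
    then show ?thesis by (rule sm_cong[OF sm_mult[OF assms(4) pd_sm[OF assms(1) True f]]])
  next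
    case False
    then have "x \<in> - K" using assms(3) by auto
    then have "\<forall>\<^sub>F y in nhds x. 0 = fmul \<beta> (\<lambda>y. rep U \<psi> y w) y f"
      using eventually_nhds_in_open[of "- K" x] assms(2,5)
      by (auto elim!: eventually_mono simp: open_Compl)
    then show ?thesis by (rule sm_cong[OF sm_const])
  qed
  ultimately show ?thesis by (simp add: vector_fields_def)
qed

end

subsection \<open>Product manifolds\<close>

lemma smooth_map_at_pullback:
  assumes "mfd A C d" "mfd B C' d'" "smooth_map_at A B F x" "smooth_fun_at B f (F x)"
  shows "smooth_fun_at A (f \<circ> F) x"
proof -
  interpret M: mfd A C d by fact
  interpret N: mfd B C' d' by fact
  obtain U \<psi> V \<theta> W where *: "(U, \<psi>) \<in> A" "(V, \<theta>) \<in> B" "open W" "x \<in> W" "W \<subseteq> U" "F ` W \<subseteq> V"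
    "smooth_on (\<psi> ` W) (\<theta> \<circ> F \<circ> inv_into U \<psi>)"
    using assms(3) unfolding smooth_map_at_def by blast
  let ?F = "\<theta> \<circ> F \<circ> inv_into U \<psi>"
  obtain T where T: "open T" "\<theta> (F x) \<in> T" "T \<subseteq> \<theta> ` V" "smooth_on T (f \<circ> inv_into V \<theta>)"
    using N.smE[OF assms(4) *(2)] *(4,6) by blast
  let ?S = "\<psi> ` W \<inter> ?F -` T"
  have S: "open ?S"
    by (rule continuous_open_preimage[OF smooth_on_continuous_on[OF *(7)] M.open_chart_image[OF *(1,3,5)] T(1)])
  have x: "x \<in> U" using * by blast
  then have xS: "\<psi> x \<in> ?S" using * T(2) M.chart_inv[OF *(1) x] by simp
  have "smooth_on ?S (\<lambda>z. (f \<circ> inv_into V \<theta>) (?F z))"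
    by (rule smooth_on_compose[OF N.coframe S T(1) smooth_on_subset[OF *(7)] T(4)]) auto
  then have "smooth_on ?S (f \<circ> F \<circ> inv_into U \<psi>)"
  proof (rule smooth_on_cong[OF S, rotated])
    fix z assume "z \<in> ?S"
    then obtain y where y: "y \<in> W" "z = \<psi> y" by blast
    then have "inv_into U \<psi> z = y" "F y \<in> V" using M.chart_inv[OF *(1), of y] * by auto
    then show "(f \<circ> inv_into V \<theta>) (?F z) = (f \<circ> F \<circ> inv_into U \<psi>) z"
      using N.chart_inv[OF *(2), of "F y"] by simp
  qed
  then show ?thesis by (rule M.smI[OF *(1) x S xS])
qed

text \<open>In charts the differential is the derivative of the coordinate expression of F, by the
  chain rule.\<close>

lemma differential_tangent:
  assumes "mfd A C d" "mfd B C' d'" "smooth_map_at A B F x" "v \<in> tangent_space A x"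
  shows "differential B F x v \<in> tangent_space B (F x)"
proof -
  interpret M: mfd A C d by fact
  interpret N: mfd B C' d' by fact
  obtain U \<psi> V \<theta> W where *: "(U, \<psi>) \<in> A" "(V, \<theta>) \<in> B" "open W" "x \<in> W" "W \<subseteq> U" "F ` W \<subseteq> V"
    "smooth_on (\<psi> ` W) (\<theta> \<circ> F \<circ> inv_into U \<psi>)"
    using assms(3) unfolding smooth_map_at_def by blast
  let ?F = "\<theta> \<circ> F \<circ> inv_into U \<psi>"
  have x: "x \<in> U" "F x \<in> V" using * by auto
  obtain w where w: "v = M.rep U \<psi> x w" using M.tangent_space_rep[OF assms(4) *(1) x(1)] .
  have F: "(?F has_derivative frechet_derivative ?F (at (\<psi> x))) (at (\<psi> x))"
    by (rule smooth_on_has_derivative[OF *(7)]) (use * in auto)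
  have Fx: "?F (\<psi> x) = \<theta> (F x)" using M.chart_inv[OF *(1) x(1)] by simp
  have "M.pd U \<psi> w (f \<circ> F) x = N.pd V \<theta> (frechet_derivative ?F (at (\<psi> x)) w) f (F x)"
    if f: "smooth_fun_at B f (F x)" for f
  proof (rule M.pdI)
    have "((f \<circ> inv_into V \<theta>) \<circ> ?F has_derivative
        (\<lambda>w. N.pd V \<theta> w f (F x)) \<circ> frechet_derivative ?F (at (\<psi> x))) (at (\<psi> x))"
      using diff_chain_at[OF F] N.pd_has_derivative[OF *(2) x(2) f] Fx by metis
    then have "(f \<circ> F \<circ> inv_into U \<psi> has_derivative
        (\<lambda>w. N.pd V \<theta> w f (F x)) \<circ> frechet_derivative ?F (at (\<psi> x))) (at (\<psi> x))"
    proof (rule has_derivative_transform_within_open[OF _ M.open_chart_image[OF *(1,3,5)]])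
      fix z assume "z \<in> \<psi> ` W"
      then obtain y where y: "y \<in> W" "z = \<psi> y" by blast
      then have "inv_into U \<psi> z = y" "F y \<in> V" using M.chart_inv[OF *(1), of y] * by auto
      then show "((f \<circ> inv_into V \<theta>) \<circ> ?F) z = (f \<circ> F \<circ> inv_into U \<psi>) z"
        using N.chart_inv[OF *(2), of "F y"] by simp
    qed (use * in auto)
    then show "(f \<circ> F \<circ> inv_into U \<psi> has_derivative
        (\<lambda>w. N.pd V \<theta> (frechet_derivative ?F (at (\<psi> x)) w) f (F x))) (at (\<psi> x))"
      by (simp add: o_def)
  qed
  then have "differential B F x v = N.rep V \<theta> (F x) (frechet_derivative ?F (at (\<psi> x)) w)"
    using smooth_map_at_pullback[OF assms(1-3)]
    by (auto simp: differential_def w M.rep_def N.rep_def fun_eq_iff)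
  then show ?thesis using N.rep_in_tangent_space[OF *(2) x(2)] by simp
qed

lemma smooth_on_Pair:
  assumes "open S" "smooth_on S f" "smooth_on S g"
  shows "smooth_on S (\<lambda>x. (f x, g x))"
proof -
  have "bounded_linear (\<lambda>a. (a, 0))" "bounded_linear (\<lambda>b. (0, b))"
    by (auto intro!: bounded_linear_Pair bounded_linear_ident bounded_linear_zero)
  then have "smooth_on S (\<lambda>x. (f x, 0) + (0, g x))"
    by (intro smooth_on_add[OF assms(1)] smooth_on_bounded_linear[OF assms(1,2)]
        smooth_on_bounded_linear[OF assms(1,3)])
  then show ?thesis by simp
qed

text \<open>The two embedded generating sets span the product, so a coframe can be produced afresh
  by \<open>coframe_exists\<close>.\<close>

lemma coframe_prod_exists:
  assumes "coframe (C :: 'a::real_inner set) d" "coframe (C' :: 'b::real_inner set) d'"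
  obtains C'' d'' where "coframe (C'' :: ('a \<times> 'b) set) d''"
proof -
  let ?D = "(\<lambda>c. (c, 0)) ` C \<union> (\<lambda>c. (0, c)) ` C'"
  have "(a, b) \<in> span ?D" for a :: 'a and b :: 'b
  proof -
    have "(\<Sum>c\<in>C. (a \<bullet> d c) *\<^sub>R (c, 0)) + (\<Sum>c\<in>C'. (b \<bullet> d' c) *\<^sub>R (0, c)) = (a, b)"
      using assms by (simp add: coframe_def prod_eq_iff fst_sum snd_sum)
    moreover    have "(\<Sum>c\<in>C. (a \<bullet> d c) *\<^sub>R (c, 0)) + (\<Sum>c\<in>C'. (b \<bullet> d' c) *\<^sub>R (0, c)) \<in> span ?D"
      by (intro span_add span_sum span_scale span_base) auto
    ultimately show ?thesis by simp
  qed
  then have "span ?D = UNIV" by auto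
  moreover have "finite ?D" using assms by (simp add: coframe_def)
  ultimately show ?thesis using coframe_exists that by blast
qed

lemma prod_chart_inv:
  assumes "inj_on \<psi> U" "inj_on \<theta> V" "a \<in> \<psi> ` U" "b \<in> \<theta> ` V"
  shows "inv_into (U \<times> V) (map_prod \<psi> \<theta>) (a, b) = (inv_into U \<psi> a, inv_into V \<theta> b)"
  by (rule inv_into_f_eq) (use assms in \<open>auto simp: map_prod_inj_on inv_into_into f_inv_into_f\<close>)

lemma mfd_prod:
  assumes "mfd A C d" "mfd B C' d'"
  obtains C'' d'' where "mfd (prod_atlas A B) C'' d''"
proof -
  interpret M: mfd A C d by fact
  interpret N: mfd B C' d' by fact
  obtain C'' d'' where c: "coframe (C'' :: ('b \<times> 'd) set) d''"
    using coframe_prod_exists[OF M.coframe N.coframe] .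
  have inj: "inj_on \<psi> U" if "(U, \<psi>) \<in> A" for U \<psi> using M.chart_inv[OF that] by (rule inj_on_inverseI)
  have inj': "inj_on \<theta> V" if "(V, \<theta>) \<in> B" for V \<theta> using N.chart_inv[OF that] by (rule inj_on_inverseI)
  have "mfd (prod_atlas A B) C'' d''"
  proof
    have "\<exists>U \<psi>. (U, \<psi>) \<in> A \<and> x \<in> U" "\<exists>V \<theta>. (V, \<theta>) \<in> B \<and> y \<in> V" for x y
      using M.chart_at N.chart_at by metis+
    then show "(\<Union>(W, \<kappa>)\<in>prod_atlas A B. W) = UNIV" unfolding prod_atlas_def by fast
  next
    fix W \<kappa> assume "(W, \<kappa>) \<in> prod_atlas A B"
    then obtain U \<psi> V \<theta> where *: "(U, \<psi>) \<in> A" "(V, \<theta>) \<in> B" "W = U \<times> V" "\<kappa> = map_prod \<psi> \<theta>"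
      unfolding prod_atlas_def by blast
    note MU = M.chart[OF *(1)] and NV = N.chart[OF *(2)]
    have im: "\<kappa> ` W = \<psi> ` U \<times> \<theta> ` V" using * by (auto simp: map_prod_def)
    have c: "continuous_on U \<psi>" "continuous_on (\<psi> ` U) (inv_into U \<psi>)"
      "continuous_on V \<theta>" "continuous_on (\<theta> ` V) (inv_into V \<theta>)"
      using MU NV by (auto simp: homeomorphism_def)
    note fs = continuous_on_fst[OF continuous_on_id] continuous_on_snd[OF continuous_on_id]
    have "continuous_on W (\<lambda>z. (\<psi> (fst z), \<theta> (snd z)))"
      by (rule continuous_on_Pair[OF continuous_on_compose2[OF c(1) fs(1)] continuous_on_compose2[OF c(3) fs(2)]])
         (auto simp: *)
    then have 1: "continuous_on W \<kappa>" by (simp add: * map_prod_def case_prod_beta)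
    have "continuous_on (\<psi> ` U \<times> \<theta> ` V) (\<lambda>z. (inv_into U \<psi> (fst z), inv_into V \<theta> (snd z)))"
      by (rule continuous_on_Pair[OF continuous_on_compose2[OF c(2) fs(1)] continuous_on_compose2[OF c(4) fs(2)]])
         auto
    then have 2: "continuous_on (\<kappa> ` W) (inv_into W \<kappa>)"
      unfolding im by (rule continuous_on_eq) (auto simp: * prod_chart_inv[OF inj[OF *(1)] inj'[OF *(2)]])
    have i: "inj_on \<kappa> W" using * inj inj' by (simp add: map_prod_inj_on)
    have "homeomorphism W (\<kappa> ` W) \<kappa> (inv_into W \<kappa>)"
      unfolding homeomorphism_def using 1 2 i by (auto simp: f_inv_into_f inv_into_into image_iff)
    then show "open W \<and> open (\<kappa> ` W) \<and> homeomorphism W (\<kappa> ` W) \<kappa> (inv_into W \<kappa>)"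
      using MU NV im * by (simp add: open_Times)
  next
    fix W \<kappa> W' \<kappa>' assume "(W, \<kappa>) \<in> prod_atlas A B" "(W', \<kappa>') \<in> prod_atlas A B"
    then obtain U \<psi> V \<theta> U' \<psi>' V' \<theta>' where *: "(U, \<psi>) \<in> A" "(V, \<theta>) \<in> B" "W = U \<times> V" "\<kappa> = map_prod \<psi> \<theta>"
      and **: "(U', \<psi>') \<in> A" "(V', \<theta>') \<in> B" "W' = U' \<times> V'" "\<kappa>' = map_prod \<psi>' \<theta>'"
      unfolding prod_atlas_def by blast
    let ?S = "\<psi> ` (U \<inter> U')" and ?T = "\<theta> ` (V \<inter> V')"
    have o: "open ?S" "open ?T"
      using M.open_chart_image[OF *(1), of "U \<inter> U'"] N.open_chart_image[OF *(2), of "V \<inter> V'"]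
        M.chart[OF *(1)] M.chart[OF **(1)] N.chart[OF *(2)] N.chart[OF **(2)] by auto
    have ST: "open (?S \<times> ?T)" using o by (simp add: open_Times)
    have im: "\<kappa> ` (W \<inter> W') = ?S \<times> ?T" using * ** by (auto simp: map_prod_def)
    have f: "smooth_on (?S \<times> ?T) fst" "smooth_on (?S \<times> ?T) snd"
      using smooth_on_bounded_linear[OF ST smooth_on_ident[OF ST] bounded_linear_fst]
        smooth_on_bounded_linear[OF ST smooth_on_ident[OF ST] bounded_linear_snd] by simp_all
    have "smooth_on (?S \<times> ?T) (\<lambda>z. (\<psi>' \<circ> inv_into U \<psi>) (fst z))"
      by (rule smooth_on_compose[OF M.coframe ST o(1) f(1) M.transition[OF *(1) **(1)]]) auto
    moreover have "smooth_on (?S \<times> ?T) (\<lambda>z. (\<theta>' \<circ> inv_into V \<theta>) (snd z))"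
      by (rule smooth_on_compose[OF N.coframe ST o(2) f(2) N.transition[OF *(2) **(2)]]) auto
    ultimately have "smooth_on (?S \<times> ?T)
        (\<lambda>z. ((\<psi>' \<circ> inv_into U \<psi>) (fst z), (\<theta>' \<circ> inv_into V \<theta>) (snd z)))"
      by (rule smooth_on_Pair[OF ST])
    then show "smooth_on (\<kappa> ` (W \<inter> W')) (\<kappa>' \<circ> inv_into W \<kappa>)"
      unfolding im
      by (rule smooth_on_cong[OF ST, rotated])
         (auto simp: * ** prod_chart_inv[OF inj[OF *(1)] inj'[OF *(2)]])
  qed (rule c)
  then show ?thesis by (rule that)
qed

text \<open>The coframe of the product model is a parameter of its own, because its construction
  yields one that need not be related to those of the factors.\<close>

locale prod_mfd = M: mfd A C d + N: mfd B C' d' + P: mfd "prod_atlas A B" C'' d''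
  for A :: "('m::topological_space, 'e::real_inner) atlas" and C d
    and B :: "('n::topological_space, 'f::real_inner) atlas" and C' d' C'' d''
begin

abbreviation "AB \<equiv> prod_atlas A B"

lemma chart_prod:
  assumes "(U, \<psi>) \<in> A" "(V, \<theta>) \<in> B"
  shows "(U \<times> V, map_prod \<psi> \<theta>) \<in> AB"
  using assms by (auto simp: prod_atlas_def)

lemma chart_prod_inv:
  assumes "(U, \<psi>) \<in> A" "(V, \<theta>) \<in> B" "a \<in> \<psi> ` U" "b \<in> \<theta> ` V"
  shows "inv_into (U \<times> V) (map_prod \<psi> \<theta>) (a, b) = (inv_into U \<psi> a, inv_into V \<theta> b)"
proof -
  have "inj_on \<psi> U" using M.chart_inv[OF assms(1)] by (rule inj_on_inverseI)
  moreover have "inj_on \<theta> V" using N.chart_inv[OF assms(2)] by (rule inj_on_inverseI)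
  ultimately show ?thesis using assms(3,4) by (rule prod_chart_inv)
qed

lemma smooth_map_at_fst: "smooth_map_at AB A fst q"
proof -
  obtain U \<psi> where c: "(U, \<psi>) \<in> A" "fst q \<in> U" using M.chart_at .
  obtain V \<theta> where c': "(V, \<theta>) \<in> B" "snd q \<in> V" using N.chart_at .
  let ?S = "\<psi> ` U \<times> \<theta> ` V"
  have S: "open ?S" using M.chart[OF c(1)] N.chart[OF c'(1)] by (simp add: open_Times)
  have "smooth_on ?S fst"
    using smooth_on_bounded_linear[OF S smooth_on_ident[OF S] bounded_linear_fst] by simp
  then have "smooth_on ?S (\<psi> \<circ> fst \<circ> inv_into (U \<times> V) (map_prod \<psi> \<theta>))"
    by (rule smooth_on_cong[OF S, rotated])
       (auto simp: chart_prod_inv[OF c(1) c'(1)] M.chart_inv[OF c(1)])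
  moreover have "map_prod \<psi> \<theta> ` (U \<times> V) = ?S" by (auto simp: map_prod_def)
  ultimately have "open (U \<times> V) \<and> q \<in> U \<times> V \<and> U \<times> V \<subseteq> U \<times> V \<and> fst ` (U \<times> V) \<subseteq> U \<and>
      smooth_on (map_prod \<psi> \<theta> ` (U \<times> V)) (\<psi> \<circ> fst \<circ> inv_into (U \<times> V) (map_prod \<psi> \<theta>))"
    using M.chart[OF c(1)] N.chart[OF c'(1)] c c' by (auto simp: open_Times mem_Times_iff)
  then show ?thesis unfolding smooth_map_at_def using chart_prod[OF c(1) c'(1)] c(1) by blast
qed

lemma smooth_map_at_snd: "smooth_map_at AB B snd q"
proof -
  obtain U \<psi> where c: "(U, \<psi>) \<in> A" "fst q \<in> U" using M.chart_at .
  obtain V \<theta> where c': "(V, \<theta>) \<in> B" "snd q \<in> V" using N.chart_at .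
  let ?S = "\<psi> ` U \<times> \<theta> ` V"
  have S: "open ?S" using M.chart[OF c(1)] N.chart[OF c'(1)] by (simp add: open_Times)
  have "smooth_on ?S snd"
    using smooth_on_bounded_linear[OF S smooth_on_ident[OF S] bounded_linear_snd] by simp
  then have "smooth_on ?S (\<theta> \<circ> snd \<circ> inv_into (U \<times> V) (map_prod \<psi> \<theta>))"
    by (rule smooth_on_cong[OF S, rotated])
       (auto simp: chart_prod_inv[OF c(1) c'(1)] N.chart_inv[OF c'(1)])
  moreover have "map_prod \<psi> \<theta> ` (U \<times> V) = ?S" by (auto simp: map_prod_def)
  ultimately have "open (U \<times> V) \<and> q \<in> U \<times> V \<and> U \<times> V \<subseteq> U \<times> V \<and> snd ` (U \<times> V) \<subseteq> V \<and>
      smooth_on (map_prod \<psi> \<theta> ` (U \<times> V)) (\<theta> \<circ> snd \<circ> inv_into (U \<times> V) (map_prod \<psi> \<theta>))"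
    using M.chart[OF c(1)] N.chart[OF c'(1)] c c' by (auto simp: open_Times mem_Times_iff)
  then show ?thesis unfolding smooth_map_at_def using chart_prod[OF c(1) c'(1)] c'(1) by blast
qed

lemma smooth_map_at_inclusion_left: "smooth_map_at A AB (\<lambda>y. (y, g)) x"
proof -
  obtain U \<psi> where c: "(U, \<psi>) \<in> A" "x \<in> U" using M.chart_at .
  obtain V \<theta> where c': "(V, \<theta>) \<in> B" "g \<in> V" using N.chart_at .
  have S: "open (\<psi> ` U)" using M.chart[OF c(1)] by simp
  have "smooth_on (\<psi> ` U) (\<lambda>z. (z, \<theta> g))"
    by (intro smooth_on_Pair smooth_on_ident smooth_on_const S)
  then have "smooth_on (\<psi> ` U) (map_prod \<psi> \<theta> \<circ> (\<lambda>y. (y, g)) \<circ> inv_into U \<psi>)"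
    by (rule smooth_on_cong[OF S, rotated]) (auto simp: M.chart_inv[OF c(1)])
  then have "open U \<and> x \<in> U \<and> U \<subseteq> U \<and> (\<lambda>y. (y, g)) ` U \<subseteq> U \<times> V \<and>
      smooth_on (\<psi> ` U) (map_prod \<psi> \<theta> \<circ> (\<lambda>y. (y, g)) \<circ> inv_into U \<psi>)"
    using M.chart[OF c(1)] c c' by auto
  then show ?thesis unfolding smooth_map_at_def using chart_prod[OF c(1) c'(1)] c(1) by blast
qed

lemma smooth_map_at_inclusion_right: "smooth_map_at B AB (\<lambda>h. (x, h)) g"
proof -
  obtain U \<psi> where c: "(U, \<psi>) \<in> A" "x \<in> U" using M.chart_at .
  obtain V \<theta> where c': "(V, \<theta>) \<in> B" "g \<in> V" using N.chart_at .
  have S: "open (\<theta> ` V)" using N.chart[OF c'(1)] by simp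
  have "smooth_on (\<theta> ` V) (\<lambda>z. (\<psi> x, z))"
    by (intro smooth_on_Pair smooth_on_ident smooth_on_const S)
  then have "smooth_on (\<theta> ` V) (map_prod \<psi> \<theta> \<circ> (\<lambda>h. (x, h)) \<circ> inv_into V \<theta>)"
    by (rule smooth_on_cong[OF S, rotated]) (auto simp: N.chart_inv[OF c'(1)])
  then have "open V \<and> g \<in> V \<and> V \<subseteq> V \<and> (\<lambda>h. (x, h)) ` V \<subseteq> U \<times> V \<and>
      smooth_on (\<theta> ` V) (map_prod \<psi> \<theta> \<circ> (\<lambda>h. (x, h)) \<circ> inv_into V \<theta>)"
    using N.chart[OF c'(1)] c c' by auto
  then show ?thesis unfolding smooth_map_at_def using chart_prod[OF c(1) c'(1)] c'(1) by blast
qed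

section \<open>Vectors and fields tested on functions of one factor\<close>

lemma sm_fst: "M.sm f (fst q) \<Longrightarrow> P.sm (f \<circ> fst) q"
  using smooth_map_at_pullback[OF P.mfd_axioms M.mfd_axioms smooth_map_at_fst] .

lemma sm_snd: "N.sm f (snd q) \<Longrightarrow> P.sm (f \<circ> snd) q"
  using smooth_map_at_pullback[OF P.mfd_axioms N.mfd_axioms smooth_map_at_snd] .

lemma coord_prod: "P.coord (map_prod \<psi> \<theta>) (a, b) = (\<lambda>y. (M.coord \<psi> a \<circ> fst) y + (N.coord \<theta> b \<circ> snd) y)"
  by (auto simp: P.coord_def M.coord_def N.coord_def fun_eq_iff)

text \<open>A linear coordinate of a product chart is the sum of a function of the first point and a
  function of the second (\<open>coord_prod\<close>), so functions pulled back from the factors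
  separate tangent vectors. The criterion for fields below has the same reason.\<close>

lemma prod_tv_ext:
  assumes w: "w \<in> tangent_space AB q" "w' \<in> tangent_space AB q"
    and "\<And>f. M.sm f (fst q) \<Longrightarrow> w (f \<circ> fst) = w' (f \<circ> fst)"
    and "\<And>f. N.sm f (snd q) \<Longrightarrow> w (f \<circ> snd) = w' (f \<circ> snd)"
  shows "w = w'"
proof -
  obtain U \<psi> where c: "(U, \<psi>) \<in> A" "fst q \<in> U" using M.chart_at .
  obtain V \<theta> where c': "(V, \<theta>) \<in> B" "snd q \<in> V" using N.chart_at .
  have m: "M.sm (M.coord \<psi> a) (fst q)" "N.sm (N.coord \<theta> b) (snd q)" for a b
    using M.sm_coord[OF c] N.sm_coord[OF c'] by auto
  show ?thesis
  proof (rule P.tv_ext[OF w chart_prod[OF c(1) c'(1)]])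
    show "q \<in> U \<times> V" using c c' by (simp add: mem_Times_iff)
    fix e
    obtain a b where "d'' e = (a, b)" by (cases "d'' e")
    then show "w (P.coord (map_prod \<psi> \<theta>) (d'' e)) = w' (P.coord (map_prod \<psi> \<theta>) (d'' e))"
      using P.tv_add[OF w(1) sm_fst[OF m(1)] sm_snd[OF m(2)], of a b]
        P.tv_add[OF w(2) sm_fst[OF m(1)] sm_snd[OF m(2)], of a b] assms(3)[OF m(1)] assms(4)[OF m(2)]
      by (simp add: coord_prod)
  qed
qed

lemma prod_vector_fieldsI:
  assumes t: "\<And>q. X q \<in> tangent_space AB q"
    and "\<And>f q. M.sm f (fst q) \<Longrightarrow> P.sm (\<lambda>y. X y (f \<circ> fst)) q"
    and "\<And>f q. N.sm f (snd q) \<Longrightarrow> P.sm (\<lambda>y. X y (f \<circ> snd)) q"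
  shows "X \<in> vector_fields AB"
proof (rule P.vector_fieldsI[OF t])
  fix q :: "'m \<times> 'n"
  obtain U \<psi> where c: "(U, \<psi>) \<in> A" "fst q \<in> U" using M.chart_at .
  obtain V \<theta> where c': "(V, \<theta>) \<in> B" "snd q \<in> V" using N.chart_at .
  have cp: "(U \<times> V, map_prod \<psi> \<theta>) \<in> AB" "q \<in> U \<times> V"
    using chart_prod[OF c(1) c'(1)] c c' by (auto simp: mem_Times_iff)
  have "P.sm (\<lambda>y. X y (P.coord (map_prod \<psi> \<theta>) (d'' e))) q" for e
  proof -
    obtain a b where e: "d'' e = (a, b)" by (cases "d'' e")
    have "P.sm (\<lambda>y. X y (M.coord \<psi> a \<circ> fst) + X y (N.coord \<theta> b \<circ> snd)) q"
      by (rule P.sm_add[OF assms(2)[OF M.sm_coord[OF c]] assms(3)[OF N.sm_coord[OF c']]])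
    moreover have "\<forall>\<^sub>F y in nhds q. X y (M.coord \<psi> a \<circ> fst) + X y (N.coord \<theta> b \<circ> snd)
        = X y (P.coord (map_prod \<psi> \<theta>) (d'' e))"
    proof (rule eventually_mono[OF eventually_nhds_in_open])
      show "open (U \<times> V)" using P.chart[OF cp(1)] by simp
      fix y assume "y \<in> U \<times> V"
      then have "fst y \<in> U" "snd y \<in> V" by auto
      from P.tv_add[OF t sm_fst[OF M.sm_coord[OF c(1) this(1)]] sm_snd[OF N.sm_coord[OF c'(1) this(2)]]]
      show "X y (M.coord \<psi> a \<circ> fst) + X y (N.coord \<theta> b \<circ> snd) = X y (P.coord (map_prod \<psi> \<theta>) (d'' e))"
        unfolding e coord_prod by simp
    qed (rule cp)
    ultimately show ?thesis by (rule P.sm_cong)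
  qed
  then show "\<exists>W \<kappa>. (W, \<kappa>) \<in> AB \<and> q \<in> W \<and> (\<forall>e\<in>C''. P.sm (\<lambda>y. X y (P.coord \<kappa> (d'' e))) q)"
    using cp by blast
qed

text \<open>The vector with components u and v in the splitting of the tangent space. It is written
  with the inclusions that occur in \<open>product_J\<close>, so that J unfolds directly to values
  of \<open>mk\<close>.\<close>

definition mk :: "'m \<Rightarrow> 'n \<Rightarrow> 'm tvec \<Rightarrow> 'n tvec \<Rightarrow> ('m \<times> 'n) tvec"
  where "mk x g u v = differential AB (\<lambda>y. (y, g)) x u + differential AB (\<lambda>h. (x, h)) g v"

lemma mk_tangent:
  assumes "u \<in> tangent_space A x" "v \<in> tangent_space B g"
  shows "mk x g u v \<in> tangent_space AB (x, g)"
  unfolding mk_def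
  by (intro P.tangent_space_add
      differential_tangent[OF M.mfd_axioms P.mfd_axioms smooth_map_at_inclusion_left assms(1)]
      differential_tangent[OF N.mfd_axioms P.mfd_axioms smooth_map_at_inclusion_right assms(2)])

text \<open>The second component differentiates along {x} x G, where f \<circ> fst is
  constant.\<close>

lemma mk_fst:
  assumes "v \<in> tangent_space B g" "M.sm f x"
  shows "mk x g u v (f \<circ> fst) = u f"
proof -
  have "P.sm (f \<circ> fst) (x, g)" using sm_fst[of f "(x, g)"] assms(2) by simp
  then show ?thesis using N.tv_const[OF assms(1)] by (simp add: mk_def differential_def o_def)
qed

lemma mk_snd:
  assumes "u \<in> tangent_space A x" "N.sm f g"
  shows "mk x g u v (f \<circ> snd) = v f"
proof -
  have "P.sm (f \<circ> snd) (x, g)" using sm_snd[of f "(x, g)"] assms(2) by simp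
  then show ?thesis using M.tv_const[OF assms(1)] by (simp add: mk_def differential_def o_def)
qed

lemma differential_fst_mk:
  assumes "u \<in> tangent_space A x" "v \<in> tangent_space B g"
  shows "differential A fst (x, g) (mk x g u v) = u"
  using mk_fst[OF assms(2)] M.tv_nonsmooth[OF assms(1)] by (auto simp: differential_def fun_eq_iff)

lemma differential_snd_mk:
  assumes "u \<in> tangent_space A x" "v \<in> tangent_space B g"
  shows "differential B snd (x, g) (mk x g u v) = v"
  using mk_snd[OF assms(1)] N.tv_nonsmooth[OF assms(2)] by (auto simp: differential_def fun_eq_iff)

lemma mk_differential:
  assumes "w \<in> tangent_space AB (x, g)"
  shows "mk x g (differential A fst (x, g) w) (differential B snd (x, g) w) = w"
    and "differential A fst (x, g) w \<in> tangent_space A x"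
    and "differential B snd (x, g) w \<in> tangent_space B g"
proof -
  show u: "differential A fst (x, g) w \<in> tangent_space A x"
    using differential_tangent[OF P.mfd_axioms M.mfd_axioms smooth_map_at_fst assms] by simp
  show v: "differential B snd (x, g) w \<in> tangent_space B g"
    using differential_tangent[OF P.mfd_axioms N.mfd_axioms smooth_map_at_snd assms] by simp
  show "mk x g (differential A fst (x, g) w) (differential B snd (x, g) w) = w"
    by (rule prod_tv_ext[OF mk_tangent[OF u v] assms])
       (simp_all add: mk_fst[OF v] mk_snd[OF u], simp_all add: differential_def)
qed

lemma differential_add: "differential K F x (v + w) = differential K F x v + differential K F x w"
  by (auto simp: differential_def fun_eq_iff)

lemma differential_scale: "differential K F x (a *\<^sub>R v) = a *\<^sub>R differential K F x v"
  by (auto simp: differential_def fun_eq_iff)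

lemma mk_add: "mk x g (u + u') (v + v') = mk x g u v + mk x g u' v'"
  unfolding mk_def differential_add by (simp only: ac_simps)

lemma mk_scale: "mk x g (a *\<^sub>R u) (a *\<^sub>R v) = a *\<^sub>R mk x g u v"
  unfolding mk_def differential_scale by (simp only: scaleR_add_right)

lemma mk_0: "mk x g 0 0 = 0"
  using mk_scale[of x g 0 0 0] by simp

lemma mk_diff: "mk x g (u - u') (v - v') = mk x g u v - mk x g u' v'"
  using mk_add[of x g "u - u'" u' "v - v'" v'] by simp

lemma mk_minus: "mk x g (- u) (- v) = - mk x g u v"
  using mk_scale[of x g "- 1" u v] by simp

lemma mk_sum: "mk x g (\<Sum>i\<in>I. u i) (\<Sum>i\<in>I. v i) = (\<Sum>i\<in>I. mk x g (u i) (v i))"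
proof (induction I rule: infinite_finite_induct)
  case (infinite I)
  show ?case unfolding sum.infinite[OF infinite] by (rule mk_0)
next
  case empty
  show ?case unfolding sum.empty by (rule mk_0)
next
  case (insert i I)
  show ?case unfolding sum.insert[OF insert.hyps] mk_add insert.IH ..
qed

end

subsection \<open>f.pk-structures\<close>

lemma is_basis_coefficients:
  assumes "is_basis p V b" "v \<in> V"
  obtains a where "v = (\<Sum>i<p. a i *\<^sub>R b i)"
proof -
  have "v \<in> span (b ` {..<p})" using assms by (simp add: is_basis_def)
  then obtain u where "v = (\<Sum>w\<in>b ` {..<p}. u w *\<^sub>R w)" by (auto simp: span_finite)
  also have "\<dots> = (\<Sum>i<p. u (b i) *\<^sub>R b i)"
    using assms(1) by (simp add: is_basis_def sum.reindex)
  finally show ?thesis by (rule that)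
qed

lemma is_basis_independent:
  assumes "is_basis p V b" "(\<Sum>i<p. a i *\<^sub>R b i) = 0" "i < p"
  shows "a i = 0"
proof -
  have inj: "inj_on b {..<p}" and ind: "independent (b ` {..<p})" using assms(1) by (auto simp: is_basis_def)
  define u where "u = (\<lambda>w. a (inv_into {..<p} b w))"
  have "(\<Sum>w\<in>b ` {..<p}. u w *\<^sub>R w) = (\<Sum>i<p. a i *\<^sub>R b i)"
    by (simp add: sum.reindex[OF inj] u_def inv_into_f_f[OF inj])
  then have "(\<Sum>w\<in>b ` {..<p}. u w *\<^sub>R w) = 0" using assms(2) by (rule trans)
  then have "u (b i) = 0"
    using independentD[OF ind, of "b ` {..<p}" u "b i"] assms(3) by simp
  then show ?thesis using assms(3) by (simp add: u_def inv_into_f_f[OF inj])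
qed

lemma is_basis_unique:
  assumes "is_basis p V b" "(\<Sum>i<p. a i *\<^sub>R b i) = (\<Sum>i<p. a' i *\<^sub>R b i)" "i < p"
  shows "a i = a' i"
proof -
  have "(\<Sum>i<p. (a i - a' i) *\<^sub>R b i) = 0"
    using assms(2) by (simp only: scaleR_left_diff_distrib sum_subtractf right_minus_eq)
  from is_basis_independent[OF assms(1) this assms(3)] show ?thesis by simp
qed

lemma is_basis_in: "is_basis p V b \<Longrightarrow> i < p \<Longrightarrow> b i \<in> V"
  using span_base[of "b i" "b ` {..<p}"] by (simp add: is_basis_def)

locale fpk = mfd A C d for A :: "('m::topological_space, 'e::real_inner) atlas" and C d +
  fixes p :: nat and \<phi> :: "'m \<Rightarrow> 'm tvec \<Rightarrow> 'm tvec" and xs :: "nat \<Rightarrow> 'm vfield"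
  assumes fpk: "fpk_structure A p \<phi> xs"
begin

abbreviation "V \<equiv> vector_fields A"
abbreviation "T \<equiv> tangent_space A"
abbreviation "\<eta> \<equiv> eta A p \<phi> xs"

lemma phi_tensor: "tensor11 A \<phi>"
  using fpk by (simp add: fpk_structure_def f_structure_def)

lemma phi_cube: "v \<in> T x \<Longrightarrow> \<phi> x (\<phi> x (\<phi> x v)) = - \<phi> x v"
  using fpk by (simp add: fpk_structure_def f_structure_def eq_neg_iff_add_eq_0)

lemma xs_vf: "i < p \<Longrightarrow> xs i \<in> V"
  using fpk by (simp add: fpk_structure_def)

lemma xs_basis: "is_basis p {v \<in> T x. \<phi> x v = 0} (\<lambda>i. xs i x)"
  using fpk by (simp add: fpk_structure_def)

lemma phi_xs: "i < p \<Longrightarrow> \<phi> x (xs i x) = 0"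
  using is_basis_in[OF xs_basis] by blast

lemmas phi_tangent = tensor11_tangent[OF phi_tensor]
  and phi_add = tensor11_add[OF phi_tensor]
  and phi_scale = tensor11_scale[OF phi_tensor]
  and phi_diff = tensor11_diff[OF phi_tensor]
  and phi_0 = tensor11_0[OF phi_tensor]
  and phi_sum = tensor11_sum[OF phi_tensor]
  and phi_vf = tensor11_vf[OF phi_tensor]

lemma phi_sum_xs: "\<phi> x (\<Sum>i<p. a i *\<^sub>R xs i x) = 0"
proof -
  have "\<phi> x (\<Sum>i<p. a i *\<^sub>R xs i x) = (\<Sum>i<p. \<phi> x (a i *\<^sub>R xs i x))"
    by (rule phi_sum) (simp add: tangent_space_scale vf_tangent xs_vf)
  also have "\<dots> = 0"
  proof (rule sum.neutral, rule ballI)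
    fix i assume "i \<in> {..<p}"
    then have i: "i < p" by simp
    show "\<phi> x (a i *\<^sub>R xs i x) = 0"
      unfolding phi_scale[OF vf_tangent[OF xs_vf[OF i]]] phi_xs[OF i] by (rule scaleR_zero_right)
  qed
  finally show ?thesis .
qed

lemma sum_xs_tangent: "(\<Sum>i<p. a i *\<^sub>R xs i x) \<in> T x"
  by (rule tangent_space_sum) (simp add: tangent_space_scale vf_tangent xs_vf)

text \<open>The condition in the definite description of \<open>eta\<close>, kept as a predicate in
  order to prove existence and uniqueness.\<close>

definition is_eta :: "nat \<Rightarrow> 'm \<Rightarrow> ('m tvec \<Rightarrow> real) \<Rightarrow> bool"
  where "is_eta i x h \<longleftrightarrow>
    (\<forall>v\<in>T x. \<forall>w\<in>T x. h (v + w) = h v + h w) \<and>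
    (\<forall>c. \<forall>v\<in>T x. h (c *\<^sub>R v) = c * h v) \<and>
    (\<forall>v. v \<notin> T x \<longrightarrow> h v = 0) \<and>
    (\<forall>j<p. h (xs j x) = (if i = j then 1 else 0)) \<and>
    (\<forall>v\<in>T x. h (\<phi> x v) = 0)"

text \<open>The vector v + \<phi>^2 v is the component of v in the kernel of \<phi>. Since h
  vanishes on the image of \<phi>, its value on v is read off from that component; this gives
  uniqueness.\<close>

lemma is_eta_coefficient:
  assumes "is_eta i x h" "v \<in> T x" "v + \<phi> x (\<phi> x v) = (\<Sum>j<p. a j *\<^sub>R xs j x)" "i < p"
  shows "h v = a i"
proof -
  have add: "h (v + w) = h v + h w" if "v \<in> T x" "w \<in> T x" for v w
    using assms(1) that unfolding is_eta_def by blast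
  have scale: "h (c *\<^sub>R v) = c * h v" if "v \<in> T x" for c v
    using assms(1) that unfolding is_eta_def by blast
  have h0: "h 0 = 0" using scale[OF tangent_space_0, of 0] by simp
  have "h (\<Sum>j\<in>I. a j *\<^sub>R xs j x) = (\<Sum>j\<in>I. a j * h (xs j x))" if "finite I" "I \<subseteq> {..<p}" for I
    using that
  proof (induction I)
    case (insert j I)
    then have j: "j < p" and I: "I \<subseteq> {..<p}" by auto
    have "h (a j *\<^sub>R xs j x + (\<Sum>j\<in>I. a j *\<^sub>R xs j x)) = h (a j *\<^sub>R xs j x) + h (\<Sum>j\<in>I. a j *\<^sub>R xs j x)"
    proof (rule add)
      show "a j *\<^sub>R xs j x \<in> T x" by (rule tangent_space_scale[OF vf_tangent[OF xs_vf[OF j]]])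
      show "(\<Sum>j\<in>I. a j *\<^sub>R xs j x) \<in> T x"
        by (rule tangent_space_sum[OF tangent_space_scale[OF vf_tangent[OF xs_vf]]]) (use I in auto)
    qed
    then show ?case
      unfolding sum.insert[OF insert.hyps] insert.IH[OF I] scale[OF vf_tangent[OF xs_vf[OF j]]] .
  qed (simp only: sum.empty h0)
  from this[of "{..<p}"] have "h (\<Sum>j<p. a j *\<^sub>R xs j x) = (\<Sum>j<p. a j * h (xs j x))" by simp
  also have "\<dots> = (\<Sum>j<p. if i = j then a j else 0)"
    using assms(1) by (intro sum.cong refl) (auto simp: is_eta_def)
  also have "\<dots> = a i" using assms(4) by simp
  finally have "h (v + \<phi> x (\<phi> x v)) = a i" unfolding assms(3) .
  moreover have "h (\<phi> x (\<phi> x v)) = 0"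
    using assms(1) phi_tangent[OF assms(2)] unfolding is_eta_def by blast
  ultimately show ?thesis using add[OF assms(2) phi_tangent[OF phi_tangent[OF assms(2)]]] by simp
qed

text \<open>\<phi>^3 + \<phi> = 0 says that v + \<phi>^2 v lies in the kernel of \<phi>, where the
  frame is a basis.\<close>

lemma ker_coefficients:
  assumes "v \<in> T x"
  obtains a where "v + \<phi> x (\<phi> x v) = (\<Sum>j<p. a j *\<^sub>R xs j x)"
proof (rule is_basis_coefficients[OF xs_basis])
  note t = phi_tangent[OF assms] phi_tangent[OF phi_tangent[OF assms]]
  have "\<phi> x (v + \<phi> x (\<phi> x v)) = 0"
    unfolding phi_add[OF assms t(2)] phi_cube[OF assms] by (rule right_minus)
  then show "v + \<phi> x (\<phi> x v) \<in> {v \<in> T x. \<phi> x v = 0}"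
    using tangent_space_add[OF assms t(2)] by blast
qed (rule that)

lemma is_eta_eta:
  assumes i: "i < p"
  shows "is_eta i x (\<eta> i x)"
proof -
  have "\<forall>v. \<exists>a. v \<in> T x \<longrightarrow> v + \<phi> x (\<phi> x v) = (\<Sum>j<p. a j *\<^sub>R xs j x)"
    using ker_coefficients by blast
  then obtain k where k: "\<And>v. v \<in> T x \<Longrightarrow> v + \<phi> x (\<phi> x v) = (\<Sum>j<p. k v j *\<^sub>R xs j x)" by metis
  have k_eq: "k v i = a i" if "v \<in> T x" "v + \<phi> x (\<phi> x v) = (\<Sum>j<p. a j *\<^sub>R xs j x)" for v a
    by (rule is_basis_unique[OF xs_basis _ i, of _ x], unfold k[OF that(1), symmetric]) (rule that(2))
  \<comment> \<open>The value 0 off the tangent space is prescribed by the description, and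
    uniqueness of the functional depends on it.\<close>
  define h where "h = (\<lambda>v. if v \<in> T x then k v i else 0)"
  have "is_eta i x h"
    unfolding is_eta_def
  proof (intro conjI ballI allI impI)
    fix v w assume v: "v \<in> T x" and w: "w \<in> T x"
    note t = phi_tangent[OF v] phi_tangent[OF w]
    have "(v + w) + \<phi> x (\<phi> x (v + w)) = (v + \<phi> x (\<phi> x v)) + (w + \<phi> x (\<phi> x w))"
      unfolding phi_add[OF v w] phi_add[OF t] by (simp only: ac_simps)
    also have "\<dots> = (\<Sum>j<p. (k v j + k w j) *\<^sub>R xs j x)"
      unfolding k[OF v] k[OF w] by (simp only: scaleR_add_left sum.distrib)
    finally show "h (v + w) = h v + h w"
      using k_eq[OF tangent_space_add[OF v w], of "\<lambda>j. k v j + k w j"] tangent_space_add[OF v w] v w by (simp add: h_def)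
  next
    fix c v assume v: "v \<in> T x"
    have "c *\<^sub>R v + \<phi> x (\<phi> x (c *\<^sub>R v)) = c *\<^sub>R (v + \<phi> x (\<phi> x v))"
      unfolding phi_scale[OF v] phi_scale[OF phi_tangent[OF v]] by (simp only: scaleR_add_right)
    also have "\<dots> = (\<Sum>j<p. (c * k v j) *\<^sub>R xs j x)"
      unfolding k[OF v] by (simp only: scaleR_sum_right scaleR_scaleR)
    finally show "h (c *\<^sub>R v) = c * h v"
      using k_eq[OF tangent_space_scale[OF v], of c "\<lambda>j. c * k v j"] tangent_space_scale[OF v] v by (simp add: h_def)
  next
    fix v assume "v \<notin> T x" then show "h v = 0" by (simp add: h_def)
  next
    fix j assume j: "j < p"
    note t = vf_tangent[OF xs_vf[OF j], of x]
    have "xs j x + \<phi> x (\<phi> x (xs j x)) = xs j x" unfolding phi_xs[OF j] phi_0 by (rule add_0_right)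
    also have "\<dots> = (\<Sum>l<p. (if l = j then 1 else 0) *\<^sub>R xs l x)"
    proof -
      have "(\<Sum>l<p. (if l = j then 1 else 0) *\<^sub>R xs l x) = (\<Sum>l<p. if l = j then xs l x else 0)"
        by (rule sum.cong[OF refl]) (simp only: if_distrib[of "\<lambda>a. a *\<^sub>R _"] scaleR_one scaleR_zero_left)
      then show ?thesis using j by (simp only: sum.delta finite_lessThan lessThan_iff if_True)
    qed
    finally have "k (xs j x) i = (if i = j then 1 else 0)" by (rule k_eq[OF t])
    then show "h (xs j x) = (if i = j then 1 else 0)" using t by (simp add: h_def)
  next
    fix v assume v: "v \<in> T x"
    have "\<phi> x v + \<phi> x (\<phi> x (\<phi> x v)) = 0" unfolding phi_cube[OF v] by (rule right_minus)
    also have "\<dots> = (\<Sum>l<p. 0 *\<^sub>R xs l x)" by (simp only: scaleR_zero_left sum.neutral_const)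
    finally have "k (\<phi> x v) i = 0" by (rule k_eq[OF phi_tangent[OF v]])
    then show "h (\<phi> x v) = 0" by (simp add: h_def)
  qed
  moreover have "h' = h" if "is_eta i x h'" for h'
  proof
    fix v show "h' v = h v"
    proof (cases "v \<in> T x")
      case True
      then show ?thesis using is_eta_coefficient[OF that True k[OF True] i] by (simp add: h_def)
    next
      case False
      then show ?thesis using that by (simp add: is_eta_def h_def)
    qed
  qed
  ultimately have "is_eta i x (THE h. is_eta i x h)" by (rule theI)
  then show ?thesis unfolding eta_def is_eta_def .
qed

text \<open>The identity \<phi>^2 = -I + \<eta>*, evaluated at v.\<close>

lemma eta_decomposition:
  assumes "v \<in> T x"
  shows "v + \<phi> x (\<phi> x v) = (\<Sum>j<p. \<eta> j x v *\<^sub>R xs j x)"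
proof -
  obtain a where a: "v + \<phi> x (\<phi> x v) = (\<Sum>j<p. a j *\<^sub>R xs j x)" using ker_coefficients[OF assms] .
  have "\<eta> j x v = a j" if "j < p" for j by (rule is_eta_coefficient[OF is_eta_eta[OF that] assms a that])
  then have "(\<Sum>j<p. \<eta> j x v *\<^sub>R xs j x) = (\<Sum>j<p. a j *\<^sub>R xs j x)"
    by (intro sum.cong refl) (simp only: lessThan_iff)
  then show ?thesis using a by simp
qed

lemma eta_add: "i < p \<Longrightarrow> v \<in> T x \<Longrightarrow> w \<in> T x \<Longrightarrow> \<eta> i x (v + w) = \<eta> i x v + \<eta> i x w"
  using is_eta_eta[of i x] unfolding is_eta_def by blast

lemma eta_scale: "i < p \<Longrightarrow> v \<in> T x \<Longrightarrow> \<eta> i x (c *\<^sub>R v) = c * \<eta> i x v"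
  using is_eta_eta[of i x] unfolding is_eta_def by blast

lemma eta_xs: "i < p \<Longrightarrow> j < p \<Longrightarrow> \<eta> i x (xs j x) = (if i = j then 1 else 0)"
  using is_eta_eta[of i x] unfolding is_eta_def by blast

lemma eta_phi: "i < p \<Longrightarrow> v \<in> T x \<Longrightarrow> \<eta> i x (\<phi> x v) = 0"
  using is_eta_eta[of i x] unfolding is_eta_def by blast

lemma eta_0: "i < p \<Longrightarrow> \<eta> i x 0 = 0"
  using eta_scale[OF _ tangent_space_0, of i x 0] by simp

lemma eta_minus: "i < p \<Longrightarrow> v \<in> T x \<Longrightarrow> \<eta> i x (- v) = - \<eta> i x v"
  using eta_scale[of i v x "- 1"] by simp

lemma eta_diff: "i < p \<Longrightarrow> v \<in> T x \<Longrightarrow> w \<in> T x \<Longrightarrow> \<eta> i x (v - w) = \<eta> i x v - \<eta> i x w"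
  using eta_add[OF _ _ tangent_space_neg, of i v x w] eta_minus[of i w x] by simp

lemma eta_sum_xs:
  assumes "i < p"
  shows "\<eta> i x (\<Sum>j<p. a j *\<^sub>R xs j x) = a i"
proof (rule is_eta_coefficient[OF is_eta_eta[OF assms] sum_xs_tangent _ assms])
  show "(\<Sum>j<p. a j *\<^sub>R xs j x) + \<phi> x (\<phi> x (\<Sum>j<p. a j *\<^sub>R xs j x)) = (\<Sum>j<p. a j *\<^sub>R xs j x)"
    unfolding phi_sum_xs phi_0 by (rule add_0_right)
qed

text \<open>A pointwise description says nothing about smoothness. But the numbers \<eta>_j(X) are
  the coefficients of the smooth field X + \<phi>^2 X in a smooth frame, one linear equation for
  each coordinate function, and elimination keeps them smooth.\<close>

lemma sm_eta:
  assumes i: "i < p" and X: "X \<in> V"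
  shows "sm (\<lambda>y. \<eta> i y (X y)) x"
proof -
  obtain U \<psi> where c: "(U, \<psi>) \<in> A" "x \<in> U" using chart_at .
  let ?w = "\<lambda>c. coord \<psi> (d c)"
  let ?Z = "X + app_field \<phi> (app_field \<phi> X)"
  have Z: "?Z \<in> V" by (rule vf_add[OF X phi_vf[OF phi_vf[OF X]]])
  have Z_eq: "?Z y = (\<Sum>j<p. \<eta> j y (X y) *\<^sub>R xs j y)" for y
    using eta_decomposition[OF vf_tangent[OF X, of y]] by (simp add: app_field_apply)
  show ?thesis
  proof (rule sm_coefficients[where I = C and Z = "\<lambda>c y. ?Z y (?w c)" and v = "\<lambda>j c y. xs j y (?w c)"
        and k = "\<lambda>j y. \<eta> j y (X y)", OF _ _ _ _ i])
    show "sm (\<lambda>y. xs j y (?w c)) x" if "j < p" for j c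
      by (rule vf_sm[OF xs_vf[OF that] sm_coord[OF c]])
    show "sm (\<lambda>y. ?Z y (?w c)) x" for c by (rule vf_sm[OF Z sm_coord[OF c]])
    show "\<forall>j<p. a j = 0" if "\<And>c. c \<in> C \<Longrightarrow> (\<Sum>j<p. a j * xs j x (?w c)) = 0" for a
    proof -
      have "(\<Sum>j<p. a j *\<^sub>R xs j x) = 0"
        by (rule tv_ext[OF sum_xs_tangent tangent_space_0 c]) (simp add: sum_fun_apply that)
      then show ?thesis using is_basis_independent[OF xs_basis] by blast
    qed
    show "\<forall>\<^sub>F y in nhds x. ?Z y (?w c) = (\<Sum>j<p. \<eta> j y (X y) * xs j y (?w c))" for c
      unfolding Z_eq by (simp add: sum_fun_apply)
  qed
qed

section \<open>Exterior derivatives of the forms \<eta>_i\<close>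

lemma d_form_add_left:
  assumes i: "i < p" and X: "X \<in> V" and X': "X' \<in> V" and Y: "Y \<in> V"
  shows "d_form A (\<eta> i) (X + X') Y x = d_form A (\<eta> i) X Y x + d_form A (\<eta> i) X' Y x"
proof -
  have "\<eta> i y ((X + X') y) = \<eta> i y (X y) + \<eta> i y (X' y)" for y
    unfolding plus_fun_apply[of X X' y] by (rule eta_add[OF i vf_tangent[OF X] vf_tangent[OF X']])
  moreover have "\<eta> i x (lie_bracket A (X + X') Y x) = \<eta> i x (lie_bracket A X Y x) + \<eta> i x (lie_bracket A X' Y x)"
    unfolding lie_bracket_add_left[OF X X' Y]
    by (subst plus_fun_apply) (rule eta_add[OF i lie_bracket_tangent[OF X Y] lie_bracket_tangent[OF X' Y]])
  ultimately show ?thesis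
    using tv_add[OF vf_tangent[OF Y] sm_eta[OF i X] sm_eta[OF i X']] by (simp add: d_form_def)
qed

lemma d_form_fmul_left:
  assumes i: "i < p" and X: "X \<in> V" and Y: "Y \<in> V" and h: "\<And>x. sm h x"
  shows "d_form A (\<eta> i) (fmul h X) Y x = h x * d_form A (\<eta> i) X Y x"
proof -
  have "\<eta> i y (fmul h X y) = h y * \<eta> i y (X y)" for y
    by (simp only: fmul_apply eta_scale[OF i vf_tangent[OF X]])
  moreover have "\<eta> i x (lie_bracket A (fmul h X) Y x) = h x * \<eta> i x (lie_bracket A X Y x) - Y x h * \<eta> i x (X x)"
    unfolding lie_bracket_fmul_left[OF X Y h]
      eta_diff[OF i tangent_space_scale[OF lie_bracket_tangent[OF X Y]] tangent_space_scale[OF vf_tangent[OF X]]]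
      eta_scale[OF i lie_bracket_tangent[OF X Y]] eta_scale[OF i vf_tangent[OF X]] ..
  ultimately show ?thesis
    using tv_mult[OF vf_tangent[OF Y] h sm_eta[OF i X]] by (simp add: d_form_def algebra_simps)
qed

lemma lie_bracket_0_left: "Y \<in> V \<Longrightarrow> lie_bracket A 0 Y = 0"
  using tv_const[OF vf_tangent] by (auto simp: lie_bracket_def fun_eq_iff)

lemma d_form_0_left: "i < p \<Longrightarrow> Y \<in> V \<Longrightarrow> d_form A (\<eta> i) 0 Y x = 0"
  using tv_const[OF vf_tangent, of Y x 0] by (simp add: d_form_def lie_bracket_0_left eta_0)

lemma d_form_sum_left:
  assumes i: "i < p" and Y: "Y \<in> V"
  shows "(\<And>j. j \<in> I \<Longrightarrow> X j \<in> V) \<Longrightarrow>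
    d_form A (\<eta> i) (\<Sum>j\<in>I. X j) Y x = (\<Sum>j\<in>I. d_form A (\<eta> i) (X j) Y x)"
proof (induction I rule: infinite_finite_induct)
  case (infinite I)
  show ?case unfolding sum.infinite[OF infinite(1)] by (rule d_form_0_left[OF i Y])
next
  case empty
  show ?case unfolding sum.empty by (rule d_form_0_left[OF i Y])
next
  case (insert j I)
  have IH: "d_form A (\<eta> i) (\<Sum>j\<in>I. X j) Y x = (\<Sum>j\<in>I. d_form A (\<eta> i) (X j) Y x)"
    by (rule insert.IH) (simp add: insert.prems)
  have "d_form A (\<eta> i) (X j + (\<Sum>j\<in>I. X j)) Y x = d_form A (\<eta> i) (X j) Y x + d_form A (\<eta> i) (\<Sum>j\<in>I. X j) Y x"
    by (rule d_form_add_left[OF i _ _ Y]) (simp_all add: insert.prems vf_sum)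
  then show ?case unfolding sum.insert[OF insert.hyps] IH .
qed

text \<open>The tensor called C in the overview; in the code the letter \<open>C\<close> denotes the
  generating set of a coframe.\<close>

abbreviation torsion :: "'m vfield \<Rightarrow> 'm vfield \<Rightarrow> 'm vfield"
  where "torsion X Y \<equiv> nijenhuis A \<phi> X Y + d_eta_star A p \<phi> xs X Y"

text \<open>Apply \<eta>_i to the torsion: d\<eta>* contributes d\<eta>_i(X, Y), while from
  [\<phi>, \<phi>] only \<eta>_i([\<phi> X, \<phi> Y]) survives, which is -d\<eta>_i(\<phi> X,
  \<phi> Y).\<close>

lemma d_form_phi:
  assumes i: "i < p" and X: "X \<in> V" and Y: "Y \<in> V" and 0: "torsion X Y = 0"
  shows "d_form A (\<eta> i) X Y x = d_form A (\<eta> i) (app_field \<phi> X) (app_field \<phi> Y) x"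
proof -
  note pX = phi_vf[OF X] and pY = phi_vf[OF Y]
  note t = lie_bracket_tangent[OF X Y, of x] lie_bracket_tangent[OF pX pY, of x]
    lie_bracket_tangent[OF pX Y, of x] lie_bracket_tangent[OF X pY, of x]
  note pt = phi_tangent[OF t(1)] phi_tangent[OF t(3)] phi_tangent[OF t(4)]
  note ppt = phi_tangent[OF pt(1)]
  have "\<eta> i x (nijenhuis A \<phi> X Y x) = \<eta> i x (lie_bracket A (app_field \<phi> X) (app_field \<phi> Y) x)"
    unfolding nijenhuis_apply
      eta_diff[OF i tangent_space_diff[OF tangent_space_add[OF ppt t(2)] pt(2)] pt(3)]
      eta_diff[OF i tangent_space_add[OF ppt t(2)] pt(2)] eta_add[OF i ppt t(2)]
      eta_phi[OF i pt(1)] eta_phi[OF i t(3)] eta_phi[OF i t(4)] by simp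
  moreover have "\<eta> i x (d_eta_star A p \<phi> xs X Y x) = d_form A (\<eta> i) X Y x"
    unfolding d_eta_star_def by (rule eta_sum_xs[OF i])
  moreover have "\<eta> i x (nijenhuis A \<phi> X Y x) + \<eta> i x (d_eta_star A p \<phi> xs X Y x) = 0"
  proof -
    have "d_eta_star A p \<phi> xs X Y x \<in> T x" unfolding d_eta_star_def by (rule sum_xs_tangent)
    from eta_add[OF i nijenhuis_tangent[OF phi_tensor X Y] this]
    have "\<eta> i x (nijenhuis A \<phi> X Y x) + \<eta> i x (d_eta_star A p \<phi> xs X Y x) = \<eta> i x (torsion X Y x)"
      by (subst plus_fun_apply) (rule sym)
    also have "\<dots> = \<eta> i x 0" unfolding 0 by (subst zero_fun_apply) (rule refl)
    finally show ?thesis using eta_0[OF i] by simp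
  qed
  moreover have "\<eta> i y (app_field \<phi> X y) = 0" "\<eta> i y (app_field \<phi> Y y) = 0" for y
    unfolding app_field_apply by (rule eta_phi[OF i vf_tangent[OF X]], rule eta_phi[OF i vf_tangent[OF Y]])
  ultimately show ?thesis
    using tv_const[OF vf_tangent[OF pX], of x 0] tv_const[OF vf_tangent[OF pY], of x 0]
    by (simp add: d_form_def)
qed

lemma app_phi_xs: "j < p \<Longrightarrow> app_field \<phi> (xs j) = 0"
  using phi_xs by (intro ext) (simp add: app_field_apply)

lemma d_form_xs:
  assumes i: "i < p" and j: "j < p" and Y: "Y \<in> V" and 0: "torsion (xs j) Y = 0"
  shows "d_form A (\<eta> i) (xs j) Y x = 0"
  unfolding d_form_phi[OF i xs_vf[OF j] Y 0] app_phi_xs[OF j] by (rule d_form_0_left[OF i phi_vf[OF Y]])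

text \<open>\<open>d_form_phi\<close> turns d\<eta>_i(\<phi> X, Y) into d\<eta>_i(\<phi>^2 X, \<phi>
  Y). As d\<eta>_i is linear over functions, \<phi>^2 X may be split into -X and multiples of the
  frame fields, and those drop out by \<open>d_form_xs\<close>.\<close>

lemma d_form_phi_skew:
  assumes i: "i < p" and X: "X \<in> V" and Y: "Y \<in> V" and 0: "\<And>X Y. X \<in> V \<Longrightarrow> Y \<in> V \<Longrightarrow> torsion X Y = 0"
  shows "d_form A (\<eta> i) (app_field \<phi> X) Y x + d_form A (\<eta> i) X (app_field \<phi> Y) x = 0"
proof -
  note pX = phi_vf[OF X] and pY = phi_vf[OF Y]
  let ?e = "\<lambda>j y. \<eta> j y (X y)"
  have e: "fmul (?e j) (xs j) \<in> V" if "j \<in> {..<p}" for j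
    using vf_fmul[OF xs_vf sm_eta[OF _ X]] that by simp
  have m: "fmul (\<lambda>y. - 1) X \<in> V" by (rule vf_fmul[OF X sm_const])
  \<comment> \<open>Every summand is a function times a field, the sign included, so that
    \<open>d_form_fmul_left\<close> handles all of them.\<close>
  have "app_field \<phi> (app_field \<phi> X) = fmul (\<lambda>y. - 1) X + (\<Sum>j<p. fmul (?e j) (xs j))"
  proof
    fix y
    have "\<phi> y (\<phi> y (X y)) = - X y + (\<Sum>j<p. ?e j y *\<^sub>R xs j y)"
      unfolding eta_decomposition[OF vf_tangent[OF X], symmetric] by (simp only: minus_add_cancel)
    then show "app_field \<phi> (app_field \<phi> X) y = (fmul (\<lambda>y. - 1) X + (\<Sum>j<p. fmul (?e j) (xs j))) y"
      by (intro ext) (simp add: app_field_apply sum_fun_apply)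
  qed
  then have "d_form A (\<eta> i) (app_field \<phi> X) Y x = d_form A (\<eta> i) (fmul (\<lambda>y. - 1) X + (\<Sum>j<p. fmul (?e j) (xs j))) (app_field \<phi> Y) x"
    using d_form_phi[OF i pX Y 0[OF pX Y]] by metis
  also have "\<dots> = d_form A (\<eta> i) (fmul (\<lambda>y. - 1) X) (app_field \<phi> Y) x
      + d_form A (\<eta> i) (\<Sum>j<p. fmul (?e j) (xs j)) (app_field \<phi> Y) x"
    by (rule d_form_add_left[OF i m vf_sum[OF e] pY])
  also have "d_form A (\<eta> i) (\<Sum>j<p. fmul (?e j) (xs j)) (app_field \<phi> Y) x
      = (\<Sum>j<p. d_form A (\<eta> i) (fmul (?e j) (xs j)) (app_field \<phi> Y) x)"
    by (rule d_form_sum_left[OF i pY e])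
  also have "\<dots> = (\<Sum>j<p. ?e j x * d_form A (\<eta> i) (xs j) (app_field \<phi> Y) x)"
    by (rule sum.cong[OF refl]) (rule d_form_fmul_left[OF i xs_vf pY sm_eta[OF _ X]], simp_all)
  also have "d_form A (\<eta> i) (fmul (\<lambda>y. - 1) X) (app_field \<phi> Y) x = - d_form A (\<eta> i) X (app_field \<phi> Y) x"
    using d_form_fmul_left[OF i X pY sm_const, of "- 1"] by simp
  also have "(\<Sum>j<p. ?e j x * d_form A (\<eta> i) (xs j) (app_field \<phi> Y) x) = 0"
    using d_form_xs[OF i _ pY 0[OF xs_vf pY]] by simp
  finally show ?thesis by simp
qed

end

lemma fpkg_abelian:
  assumes "mfd A C d" and fpkg: "fpkg_structure A p \<phi> br \<xi> star"
    and 0: "\<And>Z T. Z \<in> vector_fields A \<Longrightarrow> T \<in> vector_fields A \<Longrightarrow>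
        nijenhuis A \<phi> Z T + d_eta_star A p \<phi> (\<lambda>i. star (\<xi> i)) Z T = 0"
  shows "br a b = 0"
proof -
  interpret mfd A C d by fact
  interpret fpk A C d p \<phi> "\<lambda>i. star (\<xi> i)"
    by standard (use fpkg in \<open>simp add: fpkg_structure_def\<close>)
  have lie: "\<And>a. linear (br a)" "\<And>b. linear (\<lambda>a. br a b)" and basis: "is_basis p UNIV \<xi>"
    and star: "linear star" "\<And>a b. star (br a b) = lie_bracket A (star a) (star b)"
    using fpkg by (auto simp: fpkg_structure_def lie_algebra_def)
  have jk: "br (\<xi> j) (\<xi> k) = 0" if j: "j < p" and k: "k < p" for j k
  proof -
    obtain c where c: "br (\<xi> j) (\<xi> k) = (\<Sum>i<p. c i *\<^sub>R \<xi> i)"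
      using is_basis_coefficients[OF basis UNIV_I] .
    \<comment> \<open>One point of M is enough because the coefficients c are constants, and a point
      exists because types are inhabited.\<close>
    fix x :: 'a
    have "c i = 0" if i: "i < p" for i
    proof -
      have "star (br (\<xi> j) (\<xi> k)) x = (\<Sum>i<p. c i *\<^sub>R star (\<xi> i) x)"
        unfolding c linear_sum[OF star(1)] linear_scale[OF star(1)] sum_fun_apply scaleR_fun_apply ..
      then have "\<eta> i x (lie_bracket A (star (\<xi> j)) (star (\<xi> k)) x) = c i"
        unfolding star(2)[symmetric] by (simp only: eta_sum_xs[OF i])
      moreover have "\<eta> i y (star (\<xi> k) y) = (if i = k then 1 else 0)" "\<eta> i y (star (\<xi> j) y) = (if i = j then 1 else 0)" for y
        using eta_xs i j k by auto
      ultimately show ?thesis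
        using d_form_xs[OF i j xs_vf[OF k] 0[OF xs_vf[OF j] xs_vf[OF k]], of x]
          tv_const[OF vf_tangent[OF xs_vf[OF j], of x]] tv_const[OF vf_tangent[OF xs_vf[OF k], of x]]
        by (simp add: d_form_def)
    qed
    then show ?thesis unfolding c by (intro sum.neutral) simp
  qed
  obtain u where u: "a = (\<Sum>i<p. u i *\<^sub>R \<xi> i)" using is_basis_coefficients[OF basis UNIV_I] .
  obtain w where w: "b = (\<Sum>i<p. w i *\<^sub>R \<xi> i)" using is_basis_coefficients[OF basis UNIV_I] .
  have "br a b = (\<Sum>i<p. u i *\<^sub>R (\<Sum>k<p. w k *\<^sub>R br (\<xi> i) (\<xi> k)))"
    unfolding u linear_sum[OF lie(2)] linear_scale[OF lie(2)] unfolding w linear_sum[OF lie(1)] linear_scale[OF lie(1)] ..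
  also have "\<dots> = 0" by (intro sum.neutral ballI) (simp add: jk)
  finally show ?thesis .
qed

subsection \<open>Frames of left-invariant fields\<close>

lemma is_basisI:
  assumes ind: "\<And>a. (\<Sum>i<p. a i *\<^sub>R b i) = 0 \<Longrightarrow> \<forall>i<p. a i = 0"
    and span: "\<And>v. v \<in> V \<Longrightarrow> \<exists>a. v = (\<Sum>i<p. a i *\<^sub>R b i)"
    and V: "subspace V" "\<And>i. i < p \<Longrightarrow> b i \<in> V"
  shows "is_basis p V b"
proof -
  have inj: "inj_on b {..<p}"
  proof (rule inj_onI, rule ccontr)
    fix i j assume ij: "i \<in> {..<p}" "j \<in> {..<p}" "b i = b j" "i \<noteq> j"
    \<comment> \<open>Two equal entries of b would give the relation b i - b j = 0.\<close>
    define a where "a = (\<lambda>k. (if k = i then 1 else 0) - (if k = j then 1 else 0) :: real)"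
    have "(\<Sum>k<p. a k *\<^sub>R b k) = (\<Sum>k<p. if k = i then b k else 0) - (\<Sum>k<p. if k = j then b k else 0)"
      unfolding sum_subtractf[symmetric] by (rule sum.cong) (auto simp: a_def)
    also have "\<dots> = 0" using ij by (simp only: sum.delta finite_lessThan if_True right_minus_eq)
    finally have "a i = 0" using ind ij by blast
    then show False using ij by (simp add: a_def)
  qed
  have "independent (b ` {..<p})"
  proof (rule independent_if_scalars_zero)
    fix f v assume f: "(\<Sum>x\<in>b ` {..<p}. f x *\<^sub>R x) = 0" and v: "v \<in> b ` {..<p}"
    have "(\<Sum>i<p. f (b i) *\<^sub>R b i) = 0" using f by (simp only: sum.reindex[OF inj] o_def)
    then have "f (b i) = 0" if "i < p" for i using ind[of "\<lambda>i. f (b i)"] that by blast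
    then show "f v = 0" using v by blast
  qed simp
  moreover have "span (b ` {..<p}) = V"
  proof
    show "span (b ` {..<p}) \<subseteq> V" using V by (intro span_minimal) auto
    show "V \<subseteq> span (b ` {..<p})"
    proof
      fix v assume "v \<in> V"
      then obtain a where "v = (\<Sum>i<p. a i *\<^sub>R b i)" using span by blast
      then show "v \<in> span (b ` {..<p})"
        by (simp only:) (intro span_sum span_scale span_base imageI)
    qed
  qed
  ultimately show ?thesis using inj by (simp add: is_basis_def)
qed

text \<open>A vector outside the span of the w i would give p + 1 independent vectors in a space
  spanned by p.\<close>

lemma is_basis_UNIV_independent:
  assumes "is_basis p (UNIV :: 'v::real_vector set) b"
    and ind: "\<And>a. (\<Sum>i<p. a i *\<^sub>R w i) = 0 \<Longrightarrow> \<forall>i<p. a i = 0"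
  shows "\<exists>a. (v :: 'v) = (\<Sum>i<p. a i *\<^sub>R w i)"
proof -
  have "is_basis p (span (w ` {..<p})) w"
  proof (rule is_basisI[OF ind])
    show "\<exists>a. v = (\<Sum>i<p. a i *\<^sub>R w i)" if "v \<in> span (w ` {..<p})" for v
      using that
    proof (induction rule: span_induct_alt)
      case base
      then show ?case by (intro exI[of _ "\<lambda>_. 0"]) simp
    next
      case (step c x y)
      then obtain i a where i: "i < p" "x = w i" and a: "y = (\<Sum>i<p. a i *\<^sub>R w i)" by auto
      have "(\<Sum>k<p. (a(i := a i + c)) k *\<^sub>R w k) = (\<Sum>k<p. a k *\<^sub>R w k + (if k = i then c *\<^sub>R w k else 0))"
        by (intro sum.cong) (auto simp: scaleR_add_left)
      also have "\<dots> = c *\<^sub>R x + y" using i by (simp add: sum.distrib a add.commute)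
      finally show ?case by (intro exI) (rule sym)
    qed
  next
    show "subspace (span (w ` {..<p}))" by (rule subspace_span)
    show "w i \<in> span (w ` {..<p})" if "i < p" for i by (rule span_base) (use that in simp)
  qed
  note bw = this
  then have w: "inj_on w {..<p}" "independent (w ` {..<p})" by (auto simp: is_basis_def)
  have b: "inj_on b {..<p}" "span (b ` {..<p}) = UNIV" using assms(1) by (auto simp: is_basis_def)
  have "v \<in> span (w ` {..<p})"
  proof (rule ccontr)
    assume v: "v \<notin> span (w ` {..<p})"
    then have "independent (insert v (w ` {..<p}))" using w(2) by (rule independent_insertI)
    then have "card (insert v (w ` {..<p})) \<le> card (b ` {..<p})"
      using independent_span_bound[of "b ` {..<p}"] b(2) by simp
    moreover have "v \<notin> w ` {..<p}" using v span_base[of v "w ` {..<p}"] by blast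
    ultimately show False using card_image[OF w(1)] card_image[OF b(1)] by simp
  qed
  from is_basis_coefficients[OF bw this] show ?thesis by blast
qed

lemma (in mfd) linear_rep:
  assumes "(U, \<psi>) \<in> A" "x \<in> U"
  shows "linear (rep U \<psi> x)"
  using linear_add[OF linear_pd[OF assms]] linear_scale[OF linear_pd[OF assms]]
  by (intro linearI ext) (simp_all add: rep_def)

text \<open>A left-invariant field that vanishes at one point vanishes everywhere by translation; as
  L is injective, independence in the Lie algebra passes to the tangent space at g. In a chart the
  fields become p independent vectors of the p-dimensional model, so they also span.\<close>

lemma left_invariant_basis:
  fixes B :: "('g::{t2_space,second_countable_topology}, 'h::{real_inner,heine_borel}) atlas"
  assumes G: "lie_group p B mul" and L: "lie_algebra_of_group B mul br L"
    and \<xi>: "is_basis p UNIV \<xi>"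
  shows "is_basis p (tangent_space B g) (\<lambda>i. L (\<xi> i) g)"
proof -
  have man: "smooth_manifold p B" using G by (simp add: lie_group_def)
  then obtain C d where "mfd B C d" using smooth_manifold_mfd by blast
  then interpret mfd B C d .
  obtain b where b: "is_basis p (UNIV :: 'h set) b" using man by (auto simp: smooth_manifold_def)
  obtain e i where "Groups.group mul e i" using G by (auto simp: lie_group_def)
  then interpret grp: Groups.group mul e i .
  have lin: "linear L" and inj: "inj L" and ran: "\<And>a. L a \<in> left_invariant_fields B mul"
    using L by (auto simp: lie_algebra_of_group_def bij_betw_def)
  have ind: "\<forall>j<p. a j = 0" if 0: "(\<Sum>i<p. a i *\<^sub>R L (\<xi> i) g) = 0" for a
  proof -
    define z where "z = (\<Sum>i<p. a i *\<^sub>R \<xi> i)"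
    have Lz: "L z g = 0"
      unfolding z_def linear_sum[OF lin] linear_scale[OF lin] sum_fun_apply[of _ _ g] scaleR_fun_apply[of _ _ g]
      by (rule 0)
    have "L z g' = 0" for g'
    proof -
      \<comment> \<open>Here \<open>i\<close> is the inversion of the group: left translation by g'
        g^(-1) takes g to g'.\<close>
      have "mul (mul g' (i g)) g = g'"
        by (simp add: grp.assoc)
      then have "L z g' = differential B (mul (mul g' (i g))) g (L z g)"
        using ran[of z] by (simp add: left_invariant_fields_def)
      then show ?thesis unfolding Lz by (auto simp: differential_def fun_eq_iff)
    qed
    then have "L z = L 0" using linear_0[OF lin] by (auto simp: fun_eq_iff)
    then have "z = 0" using inj by (simp add: inj_eq)
    then show ?thesis unfolding z_def using is_basis_independent[OF \<xi>] by blast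
  qed
  obtain V \<theta> where c: "(V, \<theta>) \<in> B" "g \<in> V" using chart_at .
  have t: "L a g \<in> tangent_space B g" for a
    using ran[of a] vf_tangent by (simp add: left_invariant_fields_def)
  have "\<forall>i. \<exists>w. L (\<xi> i) g = rep V \<theta> g w" using tangent_space_rep[OF t c] by metis
  then obtain w where w: "\<And>i. L (\<xi> i) g = rep V \<theta> g (w i)" by metis
  have w_sum: "(\<Sum>i<p. a i *\<^sub>R L (\<xi> i) g) = rep V \<theta> g (\<Sum>i<p. a i *\<^sub>R w i)" for a
    unfolding w linear_sum[OF linear_rep[OF c]] linear_scale[OF linear_rep[OF c]] ..
  show ?thesis
  proof (rule is_basisI[OF ind])
    fix v assume "v \<in> tangent_space B g"
    then obtain u where u: "v = rep V \<theta> g u" using tangent_space_rep[OF _ c] by blast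
    have "\<forall>j<p. a j = 0" if 0: "(\<Sum>i<p. a i *\<^sub>R w i) = 0" for a
      by (rule ind) (unfold w_sum 0, rule linear_0[OF linear_rep[OF c]])
    then obtain a where "u = (\<Sum>i<p. a i *\<^sub>R w i)" using is_basis_UNIV_independent[OF b, of w u] by blast
    then show "\<exists>a. v = (\<Sum>i<p. a i *\<^sub>R L (\<xi> i) g)" unfolding u w_sum by blast
  qed (use t subspace_tangent_space in auto)
qed

subsection \<open>The almost complex structure on the product\<close>

text \<open>The Lie group enters only through its frame \<open>ls\<close>, with arbitrary brackets.
  That these vanish is a hypothesis where it is used, in \<open>normal_if_torsion\<close>.\<close>

locale fpk_prod = prod_mfd A C d B C' d' C'' d'' + F: fpk A C d p \<phi> xs
  for A :: "('m::topological_space, 'e::real_inner) atlas" and C d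
    and B :: "('n::topological_space, 'f::real_inner) atlas" and C' d' C'' d'' p \<phi> xs +
  fixes ls :: "nat \<Rightarrow> 'n vfield"
  assumes ls_vf: "i < p \<Longrightarrow> ls i \<in> vector_fields B"
    and ls_basis: "is_basis p (tangent_space B g) (\<lambda>i. ls i g)"
begin

abbreviation "J \<equiv> product_J A B p \<phi> xs ls"

lemma sum_ls_tangent: "(\<Sum>i<p. a i *\<^sub>R ls i g) \<in> tangent_space B g"
  by (rule N.tangent_space_sum) (simp add: N.tangent_space_scale N.vf_tangent ls_vf)

lemma star_at_sum: "star_at p xs ls x g (\<Sum>i<p. a i *\<^sub>R ls i g) = (\<Sum>i<p. a i *\<^sub>R xs i x)"
  unfolding star_at_def
proof (rule the_equality)
  show "\<exists>a'. (\<Sum>i<p. a i *\<^sub>R ls i g) = (\<Sum>i<p. a' i *\<^sub>R ls i g) \<and>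
      (\<Sum>i<p. a i *\<^sub>R xs i x) = (\<Sum>i<p. a' i *\<^sub>R xs i x)" by blast
next
  fix u assume "\<exists>a'. (\<Sum>i<p. a i *\<^sub>R ls i g) = (\<Sum>i<p. a' i *\<^sub>R ls i g) \<and> u = (\<Sum>i<p. a' i *\<^sub>R xs i x)"
  then obtain a' where a': "(\<Sum>i<p. a i *\<^sub>R ls i g) = (\<Sum>i<p. a' i *\<^sub>R ls i g)" "u = (\<Sum>i<p. a' i *\<^sub>R xs i x)"
    by blast
  show "u = (\<Sum>i<p. a i *\<^sub>R xs i x)"
    unfolding a'(2) by (rule sum.cong[OF refl]) (simp only: is_basis_unique[OF ls_basis a'(1)] lessThan_iff)
qed

text \<open>All tangent vectors of the product have this form (\<open>mk_cases\<close>), so the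
  formula replaces the differentials and the definite description in \<open>product_J\<close> from
  here on.\<close>

lemma J_mk:
  assumes u: "u \<in> tangent_space A x"
  shows "J (x, g) (mk x g u (\<Sum>i<p. a i *\<^sub>R ls i g))
    = mk x g (\<phi> x u - (\<Sum>i<p. a i *\<^sub>R xs i x)) (\<Sum>i<p. F.\<eta> i x u *\<^sub>R ls i g)"
proof -
  have "J (x, g) w = mk x g (\<phi> x (differential A fst (x, g) w) - star_at p xs ls x g (differential B snd (x, g) w))
      (\<Sum>i<p. F.\<eta> i x (differential A fst (x, g) w) *\<^sub>R ls i g)" for w
    unfolding product_J_def prod.case Let_def mk_def ..
  then show ?thesis
    unfolding differential_fst_mk[OF u sum_ls_tangent] differential_snd_mk[OF u sum_ls_tangent] star_at_sum
    by (simp only: differential_fst_mk[OF u sum_ls_tangent] differential_snd_mk[OF u sum_ls_tangent] star_at_sum)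
qed

lemma mk_cases:
  assumes "w \<in> tangent_space AB (x, g)"
  obtains u a where "u \<in> tangent_space A x" "w = mk x g u (\<Sum>i<p. a i *\<^sub>R ls i g)"
proof -
  obtain a where "differential B snd (x, g) w = (\<Sum>i<p. a i *\<^sub>R ls i g)"
    using is_basis_coefficients[OF ls_basis mk_differential(3)[OF assms]] .
  then show ?thesis using that mk_differential(1,2)[OF assms] by metis
qed

lemma J_tangent:
  assumes "w \<in> tangent_space AB q"
  shows "J q w \<in> tangent_space AB q"
proof (cases q)
  case (Pair x g)
  obtain u a where u: "u \<in> tangent_space A x" and w: "w = mk x g u (\<Sum>i<p. a i *\<^sub>R ls i g)"
    by (rule mk_cases[OF assms[unfolded Pair]])
  show ?thesis unfolding Pair w J_mk[OF u]
    by (rule mk_tangent[OF M.tangent_space_diff[OF F.phi_tangent[OF u] F.sum_xs_tangent] sum_ls_tangent])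
qed

text \<open>\<phi> kills the frame part and \<eta> kills the image of \<phi>, so a second
  application of J returns \<phi>^2 u - \<eta>*(u) = -u in the first component and the coefficients
  -a in the second.\<close>

lemma J_J:
  assumes "w \<in> tangent_space AB q"
  shows "J q (J q w) = - w"
proof (cases q)
  case (Pair x g)
  obtain u a where u: "u \<in> tangent_space A x" and w: "w = mk x g u (\<Sum>i<p. a i *\<^sub>R ls i g)"
    by (rule mk_cases[OF assms[unfolded Pair]])
  note pu = F.phi_tangent[OF u]
  let ?u = "\<phi> x u - (\<Sum>i<p. a i *\<^sub>R xs i x)"
  have u': "?u \<in> tangent_space A x" by (rule M.tangent_space_diff[OF pu F.sum_xs_tangent])
  have "\<phi> x ?u = \<phi> x (\<phi> x u)"
    unfolding F.phi_diff[OF pu F.sum_xs_tangent] F.phi_sum_xs by (rule diff_0_right)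
  then have 1: "\<phi> x ?u - (\<Sum>i<p. F.\<eta> i x u *\<^sub>R xs i x) = - u"
    unfolding F.eta_decomposition[OF u, symmetric] by (simp only: diff_add_eq_diff_diff_swap diff_self diff_0)
  have "F.\<eta> i x ?u = - a i" if "i < p" for i
    unfolding F.eta_diff[OF that pu F.sum_xs_tangent] F.eta_phi[OF that u] F.eta_sum_xs[OF that] by simp
  then have "(\<Sum>i<p. F.\<eta> i x ?u *\<^sub>R ls i g) = (\<Sum>i<p. (- a i) *\<^sub>R ls i g)"
    by (intro sum.cong refl) (simp only: lessThan_iff)
  also have "\<dots> = - (\<Sum>i<p. a i *\<^sub>R ls i g)" by (simp only: scaleR_minus_left sum_negf)
  finally show ?thesis unfolding Pair w J_mk[OF u] J_mk[OF u'] 1 mk_minus[symmetric] by (rule arg_cong)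
qed

lemma J_add:
  assumes "w \<in> tangent_space AB q" "w' \<in> tangent_space AB q"
  shows "J q (w + w') = J q w + J q w'"
proof (cases q)
  case (Pair x g)
  obtain u a where u: "u \<in> tangent_space A x" and w: "w = mk x g u (\<Sum>i<p. a i *\<^sub>R ls i g)"
    by (rule mk_cases[OF assms(1)[unfolded Pair]])
  obtain u' a' where u': "u' \<in> tangent_space A x" and w': "w' = mk x g u' (\<Sum>i<p. a' i *\<^sub>R ls i g)"
    by (rule mk_cases[OF assms(2)[unfolded Pair]])
  have s: "(\<Sum>i<p. a i *\<^sub>R b i) + (\<Sum>i<p. a' i *\<^sub>R b i) = (\<Sum>i<p. (a i + a' i) *\<^sub>R b i)"
    for a a' and b :: "nat \<Rightarrow> 'z::real_vector"
    by (simp only: scaleR_add_left sum.distrib)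
  have e: "(\<Sum>i<p. F.\<eta> i x (u + u') *\<^sub>R ls i g) = (\<Sum>i<p. (F.\<eta> i x u + F.\<eta> i x u') *\<^sub>R ls i g)"
    by (rule sum.cong[OF refl]) (simp only: F.eta_add[OF _ u u'] lessThan_iff)
  show ?thesis
    unfolding Pair w w' mk_add[symmetric] s J_mk[OF u] J_mk[OF u'] J_mk[OF M.tangent_space_add[OF u u']]
      e F.phi_add[OF u u'] by (simp only: s[symmetric] add_diff_add)
qed

lemma J_scale:
  assumes "w \<in> tangent_space AB q"
  shows "J q (c *\<^sub>R w) = c *\<^sub>R J q w"
proof (cases q)
  case (Pair x g)
  obtain u a where u: "u \<in> tangent_space A x" and w: "w = mk x g u (\<Sum>i<p. a i *\<^sub>R ls i g)"
    by (rule mk_cases[OF assms(1)[unfolded Pair]])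
  have s: "c *\<^sub>R (\<Sum>i<p. a i *\<^sub>R b i) = (\<Sum>i<p. (c * a i) *\<^sub>R b i)"
    for a and b :: "nat \<Rightarrow> 'z::real_vector"
    by (simp only: scaleR_sum_right scaleR_scaleR)
  have e: "(\<Sum>i<p. F.\<eta> i x (c *\<^sub>R u) *\<^sub>R ls i g) = (\<Sum>i<p. (c * F.\<eta> i x u) *\<^sub>R ls i g)"
    by (rule sum.cong[OF refl]) (simp only: F.eta_scale[OF _ u] lessThan_iff)
  show ?thesis
    unfolding Pair w mk_scale[symmetric] s J_mk[OF u] J_mk[OF M.tangent_space_scale[OF u]]
      e F.phi_scale[OF u] scaleR_diff_right ..
qed

text \<open>Fields on the product whose component along the second factor has coefficients that depend
  only on the first factor: closed under the bracket, and containing all lifts and their images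
  under J.\<close>
definition slift :: "'m vfield \<Rightarrow> (nat \<Rightarrow> 'm \<Rightarrow> real) \<Rightarrow> ('m \<times> 'n) vfield"
  where "slift X e = (\<lambda>(x, g). mk x g (X x) (\<Sum>i<p. e i x *\<^sub>R ls i g))"

lemma slift_apply: "slift X e (x, g) = mk x g (X x) (\<Sum>i<p. e i x *\<^sub>R ls i g)"
  by (simp add: slift_def)

lemma slift_tangent: "X \<in> vector_fields A \<Longrightarrow> slift X e q \<in> tangent_space AB q"
  using mk_tangent[OF M.vf_tangent sum_ls_tangent] by (cases q) (simp add: slift_apply)

lemma eventually_fst:
  assumes "\<forall>\<^sub>F y in nhds (fst q). P y" shows "\<forall>\<^sub>F y in nhds q. P (fst y)"
proof -
  obtain W where W: "open W" "fst q \<in> W" "\<And>y. y \<in> W \<Longrightarrow> P y" using assms by (auto simp: eventually_nhds)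
  have "\<forall>\<^sub>F y in nhds q. y \<in> W \<times> UNIV"
    by (rule eventually_nhds_in_open) (use W in \<open>auto simp: open_Times mem_Times_iff\<close>)
  then show ?thesis by (rule eventually_mono) (auto simp: W)
qed

lemma eventually_snd:
  assumes "\<forall>\<^sub>F y in nhds (snd q). P y" shows "\<forall>\<^sub>F y in nhds q. P (snd y)"
proof -
  obtain W where W: "open W" "snd q \<in> W" "\<And>y. y \<in> W \<Longrightarrow> P y" using assms by (auto simp: eventually_nhds)
  have "\<forall>\<^sub>F y in nhds q. y \<in> UNIV \<times> W"
    by (rule eventually_nhds_in_open) (use W in \<open>auto simp: open_Times mem_Times_iff\<close>)
  then show ?thesis by (rule eventually_mono) (auto simp: W)
qed

lemma slift_fst:
  assumes "M.sm f (fst q)"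
  shows "slift X e q (f \<circ> fst) = X (fst q) f"
  using mk_fst[OF sum_ls_tangent, of f "fst q"] assms by (cases q) (simp add: slift_apply)

lemma slift_snd:
  assumes "X \<in> vector_fields A" "N.sm f (snd q)"
  shows "slift X e q (f \<circ> snd) = (\<Sum>i<p. e i (fst q) * ls i (snd q) f)"
  using mk_snd[OF M.vf_tangent[OF assms(1)], of f "snd q"] assms(2)
  by (cases q) (simp add: slift_apply sum_fun_apply)

lemma slift_fst_field:
  assumes "M.sm f (fst q)"
  shows "\<forall>\<^sub>F y in nhds q. slift X e y (f \<circ> fst) = ((\<lambda>x. X x f) \<circ> fst) y"
  using eventually_fst[OF M.sm_eventually[OF assms]]
  by (rule eventually_mono) (simp only: slift_fst o_apply)

lemma slift_snd_field:
  assumes "X \<in> vector_fields A" "N.sm f (snd q)"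
  shows "\<forall>\<^sub>F y in nhds q. slift X e y (f \<circ> snd) = (\<Sum>i<p. (e i \<circ> fst) y * ((\<lambda>g. ls i g f) \<circ> snd) y)"
  using eventually_snd[OF N.sm_eventually[OF assms(2)]]
  by (rule eventually_mono) (simp only: slift_snd[OF assms(1)] o_apply)

lemma vf_slift:
  assumes X: "X \<in> vector_fields A" and e: "\<And>i x. i < p \<Longrightarrow> M.sm (e i) x"
  shows "slift X e \<in> vector_fields AB"
proof (rule prod_vector_fieldsI[OF slift_tangent[OF X]])
  fix f and q :: "'m \<times> 'n"
  assume f: "M.sm f (fst q)"
  show "P.sm (\<lambda>y. slift X e y (f \<circ> fst)) q"
    by (rule P.sm_cong[OF sm_fst[OF M.vf_sm[OF X f]]])
       (use slift_fst_field[OF f] in \<open>simp only: eq_commute\<close>)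
next
  fix f and q :: "'m \<times> 'n"
  assume f: "N.sm f (snd q)"
  have "P.sm (\<lambda>y. \<Sum>i<p. (e i \<circ> fst) y * ((\<lambda>g. ls i g f) \<circ> snd) y) q"
    by (rule P.sm_sum[OF P.sm_mult[OF sm_fst[OF e] sm_snd[OF N.vf_sm[OF ls_vf f]]]]) auto
  then show "P.sm (\<lambda>y. slift X e y (f \<circ> snd)) q"
    by (rule P.sm_cong) (use slift_snd_field[OF X f] in \<open>simp only: eq_commute\<close>)
qed

text \<open>The coefficients f j live on M and the frame on G. Hence the Leibniz rule gives one sum
  in which X differentiates the coefficients and one in which the frame differentiates
  itself.\<close>

lemma slift_snd_second:
  assumes X: "X \<in> vector_fields A" and Y: "Y \<in> vector_fields A"
    and f: "\<And>i x. i < p \<Longrightarrow> M.sm (f i) x" and k: "N.sm k (snd q)"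
  shows "slift X e q (\<lambda>y. slift Y f y (k \<circ> snd)) =
    (\<Sum>j<p. X (fst q) (f j) * ls j (snd q) k)
    + (\<Sum>j<p. \<Sum>i<p. f j (fst q) * e i (fst q) * ls i (snd q) (\<lambda>g. ls j g k))"
proof -
  note t = slift_tangent[OF X, of e q]
  have fs: "P.sm (f j \<circ> fst) q" if "j < p" for j by (rule sm_fst[OF f[OF that]])
  have l: "N.sm (\<lambda>g. ls j g k) (snd q)" if "j < p" for j by (rule N.vf_sm[OF ls_vf[OF that] k])
  have lk: "P.sm ((\<lambda>g. ls j g k) \<circ> snd) q" if "j < p" for j by (rule sm_snd[OF l[OF that]])
  have "slift X e q (\<lambda>y. slift Y f y (k \<circ> snd))
      = slift X e q (\<lambda>y. \<Sum>j<p. (f j \<circ> fst) y * ((\<lambda>g. ls j g k) \<circ> snd) y)"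
    by (rule P.tv_cong[OF t slift_snd_field[OF Y k]])
  also have "\<dots> = (\<Sum>j<p. slift X e q (\<lambda>y. (f j \<circ> fst) y * ((\<lambda>g. ls j g k) \<circ> snd) y))"
    by (rule P.tv_sum[OF t P.sm_mult[OF fs lk]]) auto
  also have "\<dots> = (\<Sum>j<p. (f j \<circ> fst) q * slift X e q ((\<lambda>g. ls j g k) \<circ> snd)
      + slift X e q (f j \<circ> fst) * ((\<lambda>g. ls j g k) \<circ> snd) q)"
    by (rule sum.cong[OF refl P.tv_mult[OF t fs lk]]) auto
  also have "\<dots> = (\<Sum>j<p. f j (fst q) * (\<Sum>i<p. e i (fst q) * ls i (snd q) (\<lambda>g. ls j g k))
      + X (fst q) (f j) * ls j (snd q) k)"
    by (rule sum.cong[OF refl]) (simp add: slift_fst[OF f] slift_snd[OF X l])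
  finally show ?thesis by (simp add: sum.distrib sum_distrib_left mult.assoc)
qed

text \<open>The numbers s j are the coefficients of the brackets of the frame fields among
  themselves. They enter by the hypothesis S, since these brackets are arbitrary here; with a lift
  as one of the fields, s is 0.\<close>

lemma lie_bracket_slift:
  assumes X: "X \<in> vector_fields A" and Y: "Y \<in> vector_fields A"
    and e: "\<And>i x. i < p \<Longrightarrow> M.sm (e i) x" and f: "\<And>i x. i < p \<Longrightarrow> M.sm (f i) x"
    and S: "(\<Sum>j<p. \<Sum>i<p. (f j x * e i x) *\<^sub>R lie_bracket B (ls i) (ls j) g) = (\<Sum>j<p. s j *\<^sub>R ls j g)"
  shows "lie_bracket AB (slift X e) (slift Y f) (x, g) =
    mk x g (lie_bracket A X Y x) (\<Sum>j<p. (X x (f j) - Y x (e j) + s j) *\<^sub>R ls j g)"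
proof (rule prod_tv_ext)
  note sX = vf_slift[OF X e] and sY = vf_slift[OF Y f]
  show "lie_bracket AB (slift X e) (slift Y f) (x, g) \<in> tangent_space AB (x, g)"
    by (rule P.lie_bracket_tangent[OF sX sY])
  show "mk x g (lie_bracket A X Y x) (\<Sum>j<p. (X x (f j) - Y x (e j) + s j) *\<^sub>R ls j g) \<in> tangent_space AB (x, g)"
    by (rule mk_tangent[OF M.lie_bracket_tangent[OF X Y] sum_ls_tangent])
next
  fix k assume "M.sm k (fst (x, g))"
  then have k: "M.sm k x" by simp
  have "slift X e (x, g) (\<lambda>y. slift Y f y (k \<circ> fst)) = X x (\<lambda>z. Y z k)"
    if X: "X \<in> vector_fields A" and Y: "Y \<in> vector_fields A" for X Y e f
  proof -
    have "slift X e (x, g) (\<lambda>y. slift Y f y (k \<circ> fst)) = slift X e (x, g) ((\<lambda>z. Y z k) \<circ> fst)"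
      using P.tv_cong[OF slift_tangent[OF X] slift_fst_field[of k "(x, g)" Y f]] k by (simp add: o_def)
    also have "\<dots> = X x (\<lambda>z. Y z k)" using slift_fst[of "\<lambda>z. Y z k" "(x, g)"] M.vf_sm[OF Y k] by simp
    finally show ?thesis .
  qed
  note * = this[OF X Y] this[OF Y X]
  have "P.sm (k \<circ> fst) (x, g)" using sm_fst[of k "(x, g)"] k by simp
  then show "lie_bracket AB (slift X e) (slift Y f) (x, g) (k \<circ> fst)
      = mk x g (lie_bracket A X Y x) (\<Sum>j<p. (X x (f j) - Y x (e j) + s j) *\<^sub>R ls j g) (k \<circ> fst)"
    using k by (simp add: mk_fst[OF sum_ls_tangent k] lie_bracket_def *)
next
  fix k assume "N.sm k (snd (x, g))"
  then have k: "N.sm k (snd (x, g))" and k': "N.sm k g" by simp_all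
  have "P.sm (k \<circ> snd) (x, g)" using sm_snd[OF k] .
  then have "lie_bracket AB (slift X e) (slift Y f) (x, g) (k \<circ> snd)
    = (\<Sum>j<p. X x (f j) * ls j g k) + (\<Sum>j<p. \<Sum>i<p. f j x * e i x * ls i g (\<lambda>g. ls j g k))
    - ((\<Sum>j<p. Y x (e j) * ls j g k) + (\<Sum>j<p. \<Sum>i<p. e j x * f i x * ls i g (\<lambda>g. ls j g k)))"
    by (simp add: lie_bracket_def slift_snd_second[OF X Y f k] slift_snd_second[OF Y X e k])
  \<comment> \<open>Exchanging the indices gives both double sums the same coefficient, so that
    their difference consists of commutators of frame fields.\<close>
  also have "(\<Sum>j<p. \<Sum>i<p. e j x * f i x * ls i g (\<lambda>g. ls j g k))
      = (\<Sum>j<p. \<Sum>i<p. f j x * e i x * ls j g (\<lambda>g. ls i g k))"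
    by (subst sum.swap) (simp add: mult.commute)
  also have "(\<Sum>j<p. X x (f j) * ls j g k) + (\<Sum>j<p. \<Sum>i<p. f j x * e i x * ls i g (\<lambda>g. ls j g k))
    - ((\<Sum>j<p. Y x (e j) * ls j g k) + (\<Sum>j<p. \<Sum>i<p. f j x * e i x * ls j g (\<lambda>g. ls i g k)))
    = (\<Sum>j<p. (X x (f j) - Y x (e j)) * ls j g k)
      + (\<Sum>j<p. \<Sum>i<p. (f j x * e i x) * (ls i g (\<lambda>g. ls j g k) - ls j g (\<lambda>g. ls i g k)))"
    by (simp add: left_diff_distrib right_diff_distrib sum_subtractf)
  also have "(\<Sum>j<p. \<Sum>i<p. (f j x * e i x) * (ls i g (\<lambda>g. ls j g k) - ls j g (\<lambda>g. ls i g k)))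
      = (\<Sum>j<p. s j * ls j g k)"
    using fun_cong[OF S, of k] k' by (simp add: sum_fun_apply lie_bracket_def)
  finally show "lie_bracket AB (slift X e) (slift Y f) (x, g) (k \<circ> snd)
      = mk x g (lie_bracket A X Y x) (\<Sum>j<p. (X x (f j) - Y x (e j) + s j) *\<^sub>R ls j g) (k \<circ> snd)"
    unfolding mk_snd[OF M.lie_bracket_tangent[OF X Y] k']
    by (simp add: sum_fun_apply distrib_right sum.distrib o_def)
qed

end

text \<open>The existential quantifier in \<open>frames\<close> needs one fixed index type, namely
  the natural numbers; a finite index set of any other type is enumerated.\<close>

lemma (in mfd) framesI:
  assumes E: "E \<subseteq> vector_fields A"
    and "\<And>X x. X \<in> vector_fields A \<Longrightarrow> \<exists>h (I :: 'i set) a e. (\<forall>y. sm h y) \<and> h x \<noteq> 0 \<and> finite I \<and>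
      (\<forall>i\<in>I. e i \<in> E \<and> (\<forall>y. sm (a i) y)) \<and> fmul h X = (\<Sum>i\<in>I. fmul (a i) (e i))"
  shows "frames E"
  unfolding frames_def
proof (intro conjI E ballI allI)
  fix X x assume "X \<in> vector_fields A"
  then obtain h and I :: "'i set" and a e where *: "\<forall>y. sm h y" "h x \<noteq> 0" "finite I"
      "\<forall>i\<in>I. e i \<in> E \<and> (\<forall>y. sm (a i) y)" "fmul h X = (\<Sum>i\<in>I. fmul (a i) (e i))"
    using assms(2)[of X x] by blast
  obtain f where f: "bij_betw f {0..<card I} I" using ex_bij_betw_nat_finite[OF *(3)] by blast
  have "(\<Sum>k\<in>{0..<card I}. fmul (a (f k)) (e (f k))) = fmul h X"
    unfolding *(5) by (rule sum.reindex_bij_betw[OF f])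
  moreover have "\<forall>k\<in>{0..<card I}. e (f k) \<in> E \<and> (\<forall>y. sm (a (f k)) y)"
    using *(4) bij_betwE[OF f] by blast
  ultimately show "\<exists>h (I :: nat set) a e. (\<forall>y. sm h y) \<and> h x \<noteq> 0 \<and>
      (\<forall>i\<in>I. e i \<in> E \<and> (\<forall>y. sm (a i) y)) \<and> fmul h X = (\<Sum>i\<in>I. fmul (a i) (e i))"
    using *(1,2)
    by (intro exI[of _ h] exI[of _ "{0..<card I}"] exI[of _ "\<lambda>k. a (f k)"] exI[of _ "\<lambda>k. e (f k)"]) simp
qed

section \<open>Lifts, generators and the Nijenhuis tensor of J\<close>

context fpk_prod
begin

abbreviation "lift X \<equiv> slift X (\<lambda>i x. 0)"

lemma lift_apply: "lift X (x, g) = mk x g (X x) 0"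
  unfolding slift_apply by (simp only: scaleR_zero_left sum.neutral_const)

lemma vf_lift: "X \<in> vector_fields A \<Longrightarrow> lift X \<in> vector_fields AB"
  by (rule vf_slift[OF _ M.sm_const])

lemma J_lift:
  assumes X: "X \<in> vector_fields A"
  shows "app_field J (lift X) = slift (app_field \<phi> X) (\<lambda>i x. F.\<eta> i x (X x))"
proof
  fix q :: "'m \<times> 'n"
  obtain x g where q: "q = (x, g)" by (cases q)
  have 0: "(\<Sum>i<p. 0 *\<^sub>R xs i x) = 0" by (simp only: scaleR_zero_left sum.neutral_const)
  show "app_field J (lift X) q = slift (app_field \<phi> X) (\<lambda>i x. F.\<eta> i x (X x)) q"
    unfolding q P.app_field_apply slift_apply J_mk[OF M.vf_tangent[OF X]] 0 diff_0_right M.app_field_apply ..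
qed

lemma vf_J_lift: "X \<in> vector_fields A \<Longrightarrow> app_field J (lift X) \<in> vector_fields AB"
  unfolding J_lift by (rule vf_slift[OF F.phi_vf F.sm_eta])

lemma J_lift_xs:
  assumes j: "j < p"
  shows "app_field J (lift (xs j)) (x, g) = mk x g 0 (ls j g)"
proof -
  have "(\<Sum>i<p. F.\<eta> i x (xs j x) *\<^sub>R ls i g) = (\<Sum>i<p. if i = j then ls i g else 0)"
    by (rule sum.cong[OF refl])
       (simp only: F.eta_xs[OF _ j] lessThan_iff if_distrib[of "\<lambda>a. a *\<^sub>R _"] scaleR_one scaleR_zero_left)
  also have "\<dots> = ls j g" using j by (simp only: sum.delta finite_lessThan lessThan_iff if_True)
  finally show ?thesis
    unfolding J_lift[OF F.xs_vf[OF j]] slift_apply M.app_field_apply F.phi_xs[OF j] by (rule arg_cong)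
qed

text \<open>The frame fields of G are recorded as J-images of lifts, so that
  \<open>nijenhuis_J_left\<close> applies to them directly.\<close>

definition gens :: "('m \<times> 'n) vfield set"
  where "gens = lift ` vector_fields A \<union> (\<lambda>j. app_field J (lift (xs j))) ` {..<p}"

lemma gens_vf: "gens \<subseteq> vector_fields AB"
  using vf_lift vf_J_lift F.xs_vf by (auto simp: gens_def)

text \<open>The coefficients are picked separately at each point of the product, but independence of
  the frame makes them solutions of a smooth linear system; elimination as for \<eta>.\<close>

lemma sm_ls_coefficients:
  assumes X: "X \<in> vector_fields AB"
    and b: "\<And>y. differential B snd y (X y) = (\<Sum>i<p. b i y *\<^sub>R ls i (snd y))" and j: "j < p"
  shows "P.sm (b j) q"
proof -
  obtain V \<theta> where c: "(V, \<theta>) \<in> B" "snd q \<in> V" using N.chart_at .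
  let ?w = "\<lambda>c. N.coord \<theta> (d' c)"
  show ?thesis
  proof (rule P.sm_coefficients[where I = C' and Z = "\<lambda>c y. X y (?w c \<circ> snd)"
        and v = "\<lambda>j c. (\<lambda>g. ls j g (?w c)) \<circ> snd" and k = b, OF _ _ _ _ j])
    show "P.sm ((\<lambda>g. ls j g (?w c)) \<circ> snd) q" if "j < p" for j c
      by (rule sm_snd[OF N.vf_sm[OF ls_vf[OF that] N.sm_coord[OF c]]])
    show "P.sm (\<lambda>y. X y (?w c \<circ> snd)) q" for c
      by (rule P.vf_sm[OF X sm_snd[OF N.sm_coord[OF c]]])
    show "\<forall>j<p. a j = 0" if 0: "\<And>c. c \<in> C' \<Longrightarrow> (\<Sum>j<p. a j * ((\<lambda>g. ls j g (?w c)) \<circ> snd) q) = 0" for a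
    proof -
      have "(\<Sum>j<p. a j *\<^sub>R ls j (snd q)) = 0"
        by (rule N.tv_ext[OF sum_ls_tangent N.tangent_space_0 c])
           (use 0 in \<open>simp add: sum_fun_apply\<close>)
      then show ?thesis using is_basis_independent[OF ls_basis] by blast
    qed
    show "\<forall>\<^sub>F y in nhds q. X y (?w c \<circ> snd) = (\<Sum>j<p. b j y * ((\<lambda>g. ls j g (?w c)) \<circ> snd) y)" for c
      using eventually_snd[OF N.sm_eventually[OF N.sm_coord[OF c, of "d' c"]]]
    proof (rule eventually_mono)
      fix y :: "'m \<times> 'n" assume "N.sm (?w c) (snd y)"
      then show "X y (?w c \<circ> snd) = (\<Sum>j<p. b j y * ((\<lambda>g. ls j g (?w c)) \<circ> snd) y)"
        using fun_cong[OF b[of y], of "?w c"] by (simp add: sum_fun_apply differential_def)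
    qed
  qed
qed

text \<open>Only the directions along M are cut off, the frame of G being global. Bump functions are
  a hypothesis because the type classes of the locale are too weak to construct them.\<close>

lemma frames_gens:
  assumes bump: "\<And>U \<psi> x. (U, \<psi>) \<in> A \<Longrightarrow> x \<in> U \<Longrightarrow>
    \<exists>K \<beta>. closed K \<and> K \<subseteq> U \<and> (\<forall>y. M.sm \<beta> y) \<and> \<beta> x \<noteq> 0 \<and> (\<forall>y. y \<notin> K \<longrightarrow> \<beta> y = 0)"
  shows "P.frames gens"
proof (rule P.framesI[OF gens_vf])
  fix X and q :: "'m \<times> 'n"
  assume X: "X \<in> vector_fields AB"
  obtain U \<psi> where c: "(U, \<psi>) \<in> A" "fst q \<in> U" using M.chart_at .
  obtain K \<beta> where K: "closed K" "K \<subseteq> U" and \<beta>: "\<And>y. M.sm \<beta> y" "\<beta> (fst q) \<noteq> 0" "\<And>y. y \<notin> K \<Longrightarrow> \<beta> y = 0"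
    using bump[OF c] by blast
  have "\<forall>y. \<exists>a. differential B snd y (X y) = (\<Sum>i<p. a i *\<^sub>R ls i (snd y))"
  proof
    fix y :: "'m \<times> 'n"
    obtain x g where y: "y = (x, g)" by (cases y)
    have "differential B snd y (X y) \<in> tangent_space B (snd y)"
      using mk_differential(3)[of "X y" x g] P.vf_tangent[OF X, of y] by (simp add: y)
    from is_basis_coefficients[OF ls_basis this]
    show "\<exists>a. differential B snd y (X y) = (\<Sum>i<p. a i *\<^sub>R ls i (snd y))" by blast
  qed
  then obtain b' where "\<forall>y. differential B snd y (X y) = (\<Sum>i<p. b' y i *\<^sub>R ls i (snd y))"
    by (rule choice[THEN exE])
  then have b: "differential B snd y (X y) = (\<Sum>i<p. b' y i *\<^sub>R ls i (snd y))" for y by blast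
  have sb: "P.sm (\<lambda>y. b' y i) y" if "i < p" for i y
    by (rule sm_ls_coefficients[OF X b that])
  have s\<beta>: "P.sm (\<beta> \<circ> fst) y" for y by (rule sm_fst[OF \<beta>(1)])
  \<comment> \<open>Two factors \<beta> are spent: one makes the coordinate field of M global, the
    other its coefficient.\<close>
  define h where "h = (\<lambda>y :: 'm \<times> 'n. (\<beta> \<circ> fst) y * (\<beta> \<circ> fst) y)"
  define a where "a = case_sum (\<lambda>c y. (\<beta> \<circ> fst) y * X y (M.coord \<psi> (d c) \<circ> fst)) (\<lambda>j y. h y * b' y j)"
  define e where "e = case_sum (\<lambda>c. lift (fmul \<beta> (\<lambda>y. M.rep U \<psi> y c))) (\<lambda>j. app_field J (lift (xs j)))"
  let ?I = "C <+> {..<p}"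
  have h: "P.sm h y" for y unfolding h_def by (rule P.sm_mult[OF s\<beta> s\<beta>])
  have fin: "finite C" using M.coframe by (simp add: coframe_def)
  have "e i \<in> gens \<and> (\<forall>y. P.sm (a i) y)" if "i \<in> ?I" for i
    using that
  proof (rule PlusE)
    fix c' assume i: "i = Inl c'"
    \<comment> \<open>The coordinate function is smooth only over U, so X applied to it is smooth
      only there until it is multiplied by \<beta>.\<close>
    have "P.sm (\<lambda>y. (\<beta> \<circ> fst) y * X y (M.coord \<psi> (d c') \<circ> fst)) y" for y
    proof (rule P.sm_cutoff[of "K \<times> UNIV", OF _ s\<beta>])
      show "closed (K \<times> (UNIV :: 'n set))" using K(1) by (simp add: closed_Times)
      show "(\<beta> \<circ> fst) y = 0" if "y \<notin> K \<times> UNIV" for y :: "'m \<times> 'n"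
        using that \<beta>(3) by (cases y) auto
      show "P.sm (\<lambda>y. X y (M.coord \<psi> (d c') \<circ> fst)) y" if "y \<in> K \<times> UNIV" for y
        by (rule P.vf_sm[OF X sm_fst[OF M.sm_coord[OF c(1)]]]) (use that K(2) in auto)
    qed
    moreover have "fmul \<beta> (\<lambda>y. M.rep U \<psi> y c') \<in> vector_fields A"
      by (rule M.vf_cutoff[OF c(1) K \<beta>(1,3)])
    ultimately show ?thesis by (simp add: i a_def e_def gens_def)
  next
    fix j assume j: "i = Inr j" "j \<in> {..<p}"
    have "P.sm (\<lambda>y. h y * b' y j) y" for y using P.sm_mult[OF h sb] j by simp
    then show ?thesis using j by (simp add: a_def e_def gens_def)
  qed
  moreover have "fmul h X = (\<Sum>i\<in>?I. fmul (a i) (e i))"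
  proof
    fix y :: "'m \<times> 'n"
    obtain x g where y: "y = (x, g)" by (cases y)
    have t: "X y \<in> tangent_space AB (x, g)" using P.vf_tangent[OF X, of y] by (simp add: y)
    let ?u = "differential A fst y (X y)"
    let ?c = "\<lambda>c. X y (M.coord \<psi> (d c) \<circ> fst)"
    have u: "h y *\<^sub>R ?u = (\<Sum>c\<in>C. (\<beta> x * ?c c) *\<^sub>R \<beta> x *\<^sub>R M.rep U \<psi> x c)"
    proof (cases "x \<in> K")
      case True
      then have x: "x \<in> U" using K by blast
      have tu: "?u \<in> tangent_space A x" using mk_differential(2)[OF t] by (simp add: y)
      have "?u (M.coord \<psi> (d c')) = ?c c'" for c'
        using M.sm_coord[OF c(1) x] by (simp add: differential_def y)
      then have "?u = (\<Sum>c\<in>C. ?c c *\<^sub>R M.rep U \<psi> x c)"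
        by (subst M.tv_expand[OF tu c(1) x]) (simp only:)
      then have "h y *\<^sub>R ?u = h y *\<^sub>R (\<Sum>c\<in>C. ?c c *\<^sub>R M.rep U \<psi> x c)" by (rule arg_cong)
      also have "\<dots> = (\<Sum>c\<in>C. (\<beta> x * ?c c) *\<^sub>R \<beta> x *\<^sub>R M.rep U \<psi> x c)"
        unfolding scaleR_sum_right scaleR_scaleR
        by (rule sum.cong[OF refl], rule arg_cong2[where f = scaleR]) (simp_all add: h_def y)
      finally show ?thesis .
    next
      case False
      then have "\<beta> x = 0" by (rule \<beta>(3))
      then show ?thesis by (intro ext) (simp add: h_def y sum_fun_apply)
    qed
    have v: "h y *\<^sub>R differential B snd y (X y) = (\<Sum>j<p. (h y * b' y j) *\<^sub>R ls j g)"
      unfolding b scaleR_sum_right scaleR_scaleR by (simp only: y snd_conv)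
    have "fmul h X y = mk x g (h y *\<^sub>R ?u) (h y *\<^sub>R differential B snd y (X y))"
      unfolding fmul_apply mk_scale using mk_differential(1)[OF t] by (simp add: y)
    \<comment> \<open>\<open>mk_sum\<close> needs sums over the same index set in both components;
      hence the sums of zeros.\<close>
    also have "\<dots> = mk x g (\<Sum>c\<in>C. (\<beta> x * ?c c) *\<^sub>R \<beta> x *\<^sub>R M.rep U \<psi> x c) (\<Sum>c\<in>C. (\<beta> x * ?c c) *\<^sub>R 0)
        + mk x g (\<Sum>j<p. (h y * b' y j) *\<^sub>R 0) (\<Sum>j<p. (h y * b' y j) *\<^sub>R ls j g)"
      unfolding u v mk_add[symmetric] scaleR_zero_right sum.neutral_const add_0_right add_0_left ..
    also have "\<dots> = (\<Sum>c\<in>C. (\<beta> x * ?c c) *\<^sub>R mk x g (\<beta> x *\<^sub>R M.rep U \<psi> x c) 0)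
        + (\<Sum>j<p. (h y * b' y j) *\<^sub>R mk x g 0 (ls j g))"
      unfolding mk_sum mk_scale ..
    also have "(\<Sum>j<p. (h y * b' y j) *\<^sub>R mk x g 0 (ls j g)) = (\<Sum>j<p. fmul (a (Inr j)) (e (Inr j)) y)"
      by (rule sum.cong[OF refl]) (simp only: lessThan_iff a_def e_def sum.case fmul_apply y J_lift_xs)
    also have "(\<Sum>c\<in>C. (\<beta> x * ?c c) *\<^sub>R mk x g (\<beta> x *\<^sub>R M.rep U \<psi> x c) 0) = (\<Sum>c\<in>C. fmul (a (Inl c)) (e (Inl c)) y)"
      by (rule sum.cong[OF refl]) (simp only: a_def e_def sum.case fmul_apply y lift_apply o_apply fst_conv)
    also have "(\<Sum>c\<in>C. fmul (a (Inl c)) (e (Inl c)) y) + (\<Sum>j<p. fmul (a (Inr j)) (e (Inr j)) y)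
        = (\<Sum>i\<in>?I. fmul (a i) (e i) y)"
      unfolding sum.Plus[OF fin finite_lessThan] o_def ..
    finally show "fmul h X y = (\<Sum>i\<in>?I. fmul (a i) (e i)) y" unfolding sum_fun_apply[of _ _ y] .
  qed
  moreover have "h q \<noteq> 0" using \<beta>(2) by (simp add: h_def)
  ultimately show "\<exists>h (I :: ('e + nat) set) a e. (\<forall>y. P.sm h y) \<and> h q \<noteq> 0 \<and> finite I \<and>
      (\<forall>i\<in>I. e i \<in> gens \<and> (\<forall>y. P.sm (a i) y)) \<and> fmul h X = (\<Sum>i\<in>I. fmul (a i) (e i))"
    using h fin by (intro exI[of _ h] exI[of _ ?I] exI[of _ a] exI[of _ e]) auto
qed

text \<open>On a lift, J gives a smooth field by smoothness of \<eta>; on a generator that is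
  already J of a lift, J^2 = -I gives back the negative of the lift. The frame property extends this
  to all fields.\<close>

lemma J_tensor:
  assumes "P.frames gens"
  shows "tensor11 AB J"
proof -
  have "app_field J e \<in> vector_fields AB" if e: "e \<in> gens" for e
  proof -
    have "app_field J (app_field J Y) \<in> vector_fields AB" if Y: "Y \<in> vector_fields AB" for Y
    proof -
      have "app_field J (app_field J Y) = fmul (\<lambda>y. - 1) Y"
        using J_J[OF P.vf_tangent[OF Y]] by (intro ext) (simp add: P.app_field_apply)
      then show ?thesis using P.vf_fmul[OF Y P.sm_const] by simp
    qed
    then show ?thesis using e vf_lift vf_J_lift F.xs_vf by (auto simp: gens_def)
  qed
  then have "app_field J X \<in> vector_fields AB" if "X \<in> vector_fields AB" for X
    using P.vf_app_field_frames[OF assms J_tangent J_add J_scale _ that] by blast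
  then show ?thesis unfolding tensor11_def using J_tangent J_add J_scale by blast
qed

text \<open>Two lifts have a bracket without second component, and a lift with a J-image only
  differentiates coefficients. So the brackets of the frame appear solely in [J(lift X), J(lift Y)],
  with the coefficients s.\<close>

lemma nijenhuis_lift:
  assumes X: "X \<in> vector_fields A" and Y: "Y \<in> vector_fields A"
  shows "\<exists>s. nijenhuis AB J (lift X) (lift Y) (x, g) = mk x g (F.torsion X Y x)
      (\<Sum>j<p. (d_form A (F.\<eta> j) (app_field \<phi> X) Y x + d_form A (F.\<eta> j) X (app_field \<phi> Y) x + s j) *\<^sub>R ls j g)
    \<and> (\<Sum>j<p. \<Sum>i<p. (F.\<eta> j x (Y x) * F.\<eta> i x (X x)) *\<^sub>R lie_bracket B (ls i) (ls j) g) = (\<Sum>j<p. s j *\<^sub>R ls j g)"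
proof -
  define e where "e = (\<lambda>i x. F.\<eta> i x (X x))"
  define f where "f = (\<lambda>i x. F.\<eta> i x (Y x))"
  have e: "M.sm (e i) x" and f: "M.sm (f i) x" if "i < p" for i x
    unfolding e_def f_def by (rule F.sm_eta[OF that X], rule F.sm_eta[OF that Y])
  note pX = F.phi_vf[OF X] and pY = F.phi_vf[OF Y]
  have "(\<Sum>j<p. \<Sum>i<p. (f j x * e i x) *\<^sub>R lie_bracket B (ls i) (ls j) g) \<in> tangent_space B g"
    by (intro N.tangent_space_sum N.tangent_space_scale N.lie_bracket_tangent ls_vf) simp_all
  then obtain s where s: "(\<Sum>j<p. \<Sum>i<p. (f j x * e i x) *\<^sub>R lie_bracket B (ls i) (ls j) g) = (\<Sum>j<p. s j *\<^sub>R ls j g)"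
    using is_basis_coefficients[OF ls_basis] by blast
  \<comment> \<open>Instances of the hypothesis of \<open>lie_bracket_slift\<close> in which at
    least one field is a plain lift.\<close>
  have S0: "(\<Sum>j<p. \<Sum>i<p. (0 * e i x) *\<^sub>R lie_bracket B (ls i) (ls j) g) = (\<Sum>j<p. 0 *\<^sub>R ls j g)"
    "(\<Sum>j<p. \<Sum>i<p. (f j x * 0) *\<^sub>R lie_bracket B (ls i) (ls j) g) = (\<Sum>j<p. 0 *\<^sub>R ls j g)"
    "(\<Sum>j<p. \<Sum>i<p. (0 * 0) *\<^sub>R lie_bracket B (ls i) (ls j) g) = (\<Sum>j<p. 0 *\<^sub>R ls j g)" for e f
    by (simp_all only: mult_zero_left mult_zero_right scaleR_zero_left sum.neutral_const)
  note c = M.tv_const[OF M.vf_tangent[OF X]] M.tv_const[OF M.vf_tangent[OF Y]]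
    M.tv_const[OF M.vf_tangent[OF pX]] M.tv_const[OF M.vf_tangent[OF pY]]
  note JX = J_lift[OF X, folded e_def] and JY = J_lift[OF Y, folded f_def]
  note t = M.lie_bracket_tangent[OF X Y, of x] M.lie_bracket_tangent[OF pX Y, of x]
    M.lie_bracket_tangent[OF X pY, of x]
  have T0: "lie_bracket AB (lift X) (lift Y) (x, g) = mk x g (lie_bracket A X Y x) (\<Sum>j<p. 0 *\<^sub>R ls j g)"
    using lie_bracket_slift[OF X Y M.sm_const M.sm_const S0(3)] by (simp only: c diff_self add_0_right)
  have T1: "lie_bracket AB (app_field J (lift X)) (app_field J (lift Y)) (x, g) =
      mk x g (lie_bracket A (app_field \<phi> X) (app_field \<phi> Y) x)
        (\<Sum>j<p. (app_field \<phi> X x (f j) - app_field \<phi> Y x (e j) + s j) *\<^sub>R ls j g)"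
    unfolding JX JY by (rule lie_bracket_slift[OF pX pY e f s])
  have T2: "lie_bracket AB (app_field J (lift X)) (lift Y) (x, g) =
      mk x g (lie_bracket A (app_field \<phi> X) Y x) (\<Sum>j<p. (- Y x (e j)) *\<^sub>R ls j g)"
    unfolding JX using lie_bracket_slift[OF pX Y e M.sm_const S0(1)] by (simp only: c diff_0 add_0_right)
  have T3: "lie_bracket AB (lift X) (app_field J (lift Y)) (x, g) =
      mk x g (lie_bracket A X (app_field \<phi> Y) x) (\<Sum>j<p. X x (f j) *\<^sub>R ls j g)"
    unfolding JY using lie_bracket_slift[OF X pY M.sm_const f S0(2)] by (simp only: c diff_0_right add_0_right)
  \<comment> \<open>Since \<eta>_j \<circ> \<phi> = 0, one of the two derivative terms of each
    exterior derivative is the derivative of the zero function.\<close>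
  have d: "d_form A (F.\<eta> j) (app_field \<phi> X) Y x = app_field \<phi> X x (f j) - F.\<eta> j x (lie_bracket A (app_field \<phi> X) Y x)"
    "d_form A (F.\<eta> j) X (app_field \<phi> Y) x = - app_field \<phi> Y x (e j) - F.\<eta> j x (lie_bracket A X (app_field \<phi> Y) x)"
    if "j < p" for j
  proof -
    have "F.\<eta> j y (app_field \<phi> X y) = 0" "F.\<eta> j y (app_field \<phi> Y y) = 0" for y
      unfolding M.app_field_apply
      by (rule F.eta_phi[OF that M.vf_tangent[OF X]], rule F.eta_phi[OF that M.vf_tangent[OF Y]])
    then show "d_form A (F.\<eta> j) (app_field \<phi> X) Y x = app_field \<phi> X x (f j) - F.\<eta> j x (lie_bracket A (app_field \<phi> X) Y x)"
      "d_form A (F.\<eta> j) X (app_field \<phi> Y) x = - app_field \<phi> Y x (e j) - F.\<eta> j x (lie_bracket A X (app_field \<phi> Y) x)"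
      by (simp_all add: d_form_def c e_def f_def)
  qed
  \<comment> \<open>The second component: the terms \<eta>_j([\<phi> X, Y]) and
    \<eta>_j([X, \<phi> Y]) come from the outer J and complete the derivatives of the coefficients
    to exterior derivatives.\<close>
  have comb: "(\<Sum>j<p. 0 *\<^sub>R ls j g)
      + (\<Sum>j<p. (app_field \<phi> X x (f j) - app_field \<phi> Y x (e j) + s j) *\<^sub>R ls j g)
      - (\<Sum>j<p. F.\<eta> j x (lie_bracket A (app_field \<phi> X) Y x) *\<^sub>R ls j g)
      - (\<Sum>j<p. F.\<eta> j x (lie_bracket A X (app_field \<phi> Y) x) *\<^sub>R ls j g)
    = (\<Sum>j<p. (d_form A (F.\<eta> j) (app_field \<phi> X) Y x + d_form A (F.\<eta> j) X (app_field \<phi> Y) x + s j) *\<^sub>R ls j g)"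
    unfolding sum.distrib[symmetric] sum_subtractf[symmetric] scaleR_left_diff_distrib[symmetric] scaleR_add_left[symmetric]
    by (rule sum.cong[OF refl], rule arg_cong2[where f = scaleR]) (simp_all add: d)
  \<comment> \<open>In the use below k is \<eta>*([X, Y]). The outer J^2 yields -[X, Y], whereas
    \<phi>^2 yields k - [X, Y]; the surplus k is cancelled by the -k contained in d\<eta>*(X,
    Y).\<close>
  have grp: "- v + w - (a - - b) - (a' - b') = (k - v) + w - a - a' + ((b' - b) - k)"
    for v w a b a' b' k :: "'m tvec"
    by (simp add: algebra_simps)
  have "\<phi> x (\<phi> x (lie_bracket A X Y x)) = (\<Sum>j<p. F.\<eta> j x (lie_bracket A X Y x) *\<^sub>R xs j x) - lie_bracket A X Y x"
    unfolding F.eta_decomposition[OF t(1), symmetric] by (rule add_diff_cancel_left'[symmetric])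
  moreover have "d_eta_star A p \<phi> xs X Y x = (\<Sum>j<p. X x (f j) *\<^sub>R xs j x) - (\<Sum>j<p. Y x (e j) *\<^sub>R xs j x)
      - (\<Sum>j<p. F.\<eta> j x (lie_bracket A X Y x) *\<^sub>R xs j x)"
    unfolding d_eta_star_def d_form_def e_def f_def by (simp only: scaleR_left_diff_distrib sum_subtractf)
  moreover have "(\<Sum>j<p. (- Y x (e j)) *\<^sub>R xs j x) = - (\<Sum>j<p. Y x (e j) *\<^sub>R xs j x)"
    by (simp only: scaleR_minus_left sum_negf)
  moreover have "F.torsion X Y x = nijenhuis A \<phi> X Y x + d_eta_star A p \<phi> xs X Y x" by (rule plus_fun_apply)
  ultimately have tor: "- lie_bracket A X Y x + lie_bracket A (app_field \<phi> X) (app_field \<phi> Y) x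
      - (\<phi> x (lie_bracket A (app_field \<phi> X) Y x) - (\<Sum>j<p. (- Y x (e j)) *\<^sub>R xs j x))
      - (\<phi> x (lie_bracket A X (app_field \<phi> Y) x) - (\<Sum>j<p. X x (f j) *\<^sub>R xs j x)) = F.torsion X Y x"
    unfolding M.nijenhuis_apply by (simp only: grp)
  have m: "- (\<Sum>j<p. 0 *\<^sub>R ls j g) = (\<Sum>j<p. 0 *\<^sub>R ls j g)"
    by (simp only: scaleR_zero_left sum.neutral_const minus_zero)
  note JJ = J_J[OF mk_tangent[OF t(1) sum_ls_tangent]]
  have "nijenhuis AB J (lift X) (lift Y) (x, g) = mk x g (F.torsion X Y x)
      (\<Sum>j<p. (d_form A (F.\<eta> j) (app_field \<phi> X) Y x + d_form A (F.\<eta> j) X (app_field \<phi> Y) x + s j) *\<^sub>R ls j g)"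
    unfolding P.nijenhuis_apply T0 T1 T2 T3 JJ J_mk[OF t(2)] J_mk[OF t(3)] comb[symmetric] tor[symmetric]
      mk_diff mk_add mk_minus[symmetric] m by (rule refl)
  then show ?thesis using s unfolding e_def f_def by blast
qed

lemma torsion_if_normal:
  assumes "\<And>X Y. X \<in> vector_fields AB \<Longrightarrow> Y \<in> vector_fields AB \<Longrightarrow> nijenhuis AB J X Y = 0"
    and X: "X \<in> vector_fields A" and Y: "Y \<in> vector_fields A"
  shows "F.torsion X Y = 0"
proof
  fix x
  \<comment> \<open>Any point of the second factor will do, as the first component of the formula
    does not depend on it.\<close>
  fix g :: 'n
  obtain s where "nijenhuis AB J (lift X) (lift Y) (x, g) = mk x g (F.torsion X Y x)
      (\<Sum>j<p. (d_form A (F.\<eta> j) (app_field \<phi> X) Y x + d_form A (F.\<eta> j) X (app_field \<phi> Y) x + s j) *\<^sub>R ls j g)"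
    (is "_ = mk x g _ ?v")
    using nijenhuis_lift[OF X Y, of x g] by blast
  moreover have "nijenhuis AB J (lift X) (lift Y) (x, g) = 0"
    unfolding assms(1)[OF vf_lift[OF X] vf_lift[OF Y]] by (rule zero_fun_apply)
  ultimately have 0: "mk x g (F.torsion X Y x) ?v = mk x g 0 0" using mk_0 by metis
  have "d_eta_star A p \<phi> xs X Y x \<in> tangent_space A x" unfolding d_eta_star_def by (rule F.sum_xs_tangent)
  from M.tangent_space_add[OF M.nijenhuis_tangent[OF F.phi_tensor X Y] this]
  have t: "F.torsion X Y x \<in> tangent_space A x" by (subst plus_fun_apply)
  have "F.torsion X Y x = differential A fst (x, g) (mk x g (F.torsion X Y x) ?v)"
    by (rule differential_fst_mk[OF t sum_ls_tangent, symmetric])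
  also have "\<dots> = 0"
    unfolding 0 by (rule differential_fst_mk[OF M.tangent_space_0 N.tangent_space_0])
  also have "\<dots> = (0 :: 'm vfield) x" by (rule zero_fun_apply[symmetric])
  finally show "F.torsion X Y x = 0 x" .
qed

text \<open>For two lifts, vanishing frame brackets force s = 0 and \<open>d_form_phi_skew\<close>
  removes the rest. J in the first argument is taken out by \<open>nijenhuis_J_left\<close>, J in
  the second by skew symmetry; these cases exhaust all pairs of generators.\<close>

lemma normal_if_torsion:
  assumes frames: "P.frames gens"
    and 0: "\<And>X Y. X \<in> vector_fields A \<Longrightarrow> Y \<in> vector_fields A \<Longrightarrow> F.torsion X Y = 0"
    and ls: "\<And>i j. i < p \<Longrightarrow> j < p \<Longrightarrow> lie_bracket B (ls i) (ls j) = 0"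
    and "X \<in> vector_fields AB" "Y \<in> vector_fields AB"
  shows "nijenhuis AB J X Y = 0"
proof (rule P.nijenhuis_0_frames[OF frames J_tensor[OF frames] _ assms(4,5)])
  note J = J_tensor[OF frames]
  have ll: "nijenhuis AB J (lift X) (lift Y) = 0" if X: "X \<in> vector_fields A" and Y: "Y \<in> vector_fields A" for X Y
  proof
    fix q :: "'m \<times> 'n"
    obtain x g where q: "q = (x, g)" by (cases q)
    obtain s where s: "nijenhuis AB J (lift X) (lift Y) (x, g) = mk x g (F.torsion X Y x)
      (\<Sum>j<p. (d_form A (F.\<eta> j) (app_field \<phi> X) Y x + d_form A (F.\<eta> j) X (app_field \<phi> Y) x + s j) *\<^sub>R ls j g)"
     and "(\<Sum>j<p. \<Sum>i<p. (F.\<eta> j x (Y x) * F.\<eta> i x (X x)) *\<^sub>R lie_bracket B (ls i) (ls j) g) = (\<Sum>j<p. s j *\<^sub>R ls j g)"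
      using nijenhuis_lift[OF X Y, of x g] by blast
    moreover have "(\<Sum>j<p. \<Sum>i<p. (F.\<eta> j x (Y x) * F.\<eta> i x (X x)) *\<^sub>R lie_bracket B (ls i) (ls j) g) = 0"
      by (intro sum.neutral ballI) (simp add: ls fun_eq_iff)
    ultimately have "(\<Sum>j<p. s j *\<^sub>R ls j g) = 0" by metis
    then have "s j = 0" if "j < p" for j by (rule is_basis_independent[OF ls_basis _ that])
    then have "(\<Sum>j<p. (d_form A (F.\<eta> j) (app_field \<phi> X) Y x + d_form A (F.\<eta> j) X (app_field \<phi> Y) x + s j) *\<^sub>R ls j g)
        = (\<Sum>j<p. 0 *\<^sub>R ls j g)"
      by (intro sum.cong refl arg_cong2[where f = scaleR]) (simp only: F.d_form_phi_skew[OF _ X Y 0] lessThan_iff add_0_right)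
    then have "nijenhuis AB J (lift X) (lift Y) (x, g) = mk x g 0 0"
      unfolding s 0[OF X Y] zero_fun_apply[of x] by (simp only: scaleR_zero_left sum.neutral_const)
    then show "nijenhuis AB J (lift X) (lift Y) q = 0 q" unfolding q mk_0 zero_fun_apply[of "(x, g)"] .
  qed
  have Jl: "nijenhuis AB J (app_field J X) Y = 0"
    if X: "X \<in> vector_fields AB" and Y: "Y \<in> vector_fields AB" and 0: "nijenhuis AB J X Y = 0" for X Y
  proof
    fix q
    have "nijenhuis AB J (app_field J X) Y q = - J q (nijenhuis AB J X Y q)"
      by (rule P.nijenhuis_J_left[OF J J_J X Y])
    also have "\<dots> = - J q (0 q)" unfolding 0 by (rule refl)
    also have "\<dots> = 0 q" unfolding zero_fun_apply[of q] P.tensor11_0[OF J] by (rule minus_zero)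
    finally show "nijenhuis AB J (app_field J X) Y q = 0 q" .
  qed
  have skew: "nijenhuis AB J X Y = 0" if "X \<in> vector_fields AB" "Y \<in> vector_fields AB" "nijenhuis AB J Y X = 0" for X Y
    unfolding P.nijenhuis_skew[OF J that(1,2)] that(3) by (rule minus_zero)
  have lJ: "nijenhuis AB J (lift X) (app_field J (lift Y)) = 0"
    if X: "X \<in> vector_fields A" and Y: "Y \<in> vector_fields A" for X Y
    by (rule skew[OF vf_lift[OF X] vf_J_lift[OF Y] Jl[OF vf_lift[OF Y] vf_lift[OF X] ll[OF Y X]]])
  have l: "nijenhuis AB J (lift X) e = 0" if "X \<in> vector_fields A" "e \<in> gens" for X e
    using that(2) ll[OF that(1)] lJ[OF that(1) F.xs_vf] unfolding gens_def by blast
  fix e e' assume e: "e \<in> gens" and e': "e' \<in> gens"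
  then have vf: "e' \<in> vector_fields AB" using gens_vf by blast
  show "nijenhuis AB J e e' = 0"
    using e l[OF _ e'] Jl[OF vf_lift[OF F.xs_vf] vf l[OF F.xs_vf e']] unfolding gens_def by blast
qed

end

theorem theorem1:
  fixes A :: "('m::{t2_space,second_countable_topology}, 'e::{real_inner,heine_borel}) atlas"
    and B :: "('g::{t2_space,second_countable_topology}, 'h::{real_inner,heine_borel}) atlas"
    and n p :: nat
    and \<phi> :: "'m \<Rightarrow> 'm tvec \<Rightarrow> 'm tvec"
    and br :: "'l::real_vector \<Rightarrow> 'l \<Rightarrow> 'l"
    and \<xi> :: "nat \<Rightarrow> 'l"
    and star :: "'l \<Rightarrow> 'm vfield"
    and mul :: "'g \<Rightarrow> 'g \<Rightarrow> 'g"
    and L :: "'l \<Rightarrow> 'g vfield"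
  assumes "smooth_manifold (2 * n + p) A"
    and "fpkg_structure A p \<phi> br \<xi> star"
  shows "(lie_group p B mul \<and> simply_connected (UNIV :: 'g set) \<and> lie_algebra_of_group B mul br L
           \<longrightarrow> (normal_fpkg A B p \<phi> \<xi> star L \<longleftrightarrow>
             (\<forall>Z\<in>vector_fields A. \<forall>T\<in>vector_fields A.
                nijenhuis A \<phi> Z T + d_eta_star A p \<phi> (\<lambda>i. star (\<xi> i)) Z T = 0)))
         \<and> ((\<forall>Z\<in>vector_fields A. \<forall>T\<in>vector_fields A.
                nijenhuis A \<phi> Z T + d_eta_star A p \<phi> (\<lambda>i. star (\<xi> i)) Z T = 0)
           \<longrightarrow> abelian_lie_algebra br)"
proof -
  let ?tor = "\<lambda>Z T. nijenhuis A \<phi> Z T + d_eta_star A p \<phi> (\<lambda>i. star (\<xi> i)) Z T"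
  obtain C d where M: "mfd A C d" using smooth_manifold_mfd[OF assms(1)] .
  \<comment> \<open>Proved before a Lie group is given: the final claim speaks of the Lie algebra
    alone, and the equivalence needs it to make the brackets of the left-invariant frame
    vanish.\<close>
  have abelian: "br a b = 0" if "\<forall>Z\<in>vector_fields A. \<forall>T\<in>vector_fields A. ?tor Z T = 0" for a b
    by (rule fpkg_abelian[OF M assms(2)]) (use that in blast)
  have "normal_fpkg A B p \<phi> \<xi> star L \<longleftrightarrow> (\<forall>Z\<in>vector_fields A. \<forall>T\<in>vector_fields A. ?tor Z T = 0)"
    if G: "lie_group p B mul" and L: "lie_algebra_of_group B mul br L"
  proof -
    have \<xi>: "is_basis p UNIV \<xi>" using assms(2) by (simp add: fpkg_structure_def)
    obtain C' d' where N: "mfd B C' d'" using smooth_manifold_mfd G unfolding lie_group_def by blast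
    obtain C'' d'' where P: "mfd (prod_atlas A B) C'' d''" using mfd_prod[OF M N] .
    have F: "fpk A C d p \<phi> (\<lambda>i. star (\<xi> i))"
      by (intro fpk.intro fpk_axioms.intro M) (use assms(2) in \<open>simp add: fpkg_structure_def\<close>)
    have ls: "L a \<in> vector_fields B" "linear L" "L (br a b) = lie_bracket B (L a) (L b)" for a b
      using L by (auto simp: lie_algebra_of_group_def bij_betw_def left_invariant_fields_def)
    interpret fpk_prod A C d B C' d' C'' d'' p \<phi> "\<lambda>i. star (\<xi> i)" "\<lambda>i. L (\<xi> i)"
      by (intro fpk_prod.intro prod_mfd.intro fpk_prod_axioms.intro M N P F ls(1)
          left_invariant_basis[OF G L \<xi>])
    have normal: "normal_fpkg A B p \<phi> \<xi> star L \<longleftrightarrow>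
        (\<forall>X\<in>vector_fields AB. \<forall>Y\<in>vector_fields AB. nijenhuis AB J X Y = 0)"
      by (simp only: normal_fpkg_def Let_def)
    have "\<exists>K \<beta>. closed K \<and> K \<subseteq> U \<and> (\<forall>y. M.sm \<beta> y) \<and> \<beta> x \<noteq> 0 \<and> (\<forall>y. y \<notin> K \<longrightarrow> \<beta> y = 0)"
      if "(U, \<psi>) \<in> A" "x \<in> U" for U \<psi> x
      by (rule bump_exists[OF M that]) blast
    then have frames: "P.frames gens" by (rule frames_gens)
    have "lie_bracket B (L (\<xi> i)) (L (\<xi> j)) = 0"
      if "\<forall>Z\<in>vector_fields A. \<forall>T\<in>vector_fields A. ?tor Z T = 0" for i j
      unfolding ls(3)[symmetric] abelian[OF that] by (rule linear_0[OF ls(2)])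
    then show ?thesis
      unfolding normal using torsion_if_normal normal_if_torsion[OF frames] by blast
  qed
  then show ?thesis using abelian unfolding abelian_lie_algebra_def by blast
qed

end
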